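(* Let $q\in\mathbb{C}\setminus\{0\}$ be not a root of unity. Let $\mathcal{S}$ be the set of all $U_q(\mathfrak{sl}_2)$-module algebra structures on the quantum plane $\mathbb{C}_q[x,y]$ such that $$(\mathsf{e}(x))_0=0,\quad(\mathsf{e}(y))_0=0,\quad(\mathsf{f}(x))_0\ne 0,\quad(\mathsf{f}(y))_0=0,$$ $$(\mathsf{e}(x))_1=(\mathsf{e}(y))_1=(\mathsf{f}(x))_1=(\mathsf{f}(y))_1=0 .$$ Then $\mathcal{S}$ consists of exactly the one-parameter family, indexed by $c_0\in\mathbb{C}\setminus\{0\}$, of structures given by $$\mathsf{k}(x)=q^2x,\quad \mathsf{k}(y)=q^{-1}y,\quad \mathsf{e}(x)=-qc_0^{-1}x^2,\quad \mathsf{e}(y)=c_0^{-1}xy,\quad \mathsf{f}(x)=c_0,\quad \mathsf{f}(y)=0 .$$ (Each $c_0\ne 0$ gives a well-defined structure.) All these structures are isomorphic, in particular to the one with $c_0=1$.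
   Context: The quantum plane $\mathbb{C}_q[x,y]$ is the unital associative $\mathbb{C}$-algebra with generators $x,y$ and the single relation $yx=qxy$; the monomials $x^my^n$ ($m,n\ge 0$) form a basis. Its $i$-th homogeneous component is the linear span of the $x^my^n$ with $m+n=i$; for a polynomial $p$, $(p)_i$ denotes the projection of $p$ to the $i$-th homogeneous component (parallel to the other components). $U_q(\mathfrak{sl}_2)$ is the unital associative $\mathbb{C}$-algebra with generators $\mathsf{k},\mathsf{k}^{-1},\mathsf{e},\mathsf{f}$ and relations $\mathsf{k}^{-1}\mathsf{k}=\mathsf{k}\mathsf{k}^{-1}=\mathbf{1}$, $\mathsf{k}\mathsf{e}=q^2\mathsf{e}\mathsf{k}$, $\mathsf{k}\mathsf{f}=q^{-2}\mathsf{f}\mathsf{k}$, $\mathsf{e}\mathsf{f}-\mathsf{f}\mathsf{e}=\frac{\mathsf{k}-\mathsf{k}^{-1}}{q-q^{-1}}$, with Hopf algebra structure $\Delta(\mathsf{k})=\mathsf{k}\otimes\mathsf{k}$, $\Delta(\mathsf{e})=\mathbf{1}\otimes\mathsf{e}+\mathsf{e}\otimes\mathsf{k}$, $\Delta(\mathsf{f})=\mathsf{f}\otimes\mathbf{1}+\mathsf{k}^{-1}\otimes\mathsf{f}$, $\varepsilon(\mathsf{k})=1$, $\varepsilon(\mathsf{e})=\varepsilon(\mathsf{f})=0$, $S(\mathsf{k})=\mathsf{k}^{-1}$, $S(\mathsf{e})=-\mathsf{e}\mathsf{k}^{-1}$, $S(\mathsf{f})=-\mathsf{k}\mathsf{f}$.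 For a Hopf algebra $H$ and a unital algebra $A$, a structure of $H$-module algebra on $A$ is an algebra homomorphism $\pi:H\to\operatorname{End}_{\mathbb{C}}A$ such that $\pi(h)(ab)=\sum_i\pi(h_i')(a)\,\pi(h_i'')(b)$ (where $\Delta(h)=\sum_i h_i'\otimes h_i''$) and $\pi(h)(\mathbf{1})=\varepsilon(h)\mathbf{1}$ for all $h\in H$, $a,b\in A$. One writes $h(a)$ for $\pi(h)(a)$. A structure on $\mathbb{C}_q[x,y]$ is uniquely determined by the values of $\mathsf{k},\mathsf{e},\mathsf{f}$ on $x,y$. Structures $\pi_1,\pi_2$ are isomorphic if there is an algebra automorphism $\Psi$ of $A$ with $\Psi\pi_1(h)\Psi^{-1}=\pi_2(h)$ for all $h\in H$. *)

theory Defs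
  imports
    Complex_Main
    "HOL-Library.FuncSet"
    "HOL-Library.Poly_Mapping"
    "HOL-Algebra.QuotRing"
    "HOL-Algebra.Module"
begin

section \<open>Unital associative complex algebras\<close>

text \<open>
  The locale \<^locale>\<open>algebra\<close> covers commutative algebras only, so a complex algebra is
  given here by a \<open>module\<close> record with scalars of type \<^typ>\<open>complex\<close>; its elements are those
  of the carrier.
\<close>

type_synonym 'a calg = "(complex, 'a) module"

definition alg_hom :: "'a calg \<Rightarrow> 'b calg \<Rightarrow> ('a \<Rightarrow> 'b) set" where
  "alg_hom A B = {h \<in> ring_hom A B.
     \<forall>c. \<forall>a \<in> carrier A. h (c \<odot>\<^bsub>A\<^esub> a) = c \<odot>\<^bsub>B\<^esub> h a}"

definition complex_alg :: "complex calg" where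
  "complex_alg = \<lparr>carrier = UNIV, mult = (*), one = 1, zero = 0, add = (+), smult = (*)\<rparr>"

definition End_alg :: "'a calg \<Rightarrow> ('a \<Rightarrow> 'a) calg" where
  "End_alg A =
    \<lparr>carrier = {T \<in> carrier A \<rightarrow>\<^sub>E carrier A.
        (\<forall>a \<in> carrier A. \<forall>b \<in> carrier A. T (a \<oplus>\<^bsub>A\<^esub> b) = T a \<oplus>\<^bsub>A\<^esub> T b) \<and>
        (\<forall>c. \<forall>a \<in> carrier A. T (c \<odot>\<^bsub>A\<^esub> a) = c \<odot>\<^bsub>A\<^esub> T a)},
     mult = compose (carrier A),
     one = (\<lambda>a \<in> carrier A. a),
     zero = (\<lambda>a \<in> carrier A. \<zero>\<^bsub>A\<^esub>),
     add = (\<lambda>S T. \<lambda>a \<in> carrier A. S a \<oplus>\<^bsub>A\<^esub> T a),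
     smult = (\<lambda>c T. \<lambda>a \<in> carrier A. c \<odot>\<^bsub>A\<^esub> T a)\<rparr>"

text \<open>
  For a two-sided ideal \<open>I\<close> of a unital algebra, \<open>I\<close> is a linear subspace and the quotient
  ring inherits the scalar multiplication.
\<close>

definition quot_alg :: "'a calg \<Rightarrow> 'a set \<Rightarrow> 'a set calg" where
  "quot_alg A I =
    \<lparr>carrier = carrier (A Quot I), mult = mult (A Quot I), one = one (A Quot I),
     zero = zero (A Quot I), add = add (A Quot I),
     smult = (\<lambda>c X. \<Union>a \<in> X. I +>\<^bsub>A\<^esub> (c \<odot>\<^bsub>A\<^esub> a))\<rparr>"

text \<open>
  The monoid algebra of \<open>M\<close>: the vector space with basis \<^term>\<open>carrier M\<close>, with the product of
  \<open>M\<close> extended bilinearly. The basis element \<open>u\<close> is \<^term>\<open>Poly_Mapping.single u 1\<close>.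
\<close>

definition monoid_alg :: "('m, 'z) monoid_scheme \<Rightarrow> ('m \<Rightarrow>\<^sub>0 complex) calg" where
  "monoid_alg M =
    \<lparr>carrier = {p. Poly_Mapping.keys p \<subseteq> carrier M},
     mult = (\<lambda>p r. \<Sum>u \<in> Poly_Mapping.keys p. \<Sum>v \<in> Poly_Mapping.keys r.
        Poly_Mapping.single (u \<otimes>\<^bsub>M\<^esub> v) (Poly_Mapping.lookup p u * Poly_Mapping.lookup r v)),
     one = Poly_Mapping.single \<one>\<^bsub>M\<^esub> 1,
     zero = 0,
     add = (+),
     smult = (\<lambda>c. Poly_Mapping.map ((*) c))\<rparr>"


section \<open>Presentations by generators and relations\<close>

definition list_monoid :: "'g list monoid" where
  "list_monoid = \<lparr>carrier = UNIV, mult = (@), one = []\<rparr>"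

definition free_alg :: "('g list \<Rightarrow>\<^sub>0 complex) calg" where
  "free_alg = monoid_alg list_monoid"

text \<open>\<open>R\<close> is the set of elements of the free algebra that become zero.\<close>

definition presented_alg :: "('g list \<Rightarrow>\<^sub>0 complex) set \<Rightarrow> ('g list \<Rightarrow>\<^sub>0 complex) set calg" where
  "presented_alg R = quot_alg free_alg (Idl\<^bsub>free_alg\<^esub> R)"

definition presented_gen :: "('g list \<Rightarrow>\<^sub>0 complex) set \<Rightarrow> 'g \<Rightarrow> ('g list \<Rightarrow>\<^sub>0 complex) set" where
  "presented_gen R g = (Idl\<^bsub>free_alg\<^esub> R) +>\<^bsub>free_alg\<^esub> Poly_Mapping.single [g] 1"

text \<open>The algebra homomorphism out of a presented algebra with prescribed values on generators.\<close>

definition presented_hom ::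
  "('g list \<Rightarrow>\<^sub>0 complex) set \<Rightarrow> 'b calg \<Rightarrow> ('g \<Rightarrow> 'b) \<Rightarrow> (('g list \<Rightarrow>\<^sub>0 complex) set \<Rightarrow> 'b)" where
  "presented_hom R B v = (THE h. h \<in> alg_hom (presented_alg R) B \<and>
     h \<in> extensional (carrier (presented_alg R)) \<and> (\<forall>g. h (presented_gen R g) = v g))"


section \<open>Tensor products of algebras\<close>

text \<open>
  The tensor product is the free vector space on pairs modulo the bilinearity relations. The
  free vector space carries the product \<open>(a, b) (a', b') = (a a', b b')\<close>, for which the span of
  the bilinearity relations is already a two-sided ideal.
\<close>

definition bilinear_rels :: "'a calg \<Rightarrow> 'b calg \<Rightarrow> ('a \<times> 'b \<Rightarrow>\<^sub>0 complex) set" where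
  "bilinear_rels A B =
     {Poly_Mapping.single (a \<oplus>\<^bsub>A\<^esub> a', b) 1
        - Poly_Mapping.single (a, b) 1 - Poly_Mapping.single (a', b) 1
      | a a' b. a \<in> carrier A \<and> a' \<in> carrier A \<and> b \<in> carrier B} \<union>
     {Poly_Mapping.single (a, b \<oplus>\<^bsub>B\<^esub> b') 1
        - Poly_Mapping.single (a, b) 1 - Poly_Mapping.single (a, b') 1
      | a b b'. a \<in> carrier A \<and> b \<in> carrier B \<and> b' \<in> carrier B} \<union>
     {Poly_Mapping.single (c \<odot>\<^bsub>A\<^esub> a, b) 1 - Poly_Mapping.single (a, b) c
      | c a b. a \<in> carrier A \<and> b \<in> carrier B} \<union>
     {Poly_Mapping.single (a, c \<odot>\<^bsub>B\<^esub> b) 1 - Poly_Mapping.single (a, b) c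
      | c a b. a \<in> carrier A \<and> b \<in> carrier B}"

definition tensor_ideal :: "'a calg \<Rightarrow> 'b calg \<Rightarrow> ('a \<times> 'b \<Rightarrow>\<^sub>0 complex) set" where
  "tensor_ideal A B = Idl\<^bsub>monoid_alg (A \<times>\<times> B)\<^esub> (bilinear_rels A B)"

definition tensor_alg :: "'a calg \<Rightarrow> 'b calg \<Rightarrow> ('a \<times> 'b \<Rightarrow>\<^sub>0 complex) set calg" where
  "tensor_alg A B = quot_alg (monoid_alg (A \<times>\<times> B)) (tensor_ideal A B)"

definition pure_tensor ::
  "'a calg \<Rightarrow> 'b calg \<Rightarrow> 'a \<Rightarrow> 'b \<Rightarrow> ('a \<times> 'b \<Rightarrow>\<^sub>0 complex) set" where
  "pure_tensor A B a b =
     tensor_ideal A B +>\<^bsub>monoid_alg (A \<times>\<times> B)\<^esub> Poly_Mapping.single (a, b) 1"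


section \<open>Module algebras\<close>

text \<open>
  Only the algebra \<open>H\<close>, the comultiplication \<open>D\<close> and the counit \<open>\<epsilon>\<close> of a Hopf algebra enter; the
  antipode does not. The condition on products is imposed for every way of writing \<open>D h\<close> as a
  finite sum of pure tensors. Structures are extensional, so that equality of structures is
  equality on \<^term>\<open>carrier H\<close>.
\<close>

definition module_algebra_structures ::
  "'h calg \<Rightarrow> ('h \<Rightarrow> ('h \<times> 'h \<Rightarrow>\<^sub>0 complex) set) \<Rightarrow> ('h \<Rightarrow> complex) \<Rightarrow> 'a calg
    \<Rightarrow> ('h \<Rightarrow> 'a \<Rightarrow> 'a) set" where
  "module_algebra_structures H D \<epsilon> A =
    {\<pi> \<in> alg_hom H (End_alg A). \<pi> \<in> extensional (carrier H) \<and>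
      (\<forall>h \<in> carrier H. \<forall>(n::nat) u v.
        (\<forall>i<n. u i \<in> carrier H \<and> v i \<in> carrier H) \<and>
        D h = (\<Oplus>\<^bsub>tensor_alg H H\<^esub> i \<in> {..<n}. pure_tensor H H (u i) (v i)) \<longrightarrow>
        (\<forall>a \<in> carrier A. \<forall>b \<in> carrier A.
          \<pi> h (a \<otimes>\<^bsub>A\<^esub> b) = (\<Oplus>\<^bsub>A\<^esub> i \<in> {..<n}. \<pi> (u i) a \<otimes>\<^bsub>A\<^esub> \<pi> (v i) b))) \<and>
      (\<forall>h \<in> carrier H. \<pi> h \<one>\<^bsub>A\<^esub> = \<epsilon> h \<odot>\<^bsub>A\<^esub> \<one>\<^bsub>A\<^esub>)}"

definition isomorphic_structures ::
  "'h calg \<Rightarrow> 'a calg \<Rightarrow> ('h \<Rightarrow> 'a \<Rightarrow> 'a) \<Rightarrow> ('h \<Rightarrow> 'a \<Rightarrow> 'a) \<Rightarrow> bool" where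
  "isomorphic_structures H A \<pi>\<^sub>1 \<pi>\<^sub>2 \<longleftrightarrow>
    (\<exists>\<Psi> \<in> alg_hom A A. bij_betw \<Psi> (carrier A) (carrier A) \<and>
      (\<forall>h \<in> carrier H. \<forall>a \<in> carrier A.
        \<Psi> (\<pi>\<^sub>1 h (inv_into (carrier A) \<Psi> a)) = \<pi>\<^sub>2 h a))"


section \<open>The quantum plane\<close>

datatype qp_gen = Gx | Gy

definition qp_rels :: "complex \<Rightarrow> (qp_gen list \<Rightarrow>\<^sub>0 complex) set" where
  "qp_rels q = {Poly_Mapping.single [Gy, Gx] 1 - Poly_Mapping.single [Gx, Gy] q}"

definition qplane :: "complex \<Rightarrow> (qp_gen list \<Rightarrow>\<^sub>0 complex) set calg" where
  "qplane q = presented_alg (qp_rels q)"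

definition qx :: "complex \<Rightarrow> (qp_gen list \<Rightarrow>\<^sub>0 complex) set" where
  "qx q = presented_gen (qp_rels q) Gx"

definition qy :: "complex \<Rightarrow> (qp_gen list \<Rightarrow>\<^sub>0 complex) set" where
  "qy q = presented_gen (qp_rels q) Gy"

text \<open>The linear span of the monomials \<open>x\<^sup>m y\<^sup>n\<close> with \<open>m + n = i\<close>.\<close>

definition qp_homog :: "complex \<Rightarrow> nat \<Rightarrow> (qp_gen list \<Rightarrow>\<^sub>0 complex) set set" where
  "qp_homog q i =
    {\<Oplus>\<^bsub>qplane q\<^esub> m \<in> {..i}.
        c m \<odot>\<^bsub>qplane q\<^esub> (qx q [^]\<^bsub>qplane q\<^esub> m \<otimes>\<^bsub>qplane q\<^esub> qy q [^]\<^bsub>qplane q\<^esub> (i - m))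
     | c. True}"

text \<open>The component in degree \<open>i\<close> of a decomposition of \<open>p\<close> into homogeneous components.\<close>

definition qp_proj ::
  "complex \<Rightarrow> nat \<Rightarrow> (qp_gen list \<Rightarrow>\<^sub>0 complex) set \<Rightarrow> (qp_gen list \<Rightarrow>\<^sub>0 complex) set" where
  "qp_proj q i p = (THE r. \<exists>u.
     (\<forall>j. u j \<in> qp_homog q j) \<and> finite {j. u j \<noteq> \<zero>\<^bsub>qplane q\<^esub>} \<and>
     p = (\<Oplus>\<^bsub>qplane q\<^esub> j \<in> {j. u j \<noteq> \<zero>\<^bsub>qplane q\<^esub>}. u j) \<and> r = u i)"


section \<open>The quantum universal enveloping algebra of sl2\<close>

datatype uq_gen = Gk | Gkinv | Ge | Gf

definition uq_rels :: "complex \<Rightarrow> (uq_gen list \<Rightarrow>\<^sub>0 complex) set" where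
  "uq_rels q =
    {Poly_Mapping.single [Gkinv, Gk] 1 - Poly_Mapping.single [] 1,
     Poly_Mapping.single [Gk, Gkinv] 1 - Poly_Mapping.single [] 1,
     Poly_Mapping.single [Gk, Ge] 1 - Poly_Mapping.single [Ge, Gk] (q\<^sup>2),
     Poly_Mapping.single [Gk, Gf] 1 - Poly_Mapping.single [Gf, Gk] (inverse (q\<^sup>2)),
     Poly_Mapping.single [Ge, Gf] 1 - Poly_Mapping.single [Gf, Ge] 1
       - (Poly_Mapping.single [Gk] (1 / (q - inverse q))
          - Poly_Mapping.single [Gkinv] (1 / (q - inverse q)))}"

definition uq :: "complex \<Rightarrow> (uq_gen list \<Rightarrow>\<^sub>0 complex) set calg" where
  "uq q = presented_alg (uq_rels q)"

definition uk :: "complex \<Rightarrow> (uq_gen list \<Rightarrow>\<^sub>0 complex) set" where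
  "uk q = presented_gen (uq_rels q) Gk"

definition ukinv :: "complex \<Rightarrow> (uq_gen list \<Rightarrow>\<^sub>0 complex) set" where
  "ukinv q = presented_gen (uq_rels q) Gkinv"

definition ue :: "complex \<Rightarrow> (uq_gen list \<Rightarrow>\<^sub>0 complex) set" where
  "ue q = presented_gen (uq_rels q) Ge"

definition uf :: "complex \<Rightarrow> (uq_gen list \<Rightarrow>\<^sub>0 complex) set" where
  "uf q = presented_gen (uq_rels q) Gf"

text \<open>The values at the inverse of \<open>k\<close> are forced by those at \<open>k\<close>.\<close>

definition uq_comult ::
  "complex \<Rightarrow> (uq_gen list \<Rightarrow>\<^sub>0 complex) set
    \<Rightarrow> ((uq_gen list \<Rightarrow>\<^sub>0 complex) set \<times> (uq_gen list \<Rightarrow>\<^sub>0 complex) set \<Rightarrow>\<^sub>0 complex) set" where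
  "uq_comult q =
    (let H = uq q; HH = tensor_alg H H; t = pure_tensor H H in
     presented_hom (uq_rels q) HH
       (\<lambda>g. case g of
          Gk \<Rightarrow> t (uk q) (uk q)
        | Gkinv \<Rightarrow> t (ukinv q) (ukinv q)
        | Ge \<Rightarrow> t \<one>\<^bsub>H\<^esub> (ue q) \<oplus>\<^bsub>HH\<^esub> t (ue q) (uk q)
        | Gf \<Rightarrow> t (uf q) \<one>\<^bsub>H\<^esub> \<oplus>\<^bsub>HH\<^esub> t (ukinv q) (uf q)))"

definition uq_counit :: "complex \<Rightarrow> (uq_gen list \<Rightarrow>\<^sub>0 complex) set \<Rightarrow> complex" where
  "uq_counit q =
     presented_hom (uq_rels q) complex_alg
       (\<lambda>g. case g of Gk \<Rightarrow> 1 | Gkinv \<Rightarrow> 1 | Ge \<Rightarrow> 0 | Gf \<Rightarrow> 0)"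


section \<open>Structures on the quantum plane\<close>

type_synonym qp_action =
  "(uq_gen list \<Rightarrow>\<^sub>0 complex) set \<Rightarrow> (qp_gen list \<Rightarrow>\<^sub>0 complex) set \<Rightarrow> (qp_gen list \<Rightarrow>\<^sub>0 complex) set"

definition qp_structures :: "complex \<Rightarrow> qp_action set" where
  "qp_structures q = module_algebra_structures (uq q) (uq_comult q) (uq_counit q) (qplane q)"

definition family_values :: "complex \<Rightarrow> complex \<Rightarrow> qp_action \<Rightarrow> bool" where
  "family_values q c \<pi> \<longleftrightarrow>
    (let A = qplane q; x = qx q; y = qy q in
     \<pi> (uk q) x = q\<^sup>2 \<odot>\<^bsub>A\<^esub> x \<and>
     \<pi> (uk q) y = inverse q \<odot>\<^bsub>A\<^esub> y \<and>
     \<pi> (ue q) x = (- q * inverse c) \<odot>\<^bsub>A\<^esub> (x [^]\<^bsub>A\<^esub> (2::nat)) \<and>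
     \<pi> (ue q) y = inverse c \<odot>\<^bsub>A\<^esub> (x \<otimes>\<^bsub>A\<^esub> y) \<and>
     \<pi> (uf q) x = c \<odot>\<^bsub>A\<^esub> \<one>\<^bsub>A\<^esub> \<and>
     \<pi> (uf q) y = \<zero>\<^bsub>A\<^esub>)"

definition family_structure :: "complex \<Rightarrow> complex \<Rightarrow> qp_action" where
  "family_structure q c = (THE \<pi>. \<pi> \<in> qp_structures q \<and> family_values q c \<pi>)"

definition special_structures :: "complex \<Rightarrow> qp_action set" where
  "special_structures q = {\<pi> \<in> qp_structures q.
     qp_proj q 0 (\<pi> (ue q) (qx q)) = \<zero>\<^bsub>qplane q\<^esub> \<and>
     qp_proj q 0 (\<pi> (ue q) (qy q)) = \<zero>\<^bsub>qplane q\<^esub> \<and>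
     qp_proj q 0 (\<pi> (uf q) (qx q)) \<noteq> \<zero>\<^bsub>qplane q\<^esub> \<and>
     qp_proj q 0 (\<pi> (uf q) (qy q)) = \<zero>\<^bsub>qplane q\<^esub> \<and>
     qp_proj q 1 (\<pi> (ue q) (qx q)) = \<zero>\<^bsub>qplane q\<^esub> \<and>
     qp_proj q 1 (\<pi> (ue q) (qy q)) = \<zero>\<^bsub>qplane q\<^esub> \<and>
     qp_proj q 1 (\<pi> (uf q) (qx q)) = \<zero>\<^bsub>qplane q\<^esub> \<and>
     qp_proj q 1 (\<pi> (uf q) (qy q)) = \<zero>\<^bsub>qplane q\<^esub>}"

end

theory Submission
  imports Defs "HOL-Library.Product_Lexorder"
begin

text \<open>
  The proof has a formal part, which turns structures into operators on polynomials, and a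
  computational part, which classifies the operators.

  Formal part. Sorting words by the rule \<open>y x = q x y\<close> shows that the monomials \<open>x^m y^n\<close> span the
  quantum plane; they are independent because the plane maps onto the algebra of finitely supported
  functions on pairs of exponents with product \<open>(x^a y^b)(x^c y^d) = q^(bc) x^(a+c) y^(b+d)\<close> (\<open>coords\<close>
  and \<open>of_coords\<close>). In these coordinates a module algebra structure is a quadruple of linear
  operators \<open>k, k', e, f\<close> that satisfy the defining relations of the quantum enveloping algebra and
  the product rules dictated by the comultiplication: \<open>k\<close> and \<open>k'\<close> are multiplicative,
  \<open>e(ab) = a e(b) + e(a) k(b)\<close> and \<open>f(ab) = f(a) b + k'(a) f(b)\<close> (locale \<open>quantum_plane_action\<close>,
  lemmas \<open>qp_structures_action\<close> and \<open>action_structure\<close>). The rules for all elements follow from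
  those for the generators because the comultiplication is multiplicative, and they do not depend on
  how a comultiplication is written as a sum of pure tensors because bilinear maps factor through the
  tensor product (\<open>bilinear_factors\<close>).

  Computational part. As \<open>q\<close> is not a root of unity, \<open>k\<close> only rescales \<open>x\<close> and \<open>y\<close>
  (\<open>automorphism_diagonal\<close>). If \<open>f(x)\<close> has constant term \<open>c \<noteq> 0\<close>, then \<open>k f = q^(-2) f k\<close> on \<open>x\<close> forces
  \<open>k(x) = q^2 x\<close>, and \<open>f(y x) = q f(x y)\<close> forces \<open>k(y) = q^(-1) y\<close>. Each of \<open>e(x), e(y), f(x), f(y)\<close> is a
  weight vector, so its monomials lie on one line in the plane of exponents. On such lines
  \<open>e(a) = w k(a) - a w\<close> for a polynomial \<open>w\<close>, and \<open>f(a) = F(a) + v a - k'(a) v\<close> for a polynomial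
  \<open>v\<close>, where \<open>F\<close> is \<open>c\<close> times a \<open>q\<close>-difference quotient in \<open>x\<close>. If \<open>v\<close> were not zero, the leading
  coefficient of \<open>(e f - f e)(y)\<close> would be a nonzero multiple of
  \<open>(1 - q^i) (1 - q^j)\<close> with \<open>i, j > 0\<close>, while \<open>(e f - f e)(y) = - y\<close> has a lower leading monomial
  (\<open>v_zero\<close>). Hence \<open>f = F\<close>, and \<open>F(e(y)) = y\<close> leaves only \<open>e(y) = c^(-1) x y\<close>, which determines \<open>e\<close>.
  Conversely these operators satisfy all rules (\<open>family_action\<close>), and \<open>x \<mapsto> (c / d) x\<close> transports
  the structure with parameter \<open>c\<close> to the one with parameter \<open>d\<close>.
\<close>


section \<open>Linear extension\<close>

abbreviation "keys \<equiv> Poly_Mapping.keys"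
abbreviation "lookup \<equiv> Poly_Mapping.lookup"
abbreviation "single \<equiv> Poly_Mapping.single"

definition cscale :: "complex \<Rightarrow> ('u \<Rightarrow>\<^sub>0 complex) \<Rightarrow> ('u \<Rightarrow>\<^sub>0 complex)" where
  "cscale c = Poly_Mapping.map ((*) c)"

lemma lookup_cscale [simp]: "lookup (cscale c p) u = c * lookup p u"
  by (simp add: cscale_def Poly_Mapping.map.rep_eq when_def)

lemma cscale_add: "cscale c (p + r) = cscale c p + cscale c r"
  by (rule poly_mapping_eqI) (simp add: lookup_add distrib_left)

lemma cscale_diff: "cscale c (p - r) = cscale c p - cscale c r"
  by (rule poly_mapping_eqI) (simp add: lookup_minus right_diff_distrib)

lemma cscale_add_left: "cscale (c + d) p = cscale c p + cscale d p"
  by (rule poly_mapping_eqI) (simp add: lookup_add distrib_right)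

lemma cscale_cscale [simp]: "cscale c (cscale d p) = cscale (c * d) p"
  by (rule poly_mapping_eqI) simp

lemma cscale_one [simp]: "cscale 1 p = p"
  by (rule poly_mapping_eqI) simp

lemma cscale_zero [simp]: "cscale c 0 = 0" "cscale 0 p = 0"
  by (rule poly_mapping_eqI, simp)+

lemma cscale_minus_one: "cscale (- 1) p = - p"
  by (rule poly_mapping_eqI) simp

lemma cscale_single [simp]: "cscale c (single u d) = single u (c * d)"
  by (rule poly_mapping_eqI) (simp add: lookup_single when_def)

lemma cscale_sum: "cscale c (sum f S) = (\<Sum>i\<in>S. cscale c (f i))"
  by (rule poly_mapping_eqI) (simp add: lookup_sum sum_distrib_left)

lemma keys_cscale: "keys (cscale c p) \<subseteq> keys p"
  by (auto simp: in_keys_iff)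

definition clin :: "(('u \<Rightarrow>\<^sub>0 complex) \<Rightarrow> ('v \<Rightarrow>\<^sub>0 complex)) \<Rightarrow> bool" where
  "clin F \<longleftrightarrow> (\<forall>p r. F (p + r) = F p + F r) \<and> (\<forall>c p. F (cscale c p) = cscale c (F p))"

lemma clinI:
  assumes "\<And>p r. F (p + r) = F p + F r" and "\<And>c p. F (cscale c p) = cscale c (F p)"
  shows "clin F"
  using assms by (simp add: clin_def)

lemma clinD:
  assumes "clin F"
  shows "F (p + r) = F p + F r" "F (cscale c p) = cscale c (F p)" "F 0 = 0" "F (p - r) = F p - F r"
    "F (sum t S) = (\<Sum>i\<in>S. F (t i))"
proof -
  show add: "F (p + r) = F p + F r" for p r
    using assms by (auto simp: clin_def)
  show sc: "F (cscale c p) = cscale c (F p)" for c p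
    using assms by (auto simp: clin_def)
  show zero: "F 0 = 0"
    using sc[of 0 0] by simp
  show "F (p - r) = F p - F r"
    using add[of p "cscale (- 1) r"] sc[of "- 1" r] by (simp add: cscale_minus_one)
  show "F (sum t S) = (\<Sum>i\<in>S. F (t i))"
    by (induct S rule: infinite_finite_induct) (simp_all add: zero add)
qed

lemma poly_mapping_expand:
  "p = (\<Sum>u\<in>keys p. cscale (lookup p u) (single u 1))"
  by (rule poly_mapping_eqI)
    (simp add: lookup_sum lookup_single when_def in_keys_iff if_distrib cong: if_cong)

lemma clin_eq_on_keys:
  assumes "clin F" "clin G"
    and "\<And>u. u \<in> keys p \<Longrightarrow> F (single u 1) = G (single u 1)"
  shows "F p = G p"
proof -
  have "F p = (\<Sum>u\<in>keys p. cscale (lookup p u) (F (single u 1)))"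
    by (subst poly_mapping_expand[of p]) (simp only: clinD[OF assms(1)])
  also have "\<dots> = (\<Sum>u\<in>keys p. cscale (lookup p u) (G (single u 1)))"
    using assms(3) by simp
  also have "\<dots> = G p"
    by (subst (3) poly_mapping_expand[of p]) (simp only: clinD[OF assms(2)])
  finally show ?thesis .
qed

lemma clin_compose: "clin F \<Longrightarrow> clin G \<Longrightarrow> clin (\<lambda>p. F (G p))"
  by (simp add: clin_def)

lemma clin_add: "clin F \<Longrightarrow> clin G \<Longrightarrow> clin (\<lambda>p. F p + G p)"
  by (simp add: clin_def cscale_add)

lemma clin_diff: "clin F \<Longrightarrow> clin G \<Longrightarrow> clin (\<lambda>p. F p - G p)"
  by (simp add: clin_def cscale_diff)

lemma clin_id: "clin (\<lambda>p. p)"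
  by (simp add: clin_def)

text \<open>
  Free vector spaces are represented by finitely supported functions, so linear maps out of them are
  given on the basis elements \<open>single u 1\<close>. Bilinear products are then extended from the basis,
  and identities between multilinear expressions are checked on basis elements only
  (\<open>clin_eq_on_keys\<close>).
\<close>

definition lext :: "('u \<Rightarrow> 'v \<Rightarrow>\<^sub>0 complex) \<Rightarrow> ('u \<Rightarrow>\<^sub>0 complex) \<Rightarrow> ('v \<Rightarrow>\<^sub>0 complex)" where
  "lext f p = (\<Sum>u\<in>keys p. cscale (lookup p u) (f u))"

lemma lext_superset:
  assumes "finite S" "keys p \<subseteq> S"
  shows "lext f p = (\<Sum>u\<in>S. cscale (lookup p u) (f u))"
  unfolding lext_def using assms
  by (intro sum.mono_neutral_left) (auto simp: in_keys_iff)

lemma clin_lext: "clin (lext f)"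
proof (rule clinI)
  fix p r :: "'a \<Rightarrow>\<^sub>0 complex"
  let ?S = "keys p \<union> keys r"
  have "finite ?S" "keys (p + r) \<subseteq> ?S"
    using keys_add[of p r] by auto
  then show "lext f (p + r) = lext f p + lext f r"
    by (simp add: lext_superset[of ?S] lookup_add cscale_add_left sum.distrib)
next
  fix c and p :: "'a \<Rightarrow>\<^sub>0 complex"
  show "lext f (cscale c p) = cscale c (lext f p)"
    using lext_superset[OF _ keys_cscale, of p f c] by (simp add: lext_def cscale_sum)
qed

lemmas lext_add = clinD(1)[OF clin_lext]
  and lext_cscale = clinD(2)[OF clin_lext]
  and lext_zero = clinD(3)[OF clin_lext]
  and lext_diff = clinD(4)[OF clin_lext]
  and lext_sum = clinD(5)[OF clin_lext]

lemma lext_single [simp]: "lext f (single u c) = cscale c (f u)"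
  by (cases "c = 0") (simp_all add: lext_def)

lemma clin_lext_arg:
  assumes "\<And>u. clin (\<lambda>p. f p u)"
  shows "clin (\<lambda>p. lext (f p) r)"
  using assms by (auto simp: clin_def lext_def cscale_add sum.distrib cscale_sum mult.commute)

lemma lext_cong: "(\<And>u. u \<in> keys p \<Longrightarrow> f u = g u) \<Longrightarrow> lext f p = lext g p"
  by (simp add: lext_def)

lemma clin_lext_swap: "clin F \<Longrightarrow> F (lext f p) = lext (\<lambda>u. F (f u)) p"
  by (simp add: lext_def clinD)

lemma lext_swap: "lext (\<lambda>u. lext (f u) r) p = lext (\<lambda>v. lext (\<lambda>u. f u v) p) r"
proof -
  have "lext (\<lambda>u. lext (f u) r) p
      = (\<Sum>u\<in>keys p. \<Sum>v\<in>keys r.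
          cscale (lookup p u * lookup r v) (f u v))"
    by (simp add: lext_def cscale_sum)
  also have "\<dots> = lext (\<lambda>v. lext (\<lambda>u. f u v) p) r"
    by (subst sum.swap) (simp add: lext_def cscale_sum mult.commute)
  finally show ?thesis .
qed

lemma keys_lext: "keys (lext f p) \<subseteq> (\<Union>u\<in>keys p. keys (f u))"
  unfolding lext_def using keys_sum keys_cscale by (smt (verit) SUP_mono' order_trans)

definition bext :: "('u \<Rightarrow> 'v \<Rightarrow> 'w \<Rightarrow>\<^sub>0 complex) \<Rightarrow> ('u \<Rightarrow>\<^sub>0 complex) \<Rightarrow> ('v \<Rightarrow>\<^sub>0 complex) \<Rightarrow> ('w \<Rightarrow>\<^sub>0 complex)"
  where "bext g p r = lext (\<lambda>u. lext (g u) r) p"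

lemma clin_bext_left: "clin (\<lambda>p. bext g p r)"
  unfolding bext_def by (rule clin_lext)

lemma clin_bext_right: "clin (bext g p)"
  unfolding bext_def using clin_lext by (rule clin_lext_arg)

lemma bext_single [simp]:
  "bext g (single u c) (single v d) = cscale (c * d) (g u v)"
  by (simp add: bext_def)

lemma keys_bext:
  "keys (bext g p r)
    \<subseteq> (\<Union>u\<in>keys p. \<Union>v\<in>keys r. keys (g u v))"
  unfolding bext_def by (rule order_trans[OF keys_lext]) (use keys_lext in fastforce)

lemma lext_bext: "lext f (bext g p r) = bext (\<lambda>u v. lext f (g u v)) p r"
  by (simp add: bext_def clin_lext_swap[OF clin_lext])

text \<open>
  Both sides are linear in each of the three arguments; replacing one argument at a time by basis
  elements reduces associativity to basis elements.
\<close>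

lemma bext_assoc:
  assumes "\<And>u v w. u \<in> keys p \<Longrightarrow> v \<in> keys r \<Longrightarrow> w \<in> keys s \<Longrightarrow>
    bext g (g u v) (single w 1) = bext g (single u 1) (g v w)"
  shows "bext g (bext g p r) s = bext g p (bext g r s)"
proof -
  note lin = clin_compose[OF clin_bext_left[of g] clin_bext_left[of g]]
    clin_compose[OF clin_bext_left[of g] clin_bext_right[of g]]
    clin_compose[OF clin_bext_right[of g] clin_bext_left[of g]]
    clin_compose[OF clin_bext_right[of g] clin_bext_right[of g]]
    clin_bext_left[of g] clin_bext_right[of g]
  have 1: "bext g (bext g (single u 1) (single v 1)) s
      = bext g (single u 1) (bext g (single v 1) s)"
    if "u \<in> keys p" "v \<in> keys r" for u v
    by (rule clin_eq_on_keys[of _ _ s]) (use lin assms that in auto)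
  have 2: "bext g (bext g (single u 1) r) s
      = bext g (single u 1) (bext g r s)"
    if "u \<in> keys p" for u
    by (rule clin_eq_on_keys[of _ _ r]) (use lin 1 that in auto)
  show ?thesis
    by (rule clin_eq_on_keys[of _ _ p]) (use lin 2 in auto)
qed

section \<open>Unital associative complex algebras\<close>

locale calgebra = ring A for A :: "'a calg" (structure) +
  assumes smult_closed [simp, intro]: "a \<in> carrier A \<Longrightarrow> c \<odot> a \<in> carrier A"
    and smult_add_left: "a \<in> carrier A \<Longrightarrow> (c + d) \<odot> a = c \<odot> a \<oplus> d \<odot> a"
    and smult_add_right: "a \<in> carrier A \<Longrightarrow> b \<in> carrier A \<Longrightarrow> c \<odot> (a \<oplus> b) = c \<odot> a \<oplus> c \<odot> b"
    and smult_smult: "a \<in> carrier A \<Longrightarrow> c \<odot> (d \<odot> a) = (c * d) \<odot> a"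
    and smult_one [simp]: "a \<in> carrier A \<Longrightarrow> 1 \<odot> a = a"
    and smult_mult_left: "a \<in> carrier A \<Longrightarrow> b \<in> carrier A \<Longrightarrow> (c \<odot> a) \<otimes> b = c \<odot> (a \<otimes> b)"
    and smult_mult_right: "a \<in> carrier A \<Longrightarrow> b \<in> carrier A \<Longrightarrow> a \<otimes> (c \<odot> b) = c \<odot> (a \<otimes> b)"
begin

lemma smult_zero_left [simp]: "a \<in> carrier A \<Longrightarrow> 0 \<odot> a = \<zero>"
  using smult_add_left[of a 0 0] by (simp add: add.l_cancel_one')

lemma smult_zero_right [simp]: "c \<odot> \<zero> = \<zero>"
  using smult_add_right[of \<zero> \<zero> c] by (simp add: add.l_cancel_one')

lemma smult_uminus: "a \<in> carrier A \<Longrightarrow> (- 1) \<odot> a = \<ominus> a"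
  using smult_add_left[of a 1 "- 1"]
  by (metis add.r_inv add_uminus_conv_diff diff_self minus_equality r_neg1 r_zero smult_closed
      smult_one smult_zero_left a_inv_closed a_comm)

lemma smult_finsum:
  "f \<in> S \<rightarrow> carrier A \<Longrightarrow> c \<odot> (\<Oplus>i\<in>S. f i) = (\<Oplus>i\<in>S. c \<odot> f i)"
  by (induct S rule: infinite_finite_induct) (auto simp: smult_add_right Pi_def finsum_closed)

lemma alg: "calgebra A" ..

end

lemma calgebraI:
  fixes A :: "'a calg" (structure)
  assumes "ring A"
    and "\<And>c a. a \<in> carrier A \<Longrightarrow> c \<odot> a \<in> carrier A"
    and "\<And>c d a. a \<in> carrier A \<Longrightarrow> (c + d) \<odot> a = c \<odot> a \<oplus> d \<odot> a"
    and "\<And>c a b. a \<in> carrier A \<Longrightarrow> b \<in> carrier A \<Longrightarrow> c \<odot> (a \<oplus> b) = c \<odot> a \<oplus> c \<odot> b"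
    and "\<And>c d a. a \<in> carrier A \<Longrightarrow> c \<odot> (d \<odot> a) = (c * d) \<odot> a"
    and "\<And>a. a \<in> carrier A \<Longrightarrow> 1 \<odot> a = a"
    and "\<And>c a b. a \<in> carrier A \<Longrightarrow> b \<in> carrier A \<Longrightarrow> (c \<odot> a) \<otimes> b = c \<odot> (a \<otimes> b)"
    and "\<And>c a b. a \<in> carrier A \<Longrightarrow> b \<in> carrier A \<Longrightarrow> a \<otimes> (c \<odot> b) = c \<odot> (a \<otimes> b)"
  shows "calgebra A"
  using assms by (simp add: calgebra_def calgebra_axioms_def)

lemma alg_homI:
  assumes "\<And>a. a \<in> carrier A \<Longrightarrow> h a \<in> carrier B"
    and "\<And>a b. a \<in> carrier A \<Longrightarrow> b \<in> carrier A \<Longrightarrow> h (a \<otimes>\<^bsub>A\<^esub> b) = h a \<otimes>\<^bsub>B\<^esub> h b"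
    and "\<And>a b. a \<in> carrier A \<Longrightarrow> b \<in> carrier A \<Longrightarrow> h (a \<oplus>\<^bsub>A\<^esub> b) = h a \<oplus>\<^bsub>B\<^esub> h b"
    and "h \<one>\<^bsub>A\<^esub> = \<one>\<^bsub>B\<^esub>"
    and "\<And>c a. a \<in> carrier A \<Longrightarrow> h (c \<odot>\<^bsub>A\<^esub> a) = c \<odot>\<^bsub>B\<^esub> h a"
  shows "h \<in> alg_hom A B"
  using assms by (auto simp: alg_hom_def intro!: ring_hom_memI)

lemma alg_homD:
  assumes "h \<in> alg_hom A B"
  shows "a \<in> carrier A \<Longrightarrow> h a \<in> carrier B"
    and "a \<in> carrier A \<Longrightarrow> b \<in> carrier A \<Longrightarrow> h (a \<otimes>\<^bsub>A\<^esub> b) = h a \<otimes>\<^bsub>B\<^esub> h b"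
    and "a \<in> carrier A \<Longrightarrow> b \<in> carrier A \<Longrightarrow> h (a \<oplus>\<^bsub>A\<^esub> b) = h a \<oplus>\<^bsub>B\<^esub> h b"
    and "h \<one>\<^bsub>A\<^esub> = \<one>\<^bsub>B\<^esub>"
    and "a \<in> carrier A \<Longrightarrow> h (c \<odot>\<^bsub>A\<^esub> a) = c \<odot>\<^bsub>B\<^esub> h a"
  using assms by (auto simp: alg_hom_def ring_hom_closed ring_hom_mult ring_hom_add ring_hom_one)

lemma alg_hom_zero:
  assumes "h \<in> alg_hom A B" "calgebra A" "calgebra B"
  shows "h \<zero>\<^bsub>A\<^esub> = \<zero>\<^bsub>B\<^esub>"
  using assms by (auto simp: alg_hom_def calgebra_def intro: ring_hom_zero)

section \<open>Monoid algebras\<close>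

lemma monoid_alg_simps:
  "carrier (monoid_alg M) = {p. keys p \<subseteq> carrier M}"
  "one (monoid_alg M) = single \<one>\<^bsub>M\<^esub> 1"
  "zero (monoid_alg M) = 0"
  "add (monoid_alg M) = (+)"
  "smult (monoid_alg M) = cscale"
  "mult (monoid_alg M) = bext (\<lambda>u v. single (u \<otimes>\<^bsub>M\<^esub> v) 1)"
  by (simp_all add: monoid_alg_def bext_def lext_def cscale_sum fun_eq_iff)
    (simp add: cscale_def)

lemma single_in_monoid_alg [simp]: "u \<in> carrier M \<Longrightarrow> single u c \<in> carrier (monoid_alg M)"
  by (cases "c = 0") (simp_all add: monoid_alg_simps)

lemma calgebra_monoid_alg:
  assumes "monoid M"
  shows "calgebra (monoid_alg M)"
proof (rule calgebraI)
  interpret monoid M by (rule assms)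
  let ?m = "\<lambda>u v. single (u \<otimes>\<^bsub>M\<^esub> v) (1::complex)"
  have keys_add_sub: "keys (p + r) \<subseteq> carrier M"
    if "keys p \<subseteq> carrier M" "keys r \<subseteq> carrier M"
    for p r :: "_ \<Rightarrow>\<^sub>0 complex"
    using keys_add[of p r] that by auto
  have keys_mult: "keys (bext ?m p r) \<subseteq> carrier M"
    if "keys p \<subseteq> carrier M" "keys r \<subseteq> carrier M" for p r
    by (rule order_trans[OF keys_bext]) (use that in auto)
  show "ring (monoid_alg M)"
  proof (rule ringI)
    show "abelian_group (monoid_alg M)"
    proof (rule abelian_groupI)
      fix p
      assume "p \<in> carrier (monoid_alg M)"
      then show "\<exists>y\<in>carrier (monoid_alg M). y \<oplus>\<^bsub>monoid_alg M\<^esub> p = \<zero>\<^bsub>monoid_alg M\<^esub>"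
        by (intro bexI[of _ "- p"]) (simp_all add: monoid_alg_simps)
    qed (simp_all add: monoid_alg_simps keys_add_sub ac_simps)
    show "monoid (monoid_alg M)"
    proof (rule monoidI; simp add: monoid_alg_simps keys_mult)
      fix p r s :: "_ \<Rightarrow>\<^sub>0 complex"
      assume *: "keys p \<subseteq> carrier M" "keys r \<subseteq> carrier M"
        "keys s \<subseteq> carrier M"
      show "bext ?m (bext ?m p r) s = bext ?m p (bext ?m r s)"
        by (rule bext_assoc) (use * in \<open>simp add: m_assoc subset_iff\<close>)
    next
      fix p :: "_ \<Rightarrow>\<^sub>0 complex"
      assume *: "keys p \<subseteq> carrier M"
      show "bext ?m (single \<one>\<^bsub>M\<^esub> 1) p = p"
        by (rule clin_eq_on_keys[OF clin_bext_right clin_id]) (use * in auto)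
      show "bext ?m p (single \<one>\<^bsub>M\<^esub> 1) = p"
        by (rule clin_eq_on_keys[OF clin_bext_left clin_id]) (use * in auto)
    qed
  qed (simp_all add: monoid_alg_simps clinD(1)[OF clin_bext_left] clinD(1)[OF clin_bext_right])
qed (use keys_cscale in \<open>force simp: monoid_alg_simps cscale_add cscale_add_left
    clinD(2)[OF clin_bext_left] clinD(2)[OF clin_bext_right]\<close>)+

definition monoid_alg_lift :: "'b calg \<Rightarrow> ('m \<Rightarrow> 'b) \<Rightarrow> ('m \<Rightarrow>\<^sub>0 complex) \<Rightarrow> 'b" where
  "monoid_alg_lift B \<phi> p = (\<Oplus>\<^bsub>B\<^esub>u\<in>keys p. lookup p u \<odot>\<^bsub>B\<^esub> \<phi> u)"

context calgebra
begin

lemma monoid_alg_lift_superset: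
  assumes "finite S" "keys p \<subseteq> S" "\<phi> \<in> S \<rightarrow> carrier A"
  shows "monoid_alg_lift A \<phi> p = (\<Oplus>u\<in>S. lookup p u \<odot> \<phi> u)"
  unfolding monoid_alg_lift_def using assms
  by (intro add.finprod_mono_neutral_cong_left) (auto simp: in_keys_iff Pi_def)

lemma monoid_alg_lift_closed:
  "\<phi> \<in> keys p \<rightarrow> carrier A \<Longrightarrow> monoid_alg_lift A \<phi> p \<in> carrier A"
  unfolding monoid_alg_lift_def by (rule finsum_closed) auto

lemma monoid_alg_lift_add:
  assumes "\<phi> \<in> keys p \<union> keys r \<rightarrow> carrier A"
  shows "monoid_alg_lift A \<phi> (p + r) = monoid_alg_lift A \<phi> p \<oplus> monoid_alg_lift A \<phi> r"
proof -
  let ?S = "keys p \<union> keys r"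
  have *: "finite ?S" "keys (p + r) \<subseteq> ?S"
    using keys_add[of p r] by auto
  have "monoid_alg_lift A \<phi> (p + r)
      = (\<Oplus>u\<in>?S. lookup p u \<odot> \<phi> u \<oplus> lookup r u \<odot> \<phi> u)"
    unfolding monoid_alg_lift_superset[OF * assms]
    by (rule finsum_cong') (use assms in \<open>auto simp: lookup_add intro!: smult_add_left\<close>)
  also have "\<dots> = monoid_alg_lift A \<phi> p \<oplus> monoid_alg_lift A \<phi> r"
    using assms by (subst finsum_addf) (auto simp: monoid_alg_lift_superset[of ?S])
  finally show ?thesis .
qed

lemma monoid_alg_lift_cscale:
  assumes "\<phi> \<in> keys p \<rightarrow> carrier A"
  shows "monoid_alg_lift A \<phi> (cscale c p) = c \<odot> monoid_alg_lift A \<phi> p"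
proof -
  have "monoid_alg_lift A \<phi> (cscale c p) = (\<Oplus>u\<in>keys p. c \<odot> (lookup p u \<odot> \<phi> u))"
    unfolding monoid_alg_lift_superset[OF _ keys_cscale assms, OF finite_keys]
    by (rule finsum_cong') (use assms in \<open>auto intro!: smult_smult[symmetric]\<close>)
  also have "\<dots> = c \<odot> monoid_alg_lift A \<phi> p"
    unfolding monoid_alg_lift_def by (rule smult_finsum[symmetric]) (use assms in auto)
  finally show ?thesis .
qed

lemma monoid_alg_lift_zero [simp]: "monoid_alg_lift A \<phi> 0 = \<zero>"
  by (simp add: monoid_alg_lift_def)

lemma monoid_alg_lift_single:
  "\<phi> u \<in> carrier A \<Longrightarrow> monoid_alg_lift A \<phi> (single u c) = c \<odot> \<phi> u"
  by (cases "c = 0") (simp_all add: monoid_alg_lift_def)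

lemma monoid_alg_lift_diff:
  assumes "\<phi> \<in> keys p \<union> keys r \<rightarrow> carrier A"
  shows "monoid_alg_lift A \<phi> (p - r) = monoid_alg_lift A \<phi> p \<ominus> monoid_alg_lift A \<phi> r"
proof -
  have "monoid_alg_lift A \<phi> (p + cscale (- 1) r) = monoid_alg_lift A \<phi> p \<oplus> (- 1) \<odot> monoid_alg_lift A \<phi> r"
    using assms keys_cscale[of "- 1" r]
    by (subst monoid_alg_lift_add) (auto simp: monoid_alg_lift_cscale Pi_def)
  then show ?thesis
    using assms by (simp add: cscale_minus_one smult_uminus monoid_alg_lift_closed a_minus_def Pi_def)
qed

text \<open>
  The universal property of a monoid algebra: a homomorphism of \<open>M\<close> into the multiplicative monoid
  of an algebra extends linearly to an algebra homomorphism, by distributivity.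
\<close>

lemma monoid_alg_lift_hom:
  assumes M: "monoid M" and closed: "\<phi> \<in> carrier M \<rightarrow> carrier A"
    and one: "\<phi> \<one>\<^bsub>M\<^esub> = \<one>"
    and mult: "\<And>u v. u \<in> carrier M \<Longrightarrow> v \<in> carrier M \<Longrightarrow> \<phi> (u \<otimes>\<^bsub>M\<^esub> v) = \<phi> u \<otimes> \<phi> v"
  shows "monoid_alg_lift A \<phi> \<in> alg_hom (monoid_alg M) A"
proof (rule alg_homI)
  let ?L = "monoid_alg_lift A \<phi>"
  interpret M: monoid M by (rule M)
  fix p r
  assume pr: "p \<in> carrier (monoid_alg M)" "r \<in> carrier (monoid_alg M)"
  then have sub: "keys p \<subseteq> carrier M" "keys r \<subseteq> carrier M"
    by (auto simp: monoid_alg_simps)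
  have \<phi>: "\<phi> u \<in> carrier A" if "u \<in> carrier M" for u
    using closed that by auto
  have p\<phi>: "\<phi> u \<in> carrier A" if "u \<in> keys p" for u
    using \<phi> sub that by auto
  have r\<phi>: "\<phi> u \<in> carrier A" if "u \<in> keys r" for u
    using \<phi> sub that by auto
  show "?L (p \<oplus>\<^bsub>monoid_alg M\<^esub> r) = ?L p \<oplus> ?L r"
    unfolding monoid_alg_simps by (rule monoid_alg_lift_add) (use p\<phi> r\<phi> in auto)
  let ?m = "\<lambda>u v. single (u \<otimes>\<^bsub>M\<^esub> v) (1::complex)"
  have fin: "?L (sum t S) = (\<Oplus>i\<in>S. ?L (t i))"
    if "finite S" "\<And>i. i \<in> S \<Longrightarrow> keys (t i) \<subseteq> carrier M"
    for S and t :: "_ \<Rightarrow> _ \<Rightarrow>\<^sub>0 complex"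
    using that
  proof (induct S)
    case (insert i S)
    have "keys (sum t S) \<subseteq> carrier M"
      using insert keys_sum[of t S] by fastforce
    moreover have "?L (t j) \<in> carrier A" if "j \<in> insert i S" for j
      using insert(4)[OF that] \<phi> by (auto intro!: monoid_alg_lift_closed)
    moreover have "?L (t i + sum t S)
        = ?L (t i) \<oplus> ?L (sum t S)"
      by (rule monoid_alg_lift_add) (use calculation(1) insert(4)[of i] \<phi> in auto)
    ultimately show ?case
      using insert(1,2) insert(3)[OF insert(4)] by (simp add: Pi_def)
  qed simp
  have inner: "?L (bext ?m (single u 1) s) = \<phi> u \<otimes> ?L s"
    if u: "u \<in> carrier M" and s: "keys s \<subseteq> carrier M" for u s
  proof -
    have "bext ?m (single u 1) s
      = (\<Sum>v\<in>keys s. single (u \<otimes>\<^bsub>M\<^esub> v) (lookup s v))"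
      by (simp add: bext_def) (simp add: lext_def)
    also have "?L \<dots>
      = (\<Oplus>v\<in>keys s. ?L (single (u \<otimes>\<^bsub>M\<^esub> v) (lookup s v)))"
      by (rule fin) (use u s in auto)
    also have "\<dots> = (\<Oplus>v\<in>keys s. \<phi> u \<otimes> (lookup s v \<odot> \<phi> v))"
      by (rule finsum_cong')
        (use u s \<phi> in \<open>auto simp: monoid_alg_lift_single mult smult_mult_right subset_iff\<close>)
    also have "\<dots> = \<phi> u \<otimes> ?L s"
      unfolding monoid_alg_lift_def
      by (rule finsum_rdistr[symmetric]) (use u s \<phi> in \<open>auto simp: subset_iff\<close>)
    finally show ?thesis .
  qed
  have rcl: "?L r \<in> carrier A"
    using r\<phi> by (auto intro!: monoid_alg_lift_closed)
  have keys_u: "keys (bext ?m (single u 1) r) \<subseteq> carrier M"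
    if "u \<in> carrier M" for u
    by (rule order_trans[OF keys_bext]) (use that sub in auto)
  have "bext ?m p r = (\<Sum>u\<in>keys p.
      cscale (lookup p u) (bext ?m (single u 1) r))"
    by (subst poly_mapping_expand[of p]) (simp only: clinD[OF clin_bext_left])
  also have "?L \<dots> = (\<Oplus>u\<in>keys p.
      ?L (cscale (lookup p u) (bext ?m (single u 1) r)))"
    using sub(1) keys_u by (intro fin) (auto dest!: subsetD[OF keys_cscale])
  also have "\<dots> = (\<Oplus>u\<in>keys p.
      (lookup p u \<odot> \<phi> u) \<otimes> ?L r)"
  proof (rule finsum_cong')
    fix u
    assume "u \<in> keys p"
    then have u: "u \<in> carrier M"
      using sub(1) by auto
    have "\<phi> \<in> keys (bext ?m (single u 1) r) \<rightarrow> carrier A"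
      using keys_u[OF u] \<phi> by auto
    then show "?L (cscale (lookup p u) (bext ?m (single u 1) r))
        = (lookup p u \<odot> \<phi> u) \<otimes> ?L r"
      by (simp only: monoid_alg_lift_cscale inner[OF u sub(2)] smult_mult_left[OF \<phi>[OF u] rcl])
  qed (use p\<phi> rcl in auto)
  also have "\<dots> = ?L p \<otimes> ?L r"
    unfolding monoid_alg_lift_def[of A \<phi> p]
    by (rule finsum_ldistr[symmetric]) (use p\<phi> rcl in auto)
  finally show "?L (p \<otimes>\<^bsub>monoid_alg M\<^esub> r) = ?L p \<otimes> ?L r"
    unfolding monoid_alg_simps .
qed (use closed in \<open>auto simp: monoid_alg_simps monoid_alg_lift_single one monoid.one_closed[OF M]
    intro!: monoid_alg_lift_closed monoid_alg_lift_cscale\<close>)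

end

section \<open>Quotients\<close>

text \<open>
  Rings are records, and algebras carry further fields; only the ring fields matter for the axioms.
\<close>

lemma ring_cong:
  assumes "ring S" "carrier T = carrier S" "mult T = mult S" "one T = one S" "zero T = zero S" "add T = add S"
  shows "ring T"
proof -
  interpret S: ring S by (rule assms)
  note eq = assms(2-)
  show ?thesis
  proof (rule ringI)
    show "abelian_group T"
      by (rule abelian_groupI; simp only: eq) (auto intro: S.a_ac S.a_inv_closed S.l_neg)
    show "monoid T"
      by (rule monoidI; simp only: eq) (auto intro: S.m_assoc)
  qed (simp_all only: eq S.l_distr S.r_distr)
qed

locale calgebra_ideal = calgebra + ideal I A for I
begin

abbreviation "cls \<equiv> (+>) I"

lemma ideal_smult: "i \<in> I \<Longrightarrow> c \<odot> i \<in> I"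
  using I_l_closed[of i "c \<odot> \<one>"] by (simp add: smult_mult_left a_Hcarr)

lemma cls_eq_iff: "a \<in> carrier A \<Longrightarrow> b \<in> carrier A \<Longrightarrow> cls a = cls b \<longleftrightarrow> a \<ominus> b \<in> I"
  by (rule quotient_eq_iff_same_a_r_cos[OF is_ideal, symmetric])

lemma quot_alg_carrier: "carrier (quot_alg A I) = cls ` carrier A"
  by (auto simp: quot_alg_def FactRing_def A_RCOSETS_def')

text \<open>
  Scalar multiples are well defined on cosets because an ideal of a unital algebra is a linear
  subspace: \<open>c \<odot> i = (c \<odot> \<one>) \<otimes> i\<close>.
\<close>

lemma quot_alg_smult:
  assumes a: "a \<in> carrier A"
  shows "c \<odot>\<^bsub>quot_alg A I\<^esub> cls a = cls (c \<odot> a)"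
proof -
  have const: "cls (c \<odot> b) = cls (c \<odot> a)" if "b \<in> cls a" for b
  proof -
    obtain i where i: "i \<in> I" "b = i \<oplus> a"
      using \<open>b \<in> cls a\<close> by (auto simp: a_r_coset_def')
    have ia: "i \<in> carrier A" "c \<odot> i \<in> carrier A" "c \<odot> a \<in> carrier A"
      using i(1) a by (auto intro: Icarr)
    have "c \<odot> b = c \<odot> i \<oplus> c \<odot> a"
      unfolding i(2) using ia(1) a by (rule smult_add_right)
    then have "cls (c \<odot> b) = (I +> (c \<odot> i)) +> (c \<odot> a)"
      using a_coset_add_assoc[OF a_subset ia(2,3)] by simp
    also have "I +> (c \<odot> i) = I"
      by (rule a_rcos_const[OF ideal_smult[OF i(1)]])
    finally show ?thesis .
  qed
  have "c \<odot>\<^bsub>quot_alg A I\<^esub> cls a = (\<Union>b\<in>cls a. cls (c \<odot> b))"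
    by (simp add: quot_alg_def)
  also have "\<dots> = (\<Union>b\<in>cls a. cls (c \<odot> a))"
    by (rule SUP_cong[OF refl const])
  also have "\<dots> = cls (c \<odot> a)"
    using a_rcos_self[OF a] by auto
  finally show ?thesis .
qed

lemma quot_alg_simps:
  "a \<in> carrier A \<Longrightarrow> b \<in> carrier A \<Longrightarrow> cls a \<otimes>\<^bsub>quot_alg A I\<^esub> cls b = cls (a \<otimes> b)"
  "a \<in> carrier A \<Longrightarrow> b \<in> carrier A \<Longrightarrow> cls a \<oplus>\<^bsub>quot_alg A I\<^esub> cls b = cls (a \<oplus> b)"
  "\<one>\<^bsub>quot_alg A I\<^esub> = cls \<one>"
  "\<zero>\<^bsub>quot_alg A I\<^esub> = cls \<zero>"
  by (simp_all add: quot_alg_def FactRing_def rcoset_mult_add a_rcos_sum a_rcos_const)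

lemma ring_quot: "ring (quot_alg A I)"
  by (rule ring_cong[OF quotient_is_ring]) (simp_all add: quot_alg_def)

lemma calgebra_quot: "calgebra (quot_alg A I)"
  by (rule calgebraI[OF ring_quot])
    (auto simp: quot_alg_carrier quot_alg_smult quot_alg_simps smult_add_left smult_add_right
      smult_smult smult_mult_left smult_mult_right)

lemma cls_hom: "cls \<in> alg_hom A (quot_alg A I)"
  by (rule alg_homI) (auto simp: quot_alg_carrier quot_alg_smult quot_alg_simps)

end

section \<open>Presented algebras\<close>

lemma monoid_list: "monoid list_monoid"
  by (rule monoidI) (auto simp: list_monoid_def)

lemma list_monoid_simps [simp]:
  "carrier list_monoid = UNIV" "mult list_monoid = (@)" "one list_monoid = []"
  by (auto simp: list_monoid_def)

lemma calgebra_free: "calgebra free_alg"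
  unfolding free_alg_def by (rule calgebra_monoid_alg[OF monoid_list])

lemma free_alg_simps:
  "carrier free_alg = UNIV" "one free_alg = single [] 1" "zero free_alg = 0"
  "add free_alg = (+)" "smult free_alg = cscale"
  "mult free_alg = bext (\<lambda>u v. single (u @ v) 1)"
  by (simp_all add: free_alg_def monoid_alg_simps)

lemma free_alg_uminus: "\<ominus>\<^bsub>free_alg\<^esub> p = - p"
proof -
  interpret calgebra free_alg by (rule calgebra_free)
  show ?thesis
    using smult_uminus[of p] by (simp add: free_alg_simps cscale_minus_one)
qed

lemma free_alg_minus: "p \<ominus>\<^bsub>free_alg\<^esub> r = p - r"
  by (simp add: a_minus_def free_alg_uminus free_alg_simps)

lemma calgebra_ideal_free: "calgebra_ideal free_alg (Idl\<^bsub>free_alg\<^esub> R)"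
proof -
  interpret calgebra free_alg by (rule calgebra_free)
  show ?thesis
    by (intro calgebra_ideal.intro alg genideal_ideal) (simp add: free_alg_simps)
qed

definition pcls :: "('g list \<Rightarrow>\<^sub>0 complex) set \<Rightarrow> ('g list \<Rightarrow>\<^sub>0 complex) \<Rightarrow> ('g list \<Rightarrow>\<^sub>0 complex) set" where
  "pcls R p = (Idl\<^bsub>free_alg\<^esub> R) +>\<^bsub>free_alg\<^esub> p"

lemma calgebra_presented: "calgebra (presented_alg R)"
  unfolding presented_alg_def by (rule calgebra_ideal.calgebra_quot[OF calgebra_ideal_free])

lemma presented_gen_eq: "presented_gen R g = pcls R (single [g] 1)"
  by (simp add: presented_gen_def pcls_def)

lemma presented_alg_carrier: "carrier (presented_alg R) = range (pcls R)"
  unfolding presented_alg_def pcls_def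
  using calgebra_ideal.quot_alg_carrier[OF calgebra_ideal_free] by (simp add: free_alg_simps)

lemma pcls_closed [simp]: "pcls R p \<in> carrier (presented_alg R)"
  by (simp add: presented_alg_carrier)

lemma presented_gen_closed [simp]: "presented_gen R g \<in> carrier (presented_alg R)"
  by (simp add: presented_gen_eq)

lemma pcls_hom: "pcls R \<in> alg_hom free_alg (presented_alg R)"
  using calgebra_ideal.cls_hom[OF calgebra_ideal_free] by (simp add: presented_alg_def pcls_def[abs_def])

lemmas pcls_simps = alg_homD(2-5)[OF pcls_hom, unfolded free_alg_simps, simplified]

lemma pcls_eq_iff: "pcls R p = pcls R r \<longleftrightarrow> p - r \<in> Idl\<^bsub>free_alg\<^esub> R"
  unfolding pcls_def using calgebra_ideal.cls_eq_iff[OF calgebra_ideal_free, of p r]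
  by (simp add: free_alg_simps free_alg_minus)

lemma pcls_rel: 
  assumes "p - r \<in> R"
  shows "pcls R p = pcls R r"
proof -
  interpret calgebra free_alg by (rule calgebra_free)
  show ?thesis
    using genideal_self[of R] assms by (auto simp: pcls_eq_iff free_alg_simps)
qed

text \<open>
  Every element of a presented algebra is a linear combination of products of generators. This is
  the way in which statements about all elements of the quantum enveloping algebra are reduced to its
  four generators.
\<close>

lemma presented_induct [consumes 1, case_names one gen mult add smult]:
  assumes X: "X \<in> carrier (presented_alg R)"
    and one: "P \<one>\<^bsub>presented_alg R\<^esub>"
    and gen: "\<And>g. P (presented_gen R g)"
    and mult: "\<And>X Y. X \<in> carrier (presented_alg R) \<Longrightarrow> Y \<in> carrier (presented_alg R) \<Longrightarrow>
      P X \<Longrightarrow> P Y \<Longrightarrow> P (X \<otimes>\<^bsub>presented_alg R\<^esub> Y)"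
    and add: "\<And>X Y. X \<in> carrier (presented_alg R) \<Longrightarrow> Y \<in> carrier (presented_alg R) \<Longrightarrow>
      P X \<Longrightarrow> P Y \<Longrightarrow> P (X \<oplus>\<^bsub>presented_alg R\<^esub> Y)"
    and smult: "\<And>c X. X \<in> carrier (presented_alg R) \<Longrightarrow> P X \<Longrightarrow> P (c \<odot>\<^bsub>presented_alg R\<^esub> X)"
  shows "P X"
proof -
  have word: "P (pcls R (single w 1))" for w
  proof (induct w)
    case Nil
    then show ?case
      using one by (simp add: pcls_simps)
  next
    case (Cons g w)
    have "pcls R (single (g # w) 1)
        = presented_gen R g \<otimes>\<^bsub>presented_alg R\<^esub> pcls R (single w 1)"
      by (simp add: presented_gen_eq flip: pcls_simps)
    then show ?case
      using Cons gen mult by simp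
  qed
  have zero: "P (pcls R 0)"
    using smult[OF pcls_closed word, of 0 "[]"] unfolding pcls_simps(4)[symmetric] by simp
  obtain p where p: "X = pcls R p"
    using X by (auto simp: presented_alg_carrier)
  have "P (pcls R (\<Sum>u\<in>S. cscale (lookup p u) (single u 1)))" if "finite S" for S
    using that
  proof (induct S)
    case (insert u S)
    then show ?case
      by (simp only: sum.insert[OF insert(1,2)] pcls_simps) (intro add smult word; simp flip: pcls_simps)
  qed (simp add: zero)
  then show ?thesis
    unfolding p by (subst poly_mapping_expand) simp
qed

lemma presented_hom_ext:
  assumes h: "h \<in> alg_hom (presented_alg R) B" and g: "g \<in> alg_hom (presented_alg R) B"
    and gen: "\<And>x. h (presented_gen R x) = g (presented_gen R x)"
    and X: "X \<in> carrier (presented_alg R)"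
  shows "h X = g X"
  using X by (induct rule: presented_induct) (simp_all add: alg_homD[OF h] alg_homD[OF g] gen)

lemma (in calgebra) minus_eq_zero_iff:
  assumes "a \<in> carrier A" "b \<in> carrier A"
  shows "a \<ominus> b = \<zero> \<longleftrightarrow> a = b"
  using assms by (metis a_inv_closed a_minus_def add.inv_closed minus_equality r_neg minus_minus)

definition word_value :: "'b calg \<Rightarrow> ('g \<Rightarrow> 'b) \<Rightarrow> 'g list \<Rightarrow> 'b" where
  "word_value B v w = foldr (\<lambda>g b. v g \<otimes>\<^bsub>B\<^esub> b) w \<one>\<^bsub>B\<^esub>"

definition free_lift :: "'b calg \<Rightarrow> ('g \<Rightarrow> 'b) \<Rightarrow> ('g list \<Rightarrow>\<^sub>0 complex) \<Rightarrow> 'b" where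
  "free_lift B v = monoid_alg_lift B (word_value B v)"

context calgebra
begin

context
  fixes v :: "'g \<Rightarrow> 'a"
  assumes v: "\<And>g. v g \<in> carrier A"
begin

lemma word_value_closed [simp]: "word_value A v w \<in> carrier A"
  by (induct w) (simp_all add: word_value_def v)

lemma word_value_simps [simp]:
  "word_value A v [] = \<one>" "word_value A v [g] = v g" "word_value A v [g, h] = v g \<otimes> v h"
  by (simp_all add: word_value_def v)

lemma word_value_append: "word_value A v (w @ w') = word_value A v w \<otimes> word_value A v w'"
proof (induct w)
  case Nil
  show ?case using word_value_closed[of w'] by (simp add: word_value_def[of A v "[]"])
next
  case (Cons g w)
  have "word_value A v (g # u) = v g \<otimes> word_value A v u" for u
    by (simp add: word_value_def)
  then show ?case
    using Cons v by (simp add: m_assoc)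
qed

lemma free_lift_hom: "free_lift A v \<in> alg_hom free_alg A"
  unfolding free_lift_def free_alg_def
  by (rule monoid_alg_lift_hom[OF monoid_list]) (simp_all add: word_value_append)

lemma free_lift_single [simp]: "free_lift A v (single w c) = c \<odot> word_value A v w"
  unfolding free_lift_def by (rule monoid_alg_lift_single) simp

lemma free_lift_diff: "free_lift A v (p - r) = free_lift A v p \<ominus> free_lift A v r"
  unfolding free_lift_def by (rule monoid_alg_lift_diff) simp

text \<open>
  The kernel of the homomorphism from the free algebra is an ideal that contains \<open>R\<close>, hence contains
  the ideal generated by \<open>R\<close>; so the homomorphism is constant on cosets.
\<close>

lemma presented_universal:
  assumes R: "\<And>r. r \<in> R \<Longrightarrow> free_lift A v r = \<zero>"
  shows "\<exists>!h. h \<in> alg_hom (presented_alg R) A \<and> h \<in> extensional (carrier (presented_alg R)) \<and>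
    (\<forall>g. h (presented_gen R g) = v g)"
proof -
  interpret F: calgebra free_alg by (rule calgebra_free)
  let ?L = "free_lift A v"
  interpret L: ring_hom_ring free_alg A ?L
    using free_lift_hom by (intro ring_hom_ringI2 F.ring_axioms ring_axioms) (simp add: alg_hom_def)
  have L_minus: "?L (p - r) = ?L p \<ominus> ?L r" for p r
    by (rule free_lift_diff)
  have sub: "Idl\<^bsub>free_alg\<^esub> R \<subseteq> a_kernel free_alg A ?L"
    using R by (intro F.genideal_minimal[OF L.kernel_is_ideal] subsetI CollectI conjI)
      (simp_all only: a_kernel_def' free_alg_simps mem_Collect_eq UNIV_I simp_thms)
  have ker: "?L r = \<zero>" if "r \<in> Idl\<^bsub>free_alg\<^esub> R" for r
    using subsetD[OF sub that] by (simp only: a_kernel_def' mem_Collect_eq)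
  have closed: "?L p \<in> carrier A" for p
    using alg_homD(1)[OF free_lift_hom] by (simp add: free_alg_simps)
  have L_cong: "?L p = ?L r" if "pcls R p = pcls R r" for p r
  proof -
    have "?L p \<ominus> ?L r = \<zero>"
      using ker[of "p - r"] that by (simp add: pcls_eq_iff L_minus)
    then show ?thesis
      using closed by (simp add: minus_eq_zero_iff)
  qed
  define h where "h = (\<lambda>X\<in>carrier (presented_alg R). ?L (SOME p. X = pcls R p))"
  have h: "h (pcls R p) = ?L p" for p
  proof -
    have "pcls R (SOME r. pcls R p = pcls R r) = pcls R p"
      by (rule someI[of "\<lambda>r. pcls R p = pcls R r", symmetric]) simp
    then have "?L (SOME r. pcls R p = pcls R r) = ?L p"
      by (rule L_cong)
    then show ?thesis
      by (simp add: h_def)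
  qed
  have hom: "h \<in> alg_hom (presented_alg R) A"
    by (rule alg_homI)
      (auto simp: presented_alg_carrier h closed alg_homD[OF free_lift_hom, unfolded free_alg_simps]
        simp flip: pcls_simps)
  show ?thesis
  proof (rule ex1I[of _ h])
    show "h \<in> alg_hom (presented_alg R) A \<and> h \<in> extensional (carrier (presented_alg R)) \<and>
        (\<forall>g. h (presented_gen R g) = v g)"
      using hom v by (simp add: presented_gen_eq h) (simp add: h_def)
    fix h'
    assume h': "h' \<in> alg_hom (presented_alg R) A \<and> h' \<in> extensional (carrier (presented_alg R)) \<and>
        (\<forall>g. h' (presented_gen R g) = v g)"
    show "h' = h"
    proof (rule extensionalityI)
      show "h' \<in> extensional (carrier (presented_alg R))" "h \<in> extensional (carrier (presented_alg R))"
        using h' by (auto simp: h_def)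
      show "h' X = h X" if "X \<in> carrier (presented_alg R)" for X
        by (rule presented_hom_ext[OF _ hom _ that]) (use h' v in \<open>auto simp: presented_gen_eq h\<close>)
    qed
  qed
qed

lemma presented_hom:
  assumes R: "\<And>r. r \<in> R \<Longrightarrow> free_lift A v r = \<zero>"
  shows "presented_hom R A v \<in> alg_hom (presented_alg R) A"
    and "presented_hom R A v \<in> extensional (carrier (presented_alg R))"
    and "presented_hom R A v (presented_gen R g) = v g"
proof -
  have *: "presented_hom R A v \<in> alg_hom (presented_alg R) A \<and>
    presented_hom R A v \<in> extensional (carrier (presented_alg R)) \<and>
    (\<forall>g. presented_hom R A v (presented_gen R g) = v g)"
    unfolding presented_hom_def by (rule theI'[OF presented_universal[OF R]])
  show "presented_hom R A v \<in> alg_hom (presented_alg R) A"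
    using * by (rule conjunct1)
  show "presented_hom R A v \<in> extensional (carrier (presented_alg R))"
    using * by (elim conjE)
  show "presented_hom R A v (presented_gen R g) = v g"
    using * by (elim conjE) (erule spec)
qed

end

end

section \<open>Endomorphism algebras and scalars\<close>

lemma calgebra_complex: "calgebra complex_alg"
proof (rule calgebraI)
  show "ring complex_alg"
  proof (rule ringI)
    show "abelian_group complex_alg"
      by (rule abelian_groupI) (auto simp: complex_alg_def intro: exI[of _ "- _"])
    show "monoid complex_alg"
      by (rule monoidI) (auto simp: complex_alg_def)
  qed (auto simp: complex_alg_def algebra_simps)
qed (auto simp: complex_alg_def algebra_simps)

context calgebra
begin

lemma End_alg_closed: "T \<in> carrier (End_alg A) \<Longrightarrow> a \<in> carrier A \<Longrightarrow> T a \<in> carrier A"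
  by (auto simp: End_alg_def)

lemma End_alg_linear:
  assumes "T \<in> carrier (End_alg A)" "a \<in> carrier A" 
  shows "b \<in> carrier A \<Longrightarrow> T (a \<oplus> b) = T a \<oplus> T b" "T (c \<odot> a) = c \<odot> T a"
  using assms by (auto simp: End_alg_def)

lemma End_alg_eqI:
  assumes "S \<in> carrier (End_alg A)" "T \<in> carrier (End_alg A)" "\<And>a. a \<in> carrier A \<Longrightarrow> S a = T a"
  shows "S = T"
  using assms by (auto simp: End_alg_def intro: PiE_ext)

lemma End_alg_apply:
  assumes "a \<in> carrier A"
  shows "(S \<otimes>\<^bsub>End_alg A\<^esub> T) a = S (T a)" "(S \<oplus>\<^bsub>End_alg A\<^esub> T) a = S a \<oplus> T a"
    "\<one>\<^bsub>End_alg A\<^esub> a = a" "\<zero>\<^bsub>End_alg A\<^esub> a = \<zero>" "(c \<odot>\<^bsub>End_alg A\<^esub> T) a = c \<odot> T a"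
  using assms by (auto simp: End_alg_def compose_def)

lemma End_algI:
  assumes "T \<in> extensional (carrier A)" "\<And>a. a \<in> carrier A \<Longrightarrow> T a \<in> carrier A"
    "\<And>a b. a \<in> carrier A \<Longrightarrow> b \<in> carrier A \<Longrightarrow> T (a \<oplus> b) = T a \<oplus> T b"
    "\<And>c a. a \<in> carrier A \<Longrightarrow> T (c \<odot> a) = c \<odot> T a"
  shows "T \<in> carrier (End_alg A)"
  using assms by (auto simp: End_alg_def PiE_def)

lemma ring_End: "ring (End_alg A)"
proof (rule ringI)
  show "abelian_group (End_alg A)"
  proof (rule abelian_groupI)
    fix T
    assume T: "T \<in> carrier (End_alg A)"
    have "(- 1) \<odot>\<^bsub>End_alg A\<^esub> T \<in> carrier (End_alg A)"
      using T by (auto simp: End_alg_def smult_add_right smult_smult PiE_iff)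
    moreover have "(- 1) \<odot>\<^bsub>End_alg A\<^esub> T \<oplus>\<^bsub>End_alg A\<^esub> T = \<zero>\<^bsub>End_alg A\<^esub>"
      using T by (auto simp: End_alg_def smult_uminus l_neg restrict_def PiE_iff fun_eq_iff)
    ultimately show "\<exists>S\<in>carrier (End_alg A). S \<oplus>\<^bsub>End_alg A\<^esub> T = \<zero>\<^bsub>End_alg A\<^esub>"
      by blast
  qed (auto simp: End_alg_def a_ac smult_add_right PiE_iff restrict_def fun_eq_iff extensional_def)
  show "monoid (End_alg A)"
    by (rule monoidI) (auto simp: End_alg_def compose_def PiE_iff restrict_def fun_eq_iff extensional_def)
qed (auto simp: End_alg_def compose_def PiE_iff restrict_def fun_eq_iff)

lemma calgebra_End: "calgebra (End_alg A)"
  by (rule calgebraI[OF ring_End])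
    (auto simp: End_alg_def compose_def PiE_iff restrict_def fun_eq_iff extensional_def
      smult_add_left smult_add_right smult_smult mult.commute)

end

section \<open>Tensor products\<close>

definition tcls :: "'a calg \<Rightarrow> 'b calg \<Rightarrow> ('a \<times> 'b \<Rightarrow>\<^sub>0 complex) \<Rightarrow> ('a \<times> 'b \<Rightarrow>\<^sub>0 complex) set" where
  "tcls A B p = tensor_ideal A B +>\<^bsub>monoid_alg (A \<times>\<times> B)\<^esub> p"

definition bilinear_on :: "'a calg \<Rightarrow> 'b calg \<Rightarrow> ('a \<Rightarrow> 'b \<Rightarrow> 'v \<Rightarrow>\<^sub>0 complex) \<Rightarrow> bool" where
  "bilinear_on A B \<beta> \<longleftrightarrow>
    (\<forall>a\<in>carrier A. \<forall>a'\<in>carrier A. \<forall>b\<in>carrier B. \<beta> (a \<oplus>\<^bsub>A\<^esub> a') b = \<beta> a b + \<beta> a' b) \<and>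
    (\<forall>a\<in>carrier A. \<forall>b\<in>carrier B. \<forall>b'\<in>carrier B. \<beta> a (b \<oplus>\<^bsub>B\<^esub> b') = \<beta> a b + \<beta> a b') \<and>
    (\<forall>c. \<forall>a\<in>carrier A. \<forall>b\<in>carrier B. \<beta> (c \<odot>\<^bsub>A\<^esub> a) b = cscale c (\<beta> a b)) \<and>
    (\<forall>c. \<forall>a\<in>carrier A. \<forall>b\<in>carrier B. \<beta> a (c \<odot>\<^bsub>B\<^esub> b) = cscale c (\<beta> a b))"

locale two_calgebras = A: calgebra A + B: calgebra B
  for A :: "'a calg" and B :: "'b calg"
begin

abbreviation "F \<equiv> monoid_alg (A \<times>\<times> B)"
abbreviation "T \<equiv> tensor_alg A B"
abbreviation "t \<equiv> pure_tensor A B"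

lemma calgebra_F: "calgebra F"
  by (intro calgebra_monoid_alg DirProd_monoid A.is_monoid B.is_monoid)

sublocale F: calgebra F
  by (rule calgebra_F)

lemma F_carrier: "p \<in> carrier F \<longleftrightarrow> keys p \<subseteq> carrier A \<times> carrier B"
  by (simp add: monoid_alg_simps)

lemma single_in_F [simp]: "a \<in> carrier A \<Longrightarrow> b \<in> carrier B \<Longrightarrow> single (a, b) c \<in> carrier F"
  by (rule single_in_monoid_alg) simp

lemma F_uminus: "p \<in> carrier F \<Longrightarrow> \<ominus>\<^bsub>F\<^esub> p = - p"
  using F.smult_uminus[of p] by (simp add: monoid_alg_simps cscale_minus_one)

lemma F_minus: "p \<in> carrier F \<Longrightarrow> r \<in> carrier F \<Longrightarrow> p \<ominus>\<^bsub>F\<^esub> r = p - r"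
  by (simp add: a_minus_def F_uminus) (simp add: monoid_alg_simps)

lemma diff_in_F: "p \<in> carrier F \<Longrightarrow> r \<in> carrier F \<Longrightarrow> p - r \<in> carrier F"
  by (metis F_minus F.minus_closed)

lemma bilinear_rels_in_F: "bilinear_rels A B \<subseteq> carrier F"
  by (auto simp: bilinear_rels_def intro!: diff_in_F)

lemma ideal_tensor: "ideal (tensor_ideal A B) F"
  unfolding tensor_ideal_def by (rule F.genideal_ideal[OF bilinear_rels_in_F])

sublocale TI: calgebra_ideal F "tensor_ideal A B"
  by (intro calgebra_ideal.intro calgebra_F ideal_tensor)

lemma calgebra_tensor: "calgebra T"
  unfolding tensor_alg_def by (rule TI.calgebra_quot)

lemma tcls_hom: "tcls A B \<in> alg_hom F T"
  using TI.cls_hom by (simp add: tensor_alg_def tcls_def[abs_def])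

lemma tensor_carrier: "carrier T = tcls A B ` carrier F"
  unfolding tensor_alg_def tcls_def by (rule TI.quot_alg_carrier)

lemma pure_tensor_eq: "t a b = tcls A B (single (a, b) 1)"
  by (simp add: pure_tensor_def tcls_def)

lemma tcls_eq_iff: "p \<in> carrier F \<Longrightarrow> r \<in> carrier F \<Longrightarrow>
    tcls A B p = tcls A B r \<longleftrightarrow> p - r \<in> tensor_ideal A B"
  using TI.cls_eq_iff[of p r] by (simp add: F_minus tcls_def)

lemma pure_tensor_closed [simp]: "a \<in> carrier A \<Longrightarrow> b \<in> carrier B \<Longrightarrow> t a b \<in> carrier T"
  by (simp add: tensor_carrier pure_tensor_eq)

lemma pure_tensor_mult:
  assumes "a \<in> carrier A" "b \<in> carrier B" "a' \<in> carrier A" "b' \<in> carrier B"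
  shows "t a b \<otimes>\<^bsub>T\<^esub> t a' b' = t (a \<otimes>\<^bsub>A\<^esub> a') (b \<otimes>\<^bsub>B\<^esub> b')"
  using assms
  by (simp add: pure_tensor_eq flip: alg_homD(2)[OF tcls_hom]) (simp add: monoid_alg_simps)

lemma pure_tensor_one: "t \<one>\<^bsub>A\<^esub> \<one>\<^bsub>B\<^esub> = \<one>\<^bsub>T\<^esub>"
  by (simp add: pure_tensor_eq flip: alg_homD(4)[OF tcls_hom]) (simp add: monoid_alg_simps)

lemma tcls_rel:
  assumes "p - r - s \<in> bilinear_rels A B" "p \<in> carrier F" "r \<in> carrier F" "s \<in> carrier F"
  shows "tcls A B p = tcls A B r \<oplus>\<^bsub>T\<^esub> tcls A B s"
proof -
  have rs: "r + s \<in> carrier F"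
    using F.a_closed[OF assms(3,4)] by (simp add: monoid_alg_simps)
  have "p - (r + s) \<in> tensor_ideal A B"
    using F.genideal_self[OF bilinear_rels_in_F] assms(1) by (auto simp: tensor_ideal_def diff_diff_eq)
  then have "tcls A B p = tcls A B (r + s)"
    using rs assms by (simp add: tcls_eq_iff)
  then show ?thesis
    using alg_homD(3)[OF tcls_hom assms(3,4)] by (simp add: monoid_alg_simps)
qed

lemma pure_tensor_add_left:
  assumes "a \<in> carrier A" "a' \<in> carrier A" "b \<in> carrier B"
  shows "t (a \<oplus>\<^bsub>A\<^esub> a') b = t a b \<oplus>\<^bsub>T\<^esub> t a' b"
  unfolding pure_tensor_eq using assms
  by (intro tcls_rel single_in_F A.a_closed) (auto simp: bilinear_rels_def)

lemma pure_tensor_add_right: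
  assumes "a \<in> carrier A" "b \<in> carrier B" "b' \<in> carrier B"
  shows "t a (b \<oplus>\<^bsub>B\<^esub> b') = t a b \<oplus>\<^bsub>T\<^esub> t a b'"
  unfolding pure_tensor_eq using assms
  by (intro tcls_rel single_in_F B.a_closed) (auto simp: bilinear_rels_def)

lemma tcls_smult_rel:
  assumes "p - cscale c r \<in> bilinear_rels A B" "p \<in> carrier F" "r \<in> carrier F"
  shows "tcls A B p = c \<odot>\<^bsub>T\<^esub> tcls A B r"
proof -
  have "cscale c r \<in> carrier F"
    using F.smult_closed[OF assms(3), of c] by (simp add: monoid_alg_simps)
  moreover have "p - cscale c r \<in> tensor_ideal A B"
    using F.genideal_self[OF bilinear_rels_in_F] assms(1) by (auto simp: tensor_ideal_def)
  ultimately have "tcls A B p = tcls A B (cscale c r)"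
    using assms by (simp add: tcls_eq_iff)
  then show ?thesis
    using alg_homD(5)[OF tcls_hom assms(3), of c] by (simp add: monoid_alg_simps)
qed

lemma pure_tensor_smult_left:
  assumes "a \<in> carrier A" "b \<in> carrier B"
  shows "t (c \<odot>\<^bsub>A\<^esub> a) b = c \<odot>\<^bsub>T\<^esub> t a b"
  unfolding pure_tensor_eq using assms
  by (intro tcls_smult_rel single_in_F A.smult_closed) (auto simp: bilinear_rels_def)

lemma pure_tensor_smult_right:
  assumes "a \<in> carrier A" "b \<in> carrier B"
  shows "t a (c \<odot>\<^bsub>B\<^esub> b) = c \<odot>\<^bsub>T\<^esub> t a b"
  unfolding pure_tensor_eq using assms
  by (intro tcls_smult_rel single_in_F B.smult_closed) (auto simp: bilinear_rels_def)

lemma finsum_pure_tensor: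
  assumes "finite S" and "\<And>i. i \<in> S \<Longrightarrow> u i \<in> carrier A \<and> v i \<in> carrier B"
  shows "(\<Sum>i\<in>S. single (u i, v i) 1) \<in> carrier F" (is ?closed)
    and "(\<Oplus>\<^bsub>T\<^esub>i\<in>S. t (u i) (v i)) = tcls A B (\<Sum>i\<in>S. single (u i, v i) 1)" (is ?eq)
proof -
  interpret T: calgebra T by (rule calgebra_tensor)
  have "?closed \<and> ?eq"
    using assms
  proof (induct S)
    case empty
    have "tcls A B 0 = \<zero>\<^bsub>T\<^esub>"
      using alg_hom_zero[OF tcls_hom calgebra_F calgebra_tensor] by (simp add: monoid_alg_simps)
    then show ?case
      by (simp add: monoid_alg_simps)
  next
    case (insert i S)
    let ?s = "\<Sum>i\<in>S. single (u i, v i) (1::complex)"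
    have i: "u i \<in> carrier A" "v i \<in> carrier B" and S: "\<And>j. j \<in> S \<Longrightarrow> u j \<in> carrier A \<and> v j \<in> carrier B"
      using insert(4) by auto
    have IH: "?s \<in> carrier F" "(\<Oplus>\<^bsub>T\<^esub>i\<in>S. t (u i) (v i)) = tcls A B ?s"
      using insert(3)[OF S] by auto
    have single: "single (u i, v i) (1::complex) \<in> carrier F"
      using i by simp
    have "(\<Oplus>\<^bsub>T\<^esub>i\<in>insert i S. t (u i) (v i)) = t (u i) (v i) \<oplus>\<^bsub>T\<^esub> tcls A B ?s"
      using insert(1,2) i S IH(2) by (subst T.finsum_insert) auto
    also have "\<dots> = tcls A B (single (u i, v i) 1 + ?s)"
      using alg_homD(3)[OF tcls_hom single IH(1)] by (simp add: pure_tensor_eq monoid_alg_simps)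
    finally show ?case
      using F.a_closed[OF single IH(1)] insert(1,2) by (simp add: monoid_alg_simps)
  qed
  then show ?closed ?eq
    by auto
qed

lemma bilinear_on_translate:
  assumes \<beta>: "bilinear_on A B \<beta>" and ab: "a \<in> carrier A" "b \<in> carrier B"
  shows "bilinear_on A B (\<lambda>u v. \<beta> (a \<otimes>\<^bsub>A\<^esub> u) (b \<otimes>\<^bsub>B\<^esub> v))"
    and "bilinear_on A B (\<lambda>u v. \<beta> (u \<otimes>\<^bsub>A\<^esub> a) (v \<otimes>\<^bsub>B\<^esub> b))"
  using \<beta> ab unfolding bilinear_on_def
  by (simp_all add: A.r_distr B.r_distr A.l_distr B.l_distr
      A.smult_mult_left A.smult_mult_right B.smult_mult_left B.smult_mult_right)

text \<open>
  The elements of the free vector space on pairs that every bilinear map kills form a two-sided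
  ideal, because \<open>(u, v) \<mapsto> \<beta> (a u) (b v)\<close> and \<open>(u, v) \<mapsto> \<beta> (u a) (v b)\<close> are bilinear whenever
  \<open>\<beta>\<close> is. This ideal contains the bilinearity relations, hence the whole tensor ideal.
\<close>

lemma bilinear_factors:
  assumes \<beta>: "bilinear_on A B \<beta>"
    and pr: "p \<in> carrier F" "r \<in> carrier F" "tcls A B p = tcls A B r"
  shows "lext (case_prod \<beta>) p = lext (case_prod \<beta>) r"
proof -
  define K where "K = {p \<in> carrier F. \<forall>\<gamma>::'a \<Rightarrow> 'b \<Rightarrow> 'c \<Rightarrow>\<^sub>0 complex. bilinear_on A B \<gamma> \<longrightarrow> lext (case_prod \<gamma>) p = 0}"
  have KI: "p \<in> K" if "p \<in> carrier F"
    "\<And>\<gamma>::'a \<Rightarrow> 'b \<Rightarrow> 'c \<Rightarrow>\<^sub>0 complex. bilinear_on A B \<gamma> \<Longrightarrow> lext (case_prod \<gamma>) p = 0" for p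
    using that by (simp add: K_def)
  have KD: "p \<in> carrier F" "bilinear_on A B \<gamma> \<Longrightarrow> lext (case_prod \<gamma>) p = 0" if "p \<in> K"
    for p and \<gamma> :: "'a \<Rightarrow> 'b \<Rightarrow> 'c \<Rightarrow>\<^sub>0 complex"
    using that by (simp_all add: K_def)
  have mult: "(a, b) \<otimes>\<^bsub>A \<times>\<times> B\<^esub> (a', b') = (a \<otimes>\<^bsub>A\<^esub> a', b \<otimes>\<^bsub>B\<^esub> b')" for a b a' b'
    by (simp add: DirProd_def)
  have "ideal K F"
  proof (rule idealI[OF F.ring_axioms])
    show "subgroup K (add_monoid F)"
    proof
      show "K \<subseteq> carrier (add_monoid F)"
        using KD(1) by auto
      show "x \<otimes>\<^bsub>add_monoid F\<^esub> y \<in> K" if "x \<in> K" "y \<in> K" for x y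
      proof (rule KI)
        show "x \<otimes>\<^bsub>add_monoid F\<^esub> y \<in> carrier F"
          using F.a_closed[OF KD(1)[OF that(1)] KD(1)[OF that(2)]] by simp
        fix \<gamma> :: "'a \<Rightarrow> 'b \<Rightarrow> 'c \<Rightarrow>\<^sub>0 complex"
        assume "bilinear_on A B \<gamma>"
        then show "lext (case_prod \<gamma>) (x \<otimes>\<^bsub>add_monoid F\<^esub> y) = 0"
          using KD(2)[OF that(1)] KD(2)[OF that(2)] by (simp add: monoid_alg_simps lext_add)
      qed
      show "\<one>\<^bsub>add_monoid F\<^esub> \<in> K"
        by (rule KI) (simp_all add: monoid_alg_simps lext_zero)
      show "inv\<^bsub>add_monoid F\<^esub> x \<in> K" if "x \<in> K" for x
      proof -
        have x: "inv\<^bsub>add_monoid F\<^esub> x = - x"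
          using F_uminus[OF KD(1)[OF that]] by (simp add: a_inv_def)
        show ?thesis
          unfolding x
        proof (rule KI)
          show "- x \<in> carrier F"
            using F_uminus[OF KD(1)[OF that]] F.a_inv_closed[OF KD(1)[OF that]] by simp
          show "lext (case_prod \<gamma>) (- x) = 0" if "bilinear_on A B \<gamma>"
            for \<gamma> :: "'a \<Rightarrow> 'b \<Rightarrow> 'c \<Rightarrow>\<^sub>0 complex"
            using KD(2)[OF \<open>x \<in> K\<close> that] lext_cscale[of "case_prod \<gamma>" "- 1" x]
            by (simp add: cscale_minus_one)
        qed
      qed
    qed
    fix p x
    assume p: "p \<in> K" and x: "x \<in> carrier F"
    show "x \<otimes>\<^bsub>F\<^esub> p \<in> K"
    proof (rule KI)
      show "x \<otimes>\<^bsub>F\<^esub> p \<in> carrier F"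
        using x KD(1)[OF p] by simp
      fix \<gamma> :: "'a \<Rightarrow> 'b \<Rightarrow> 'c \<Rightarrow>\<^sub>0 complex"
      assume \<gamma>: "bilinear_on A B \<gamma>"
      have "lext (case_prod \<gamma>) (x \<otimes>\<^bsub>F\<^esub> p)
          = lext (\<lambda>u. lext (\<lambda>v. case_prod \<gamma> (u \<otimes>\<^bsub>A \<times>\<times> B\<^esub> v)) p) x"
        by (simp add: monoid_alg_simps lext_bext) (simp add: bext_def)
      also have "\<dots> = lext (\<lambda>u. 0) x"
      proof (rule lext_cong)
        fix u
        assume "u \<in> keys x"
        then obtain a b where u: "u = (a, b)" "a \<in> carrier A" "b \<in> carrier B"
          using x by (auto simp: F_carrier)
        have "(\<lambda>v. case_prod \<gamma> (u \<otimes>\<^bsub>A \<times>\<times> B\<^esub> v)) = case_prod (\<lambda>a' b'. \<gamma> (a \<otimes>\<^bsub>A\<^esub> a') (b \<otimes>\<^bsub>B\<^esub> b'))"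
          by (auto simp: u mult fun_eq_iff)
        then show "lext (\<lambda>v. case_prod \<gamma> (u \<otimes>\<^bsub>A \<times>\<times> B\<^esub> v)) p = 0"
          using KD(2)[OF p bilinear_on_translate(1)[OF \<gamma> u(2,3)]] by simp
      qed
      finally show "lext (case_prod \<gamma>) (x \<otimes>\<^bsub>F\<^esub> p) = 0"
        by (simp add: lext_def)
    qed
    show "p \<otimes>\<^bsub>F\<^esub> x \<in> K"
    proof (rule KI)
      show "p \<otimes>\<^bsub>F\<^esub> x \<in> carrier F"
        using x KD(1)[OF p] by simp
      fix \<gamma> :: "'a \<Rightarrow> 'b \<Rightarrow> 'c \<Rightarrow>\<^sub>0 complex"
      assume \<gamma>: "bilinear_on A B \<gamma>"
      have "lext (case_prod \<gamma>) (p \<otimes>\<^bsub>F\<^esub> x)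
          = lext (\<lambda>u. lext (\<lambda>v. case_prod \<gamma> (v \<otimes>\<^bsub>A \<times>\<times> B\<^esub> u)) p) x"
        by (simp add: monoid_alg_simps lext_bext) (simp add: bext_def, rule lext_swap)
      also have "\<dots> = lext (\<lambda>u. 0) x"
      proof (rule lext_cong)
        fix u
        assume "u \<in> keys x"
        then obtain a b where u: "u = (a, b)" "a \<in> carrier A" "b \<in> carrier B"
          using x by (auto simp: F_carrier)
        have "(\<lambda>v. case_prod \<gamma> (v \<otimes>\<^bsub>A \<times>\<times> B\<^esub> u)) = case_prod (\<lambda>a' b'. \<gamma> (a' \<otimes>\<^bsub>A\<^esub> a) (b' \<otimes>\<^bsub>B\<^esub> b))"
          by (auto simp: u mult fun_eq_iff)
        then show "lext (\<lambda>v. case_prod \<gamma> (v \<otimes>\<^bsub>A \<times>\<times> B\<^esub> u)) p = 0"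
          using KD(2)[OF p bilinear_on_translate(2)[OF \<gamma> u(2,3)]] by simp
      qed
      finally show "lext (case_prod \<gamma>) (p \<otimes>\<^bsub>F\<^esub> x) = 0"
        by (simp add: lext_def)
    qed
  qed
  moreover have "bilinear_rels A B \<subseteq> K"
  proof
    fix p
    assume p: "p \<in> bilinear_rels A B"
    show "p \<in> K"
    proof (rule KI)
      show "p \<in> carrier F"
        using p bilinear_rels_in_F by auto
      fix \<gamma> :: "'a \<Rightarrow> 'b \<Rightarrow> 'c \<Rightarrow>\<^sub>0 complex"
      assume "bilinear_on A B \<gamma>"
      then show "lext (case_prod \<gamma>) p = 0"
        using p by (auto simp: bilinear_rels_def bilinear_on_def lext_diff)
    qed
  qed
  ultimately have "tensor_ideal A B \<subseteq> K"
    unfolding tensor_ideal_def by (rule F.genideal_minimal)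
  then have "lext (case_prod \<beta>) (p - r) = 0"
    using pr \<beta> KD(2) by (auto simp: tcls_eq_iff)
  then show ?thesis
    by (simp add: lext_diff)
qed

end

section \<open>The quantum universal enveloping algebra\<close>

text \<open>
  The relation between \<open>E\<close> and \<open>F\<close> is written without subtraction, which spares the handling of
  additive inverses when it is verified in tensor products and in endomorphism algebras.
\<close>

definition uq_relations :: "'a calg \<Rightarrow> complex \<Rightarrow> 'a \<Rightarrow> 'a \<Rightarrow> 'a \<Rightarrow> 'a \<Rightarrow> bool" where
  "uq_relations A q K K' E F \<longleftrightarrow>
    K \<in> carrier A \<and> K' \<in> carrier A \<and> E \<in> carrier A \<and> F \<in> carrier A \<and>
    K' \<otimes>\<^bsub>A\<^esub> K = \<one>\<^bsub>A\<^esub> \<and> K \<otimes>\<^bsub>A\<^esub> K' = \<one>\<^bsub>A\<^esub> \<and>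
    K \<otimes>\<^bsub>A\<^esub> E = q\<^sup>2 \<odot>\<^bsub>A\<^esub> (E \<otimes>\<^bsub>A\<^esub> K) \<and>
    K \<otimes>\<^bsub>A\<^esub> F = inverse (q\<^sup>2) \<odot>\<^bsub>A\<^esub> (F \<otimes>\<^bsub>A\<^esub> K) \<and>
    E \<otimes>\<^bsub>A\<^esub> F \<oplus>\<^bsub>A\<^esub> (1 / (q - inverse q)) \<odot>\<^bsub>A\<^esub> K'
      = F \<otimes>\<^bsub>A\<^esub> E \<oplus>\<^bsub>A\<^esub> (1 / (q - inverse q)) \<odot>\<^bsub>A\<^esub> K"

lemma uq_relationsD:
  assumes "uq_relations A q K K' E F"
  shows "K \<in> carrier A" "K' \<in> carrier A" "E \<in> carrier A" "F \<in> carrier A"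
    "K' \<otimes>\<^bsub>A\<^esub> K = \<one>\<^bsub>A\<^esub>" "K \<otimes>\<^bsub>A\<^esub> K' = \<one>\<^bsub>A\<^esub>"
    "K \<otimes>\<^bsub>A\<^esub> E = q\<^sup>2 \<odot>\<^bsub>A\<^esub> (E \<otimes>\<^bsub>A\<^esub> K)"
    "K \<otimes>\<^bsub>A\<^esub> F = inverse (q\<^sup>2) \<odot>\<^bsub>A\<^esub> (F \<otimes>\<^bsub>A\<^esub> K)"
    "E \<otimes>\<^bsub>A\<^esub> F \<oplus>\<^bsub>A\<^esub> (1 / (q - inverse q)) \<odot>\<^bsub>A\<^esub> K'
      = F \<otimes>\<^bsub>A\<^esub> E \<oplus>\<^bsub>A\<^esub> (1 / (q - inverse q)) \<odot>\<^bsub>A\<^esub> K"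
  using assms by (simp_all add: uq_relations_def)

context calgebra
begin

lemma minus_minus_eq_zero:
  assumes "a \<in> carrier A" "b \<in> carrier A" "c \<in> carrier A" "d \<in> carrier A" "a \<oplus> d = b \<oplus> c"
  shows "(a \<ominus> b) \<ominus> (c \<ominus> d) = \<zero>"
proof -
  have "(a \<ominus> b) \<ominus> (c \<ominus> d) = (a \<oplus> d) \<ominus> (b \<oplus> c)"
    using assms(1-4) by (simp add: a_minus_def minus_add a_ac)
  then show ?thesis
    using assms by (simp add: minus_eq_zero_iff)
qed

lemma uq_rels_vanish:
  assumes rel: "uq_relations A q K K' E F" and r: "r \<in> uq_rels q"
  shows "free_lift A (case_uq_gen K K' E F) r = \<zero>"
proof -
  let ?v = "case_uq_gen K K' E F"
  note D = uq_relationsD[OF rel]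
  have v: "\<And>g. ?v g \<in> carrier A"
    using D by (simp split: uq_gen.split)
  note simps = free_lift_diff[OF v] free_lift_single[OF v] word_value_simps[OF v]
  show ?thesis
    using r unfolding uq_rels_def
    by (elim insertE emptyE; hypsubst; simp only: simps)
      (use D in \<open>simp_all add: minus_eq_zero_iff minus_minus_eq_zero\<close>)
qed

lemma uq_hom:
  assumes rel: "uq_relations A q K K' E F"
  defines "h \<equiv> presented_hom (uq_rels q) A (case_uq_gen K K' E F)"
  shows "h \<in> alg_hom (uq q) A" (is ?hom) and "h \<in> extensional (carrier (uq q))" (is ?ext)
    and "h (uk q) = K" (is ?k) and "h (ukinv q) = K'" (is ?k') and "h (ue q) = E" (is ?e) and "h (uf q) = F" (is ?f)
proof -
  have v: "case_uq_gen K K' E F g \<in> carrier A" for g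
    using uq_relationsD[OF rel] by (simp split: uq_gen.split)
  note * = presented_hom[of "case_uq_gen K K' E F" "uq_rels q", OF v uq_rels_vanish[OF rel], folded h_def]
  show ?hom ?ext
    unfolding uq_def by (rule *; assumption)+
  show ?k ?k' ?e ?f
    unfolding uk_def ukinv_def ue_def uf_def by (subst *(3); simp)+
qed

text \<open>
  Obtained by multiplying the relations for \<open>K\<close> by \<open>K'\<close> from both sides.
\<close>

lemma uq_relations_kinv:
  assumes rel: "uq_relations A q K K' E F" and q: "q \<noteq> 0"
  shows "K' \<otimes> E = inverse (q\<^sup>2) \<odot> (E \<otimes> K')" and "K' \<otimes> F = q\<^sup>2 \<odot> (F \<otimes> K')"
proof -
  note D = uq_relationsD[OF rel]
  have swap: "K' \<otimes> X = inverse c \<odot> (X \<otimes> K')"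
    if X: "X \<in> carrier A" and KX: "K \<otimes> X = c \<odot> (X \<otimes> K)" and c: "c \<noteq> 0" for X c
  proof -
    have "X \<otimes> K' = K' \<otimes> (K \<otimes> X) \<otimes> K'"
      using D(1-6) X by (simp flip: m_assoc)
    also have "\<dots> = c \<odot> (K' \<otimes> X \<otimes> (K \<otimes> K'))"
      using D(1,2) X by (simp only: KX smult_mult_left smult_mult_right m_assoc m_closed)
    also have "\<dots> = c \<odot> (K' \<otimes> X)"
      using D(2,6) X by simp
    finally show ?thesis
      using c X D(2) by (simp add: smult_smult)
  qed
  show "K' \<otimes> E = inverse (q\<^sup>2) \<odot> (E \<otimes> K')"
    using swap[OF D(3,7)] q by simp
  show "K' \<otimes> F = q\<^sup>2 \<odot> (F \<otimes> K')"
    using swap[OF D(4,8)] q by simp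
qed

end

lemma calgebra_uq: "calgebra (uq q)"
  unfolding uq_def by (rule calgebra_presented)

lemma uq_gen_closed [simp]:
  "uk q \<in> carrier (uq q)" "ukinv q \<in> carrier (uq q)" "ue q \<in> carrier (uq q)" "uf q \<in> carrier (uq q)"
  by (simp_all add: uq_def uk_def ukinv_def ue_def uf_def)

lemma uq_relations_uq: "uq_relations (uq q) q (uk q) (ukinv q) (ue q) (uf q)"
proof -
  let ?s = "1 / (q - inverse q)"
  let ?w = "\<lambda>w c. pcls (uq_rels q) (single w c)"
  have word: "presented_gen (uq_rels q) a \<otimes>\<^bsub>uq q\<^esub> presented_gen (uq_rels q) b = ?w [a, b] 1" for a b
    by (simp add: uq_def presented_gen_eq flip: pcls_simps)
  have sm: "c \<odot>\<^bsub>uq q\<^esub> ?w w 1 = ?w w c" for c w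
    by (simp add: uq_def flip: pcls_simps)
  have one: "\<one>\<^bsub>uq q\<^esub> = ?w [] 1"
    by (simp add: uq_def flip: pcls_simps)
  have add: "pcls (uq_rels q) p \<oplus>\<^bsub>uq q\<^esub> pcls (uq_rels q) r = pcls (uq_rels q) (p + r)" for p r
    by (simp add: uq_def flip: pcls_simps)
  have gen: "presented_gen (uq_rels q) g = ?w [g] 1" for g
    by (rule presented_gen_eq)
  show ?thesis
    unfolding uq_relations_def uk_def ukinv_def ue_def uf_def word sm one
    unfolding gen sm add
    by (intro conjI pcls_rel) (auto simp: uq_def uq_rels_def algebra_simps)
qed

lemma counit_relations:
  "uq_relations complex_alg q 1 1 0 0"
  by (simp add: uq_relations_def complex_alg_def)

lemma uq_counit:
  shows "uq_counit q \<in> alg_hom (uq q) complex_alg"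
    and "uq_counit q (uk q) = 1" "uq_counit q (ukinv q) = 1" "uq_counit q (ue q) = 0" "uq_counit q (uf q) = 0"
  unfolding uq_counit_def
  using calgebra.uq_hom[OF calgebra_complex counit_relations, of q] by auto

text \<open>
  The only relation that is not immediate is the one between \<open>e\<close> and \<open>f\<close>. In the two products the
  mixed terms \<open>e k' \<otimes> k f\<close> and \<open>k' e \<otimes> f k\<close> agree, since moving \<open>k'\<close> past \<open>e\<close> and \<open>k\<close> past
  \<open>f\<close> both give the factor \<open>q^(-2)\<close>. What remains is
  \<open>k' \<otimes> (e f - f e) + (e f - f e) \<otimes> k\<close>, which is a multiple of
  \<open>k' \<otimes> (k - k') + (k - k') \<otimes> k = k \<otimes> k - k' \<otimes> k'\<close>.
\<close>

lemma comult_relations: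
  fixes q
  defines "H \<equiv> uq q"
  defines "HH \<equiv> tensor_alg H H" and "t \<equiv> pure_tensor H H"
  assumes q: "q \<noteq> 0"
  shows "uq_relations HH q (t (uk q) (uk q)) (t (ukinv q) (ukinv q))
    (t \<one>\<^bsub>H\<^esub> (ue q) \<oplus>\<^bsub>HH\<^esub> t (ue q) (uk q)) (t (uf q) \<one>\<^bsub>H\<^esub> \<oplus>\<^bsub>HH\<^esub> t (ukinv q) (uf q))"
proof -
  interpret H: calgebra H
    unfolding H_def by (rule calgebra_uq)
  interpret two_calgebras H H ..
  interpret HH: calgebra HH
    unfolding HH_def by (rule calgebra_tensor)
  define k k' e f s where "k = uk q" "k' = ukinv q" "e = ue q" "f = uf q" "s = 1 / (q - inverse q)"
  have rel: "uq_relations H q k k' e f"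
    unfolding k_k'_e_f_s_def H_def by (rule uq_relations_uq)
  note D = uq_relationsD[OF rel, folded k_k'_e_f_s_def(5)] and D' = H.uq_relations_kinv[OF rel q]
  note tc [simp] = pure_tensor_closed[folded HH_def t_def]
  note mult = pure_tensor_mult[folded HH_def t_def]
  note one = pure_tensor_one[folded HH_def t_def]
  note addl = pure_tensor_add_left[folded HH_def t_def] and addr = pure_tensor_add_right[folded HH_def t_def]
  note sml = pure_tensor_smult_left[folded HH_def t_def] and smr = pure_tensor_smult_right[folded HH_def t_def]
  note dist = HH.l_distr HH.r_distr HH.smult_add_right HH.smult_smult
  have X: "t (e \<otimes>\<^bsub>H\<^esub> k') (k \<otimes>\<^bsub>H\<^esub> f) = t (k' \<otimes>\<^bsub>H\<^esub> e) (f \<otimes>\<^bsub>H\<^esub> k)"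
    using D(1-4) by (simp add: D(8) D'(1) sml smr)
  have Y: "t k' (e \<otimes>\<^bsub>H\<^esub> f) \<oplus>\<^bsub>HH\<^esub> s \<odot>\<^bsub>HH\<^esub> t k' k' = t k' (f \<otimes>\<^bsub>H\<^esub> e) \<oplus>\<^bsub>HH\<^esub> s \<odot>\<^bsub>HH\<^esub> t k' k"
    using D(1-4) arg_cong[OF D(9), of "t k'"] by (simp add: addr smr)
  have Z: "t (e \<otimes>\<^bsub>H\<^esub> f) k \<oplus>\<^bsub>HH\<^esub> s \<odot>\<^bsub>HH\<^esub> t k' k = t (f \<otimes>\<^bsub>H\<^esub> e) k \<oplus>\<^bsub>HH\<^esub> s \<odot>\<^bsub>HH\<^esub> t k k"
    using D(1-4) arg_cong[OF D(9), of "\<lambda>u. t u k"] by (simp add: addl sml)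
  \<comment> \<open>The mixed term \<open>k' \<otimes> k\<close> that cancels in the sum above occurs here as \<open>d'\<close>.\<close>
  have regroup: "((a \<oplus>\<^bsub>HH\<^esub> b) \<oplus>\<^bsub>HH\<^esub> (c \<oplus>\<^bsub>HH\<^esub> x)) \<oplus>\<^bsub>HH\<^esub> d
      = ((a \<oplus>\<^bsub>HH\<^esub> c') \<oplus>\<^bsub>HH\<^esub> (b' \<oplus>\<^bsub>HH\<^esub> x)) \<oplus>\<^bsub>HH\<^esub> d''"
    if "b \<oplus>\<^bsub>HH\<^esub> d = b' \<oplus>\<^bsub>HH\<^esub> d'" "c \<oplus>\<^bsub>HH\<^esub> d' = c' \<oplus>\<^bsub>HH\<^esub> d''"
      "{a, b, c, x, d, b', c', d', d''} \<subseteq> carrier HH" for a b c x d b' c' d' d''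
  proof -
    have "((a \<oplus>\<^bsub>HH\<^esub> b) \<oplus>\<^bsub>HH\<^esub> (c \<oplus>\<^bsub>HH\<^esub> x)) \<oplus>\<^bsub>HH\<^esub> d = (a \<oplus>\<^bsub>HH\<^esub> x) \<oplus>\<^bsub>HH\<^esub> (c \<oplus>\<^bsub>HH\<^esub> (b \<oplus>\<^bsub>HH\<^esub> d))"
      using that(3) by (simp add: HH.a_ac)
    also have "\<dots> = (a \<oplus>\<^bsub>HH\<^esub> x) \<oplus>\<^bsub>HH\<^esub> (b' \<oplus>\<^bsub>HH\<^esub> (c \<oplus>\<^bsub>HH\<^esub> d'))"
      using that(3) by (simp add: that(1)) (simp add: HH.a_ac)
    also have "\<dots> = ((a \<oplus>\<^bsub>HH\<^esub> c') \<oplus>\<^bsub>HH\<^esub> (b' \<oplus>\<^bsub>HH\<^esub> x)) \<oplus>\<^bsub>HH\<^esub> d''"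
      using that(3) by (simp add: that(2)) (simp add: HH.a_ac)
    finally show ?thesis .
  qed
  let ?E = "t \<one>\<^bsub>H\<^esub> e \<oplus>\<^bsub>HH\<^esub> t e k" and ?F = "t f \<one>\<^bsub>H\<^esub> \<oplus>\<^bsub>HH\<^esub> t k' f"
  have EF: "?E \<otimes>\<^bsub>HH\<^esub> ?F = (t f e \<oplus>\<^bsub>HH\<^esub> t k' (e \<otimes>\<^bsub>H\<^esub> f)) \<oplus>\<^bsub>HH\<^esub> (t (e \<otimes>\<^bsub>H\<^esub> f) k \<oplus>\<^bsub>HH\<^esub> t (e \<otimes>\<^bsub>H\<^esub> k') (k \<otimes>\<^bsub>H\<^esub> f))"
    using D(1-4) by (simp add: dist mult HH.a_ac)
  have FE: "?F \<otimes>\<^bsub>HH\<^esub> ?E = (t f e \<oplus>\<^bsub>HH\<^esub> t (f \<otimes>\<^bsub>H\<^esub> e) k) \<oplus>\<^bsub>HH\<^esub> (t k' (f \<otimes>\<^bsub>H\<^esub> e) \<oplus>\<^bsub>HH\<^esub> t (k' \<otimes>\<^bsub>H\<^esub> e) (f \<otimes>\<^bsub>H\<^esub> k))"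
    using D(1-4) by (simp add: dist mult HH.a_ac)
  have "?E \<otimes>\<^bsub>HH\<^esub> ?F \<oplus>\<^bsub>HH\<^esub> s \<odot>\<^bsub>HH\<^esub> t k' k' = ?F \<otimes>\<^bsub>HH\<^esub> ?E \<oplus>\<^bsub>HH\<^esub> s \<odot>\<^bsub>HH\<^esub> t k k"
    unfolding EF FE X by (rule regroup[OF Y Z]) (use D(1-4) in simp)
  moreover have "t k k \<otimes>\<^bsub>HH\<^esub> ?E = q\<^sup>2 \<odot>\<^bsub>HH\<^esub> (?E \<otimes>\<^bsub>HH\<^esub> t k k)"
    using D(1-4) by (simp add: dist mult D(7) sml smr)
  moreover have "t k k \<otimes>\<^bsub>HH\<^esub> ?F = inverse (q\<^sup>2) \<odot>\<^bsub>HH\<^esub> (?F \<otimes>\<^bsub>HH\<^esub> t k k)"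
    using D(1-6) by (simp add: dist mult D(8) sml smr)
  ultimately show ?thesis
    unfolding k_k'_e_f_s_def(1-4)[symmetric] uq_relations_def k_k'_e_f_s_def(5)[symmetric]
    using D(1-6) by (simp add: mult one)
qed

lemma uq_comult:
  fixes q
  defines "H \<equiv> uq q"
  defines "HH \<equiv> tensor_alg H H" and "t \<equiv> pure_tensor H H"
  assumes q: "q \<noteq> 0"
  shows "uq_comult q \<in> alg_hom H HH"
    and "uq_comult q (uk q) = t (uk q) (uk q)" (is ?k)
    and "uq_comult q (ukinv q) = t (ukinv q) (ukinv q)" (is ?k')
    and "uq_comult q (ue q) = t \<one>\<^bsub>H\<^esub> (ue q) \<oplus>\<^bsub>HH\<^esub> t (ue q) (uk q)" (is ?e)
    and "uq_comult q (uf q) = t (uf q) \<one>\<^bsub>H\<^esub> \<oplus>\<^bsub>HH\<^esub> t (ukinv q) (uf q)" (is ?f)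
proof -
  interpret H: calgebra H
    unfolding H_def by (rule calgebra_uq)
  interpret two_calgebras H H ..
  have HH: "calgebra HH"
    unfolding HH_def by (rule calgebra_tensor)
  note hom = calgebra.uq_hom[OF HH comult_relations[OF q, folded H_def, folded HH_def t_def]]
  have eq: "uq_comult q = presented_hom (uq_rels q) HH (case_uq_gen (t (uk q) (uk q)) (t (ukinv q) (ukinv q))
    (t \<one>\<^bsub>H\<^esub> (ue q) \<oplus>\<^bsub>HH\<^esub> t (ue q) (uk q)) (t (uf q) \<one>\<^bsub>H\<^esub> \<oplus>\<^bsub>HH\<^esub> t (ukinv q) (uf q)))"
    by (simp add: uq_comult_def Let_def H_def HH_def t_def)
  show "uq_comult q \<in> alg_hom H HH"
    unfolding eq by (rule hom(1)[folded H_def])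
  show ?k ?k' ?e ?f
    unfolding eq by (rule hom)+
qed

lemma uq_induct [consumes 1, case_names one k kinv e f mult add smult]:
  assumes "X \<in> carrier (uq q)" and "P \<one>\<^bsub>uq q\<^esub>" and "P (uk q)" "P (ukinv q)" "P (ue q)" "P (uf q)"
    and "\<And>X Y. X \<in> carrier (uq q) \<Longrightarrow> Y \<in> carrier (uq q) \<Longrightarrow> P X \<Longrightarrow> P Y \<Longrightarrow> P (X \<otimes>\<^bsub>uq q\<^esub> Y)"
    and "\<And>X Y. X \<in> carrier (uq q) \<Longrightarrow> Y \<in> carrier (uq q) \<Longrightarrow> P X \<Longrightarrow> P Y \<Longrightarrow> P (X \<oplus>\<^bsub>uq q\<^esub> Y)"
    and "\<And>c X. X \<in> carrier (uq q) \<Longrightarrow> P X \<Longrightarrow> P (c \<odot>\<^bsub>uq q\<^esub> X)"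
  shows "P X"
proof -
  have "P (presented_gen (uq_rels q) g)" for g
    using assms(3-6) by (cases g) (simp_all add: uk_def ukinv_def ue_def uf_def)
  with assms show ?thesis
    unfolding uq_def by (rule_tac presented_induct[of X "uq_rels q" P]) auto
qed

section \<open>Coordinates on the quantum plane\<close>

lemma poly_mapping_single_add_induct [case_names single add]:
  fixes p :: "'u \<Rightarrow>\<^sub>0 complex"
  assumes single: "\<And>u c. P (single u c)" and add: "\<And>p r. P p \<Longrightarrow> P r \<Longrightarrow> P (p + r)"
  shows "P p"
proof -
  have "P (\<Sum>u\<in>S. cscale (lookup p u) (single u 1))" if "finite S" for S
    using that
  proof (induct S)
    case empty
    show ?case
      using single[of undefined 0] by simp
  next
    case (insert u S)
    then show ?case
      using add[OF single[of u "lookup p u"]] by simp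
  qed
  then show ?thesis
    by (subst poly_mapping_expand) simp
qed

type_synonym qp_poly = "nat \<times> nat \<Rightarrow>\<^sub>0 complex"

abbreviation mon :: "nat \<Rightarrow> nat \<Rightarrow> qp_poly" where
  "mon m n \<equiv> single (m, n) 1"

text \<open>
  The product of the quantum plane in the basis of the monomials \<open>x^m y^n\<close>, which are indexed by
  their exponents \<open>(m, n)\<close>: moving \<open>y^b\<close> past \<open>x^c\<close> gives the factor \<open>q^(bc)\<close>.
\<close>

definition pmul :: "complex \<Rightarrow> qp_poly \<Rightarrow> qp_poly \<Rightarrow> qp_poly" where
  "pmul q = bext (\<lambda>(a, b) (c, d). single (a + c, b + d) (q ^ (b * c)))"

lemma clin_pmul_left: "clin (\<lambda>p. pmul q p r)"
  unfolding pmul_def by (rule clin_bext_left)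

lemma clin_pmul_right: "clin (pmul q p)"
  unfolding pmul_def by (rule clin_bext_right)

lemmas pmul_linear_left = clinD[OF clin_pmul_left]
  and pmul_linear_right = clinD[OF clin_pmul_right]

lemma pmul_single [simp]:
  "pmul q (single (a, b) c) (single (a', b') d)
    = single (a + a', b + b') (c * d * q ^ (b * a'))"
  by (simp add: pmul_def)

lemma pmul_assoc: "pmul q (pmul q p r) s = pmul q p (pmul q r s)"
  unfolding pmul_def by (rule bext_assoc) (auto simp: algebra_simps power_add)

lemma pmul_one [simp]: "pmul q (mon 0 0) p = p" "pmul q p (mon 0 0) = p"
  by (rule clin_eq_on_keys[OF clin_pmul_right clin_id], auto)
    (rule clin_eq_on_keys[OF clin_pmul_left clin_id], auto)

definition qp_model :: "complex \<Rightarrow> qp_poly calg" where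
  "qp_model q = \<lparr>carrier = UNIV, mult = pmul q, one = mon 0 0, zero = 0, add = (+), smult = cscale\<rparr>"

lemma qp_model_simps [simp]:
  "carrier (qp_model q) = UNIV" "mult (qp_model q) = pmul q" "one (qp_model q) = mon 0 0"
  "zero (qp_model q) = 0" "add (qp_model q) = (+)" "smult (qp_model q) = cscale"
  by (simp_all add: qp_model_def)

lemma calgebra_qp_model: "calgebra (qp_model q)"
proof (rule calgebraI)
  show "ring (qp_model q)"
  proof (rule ringI)
    show "abelian_group (qp_model q)"
      by (rule abelian_groupI) (auto simp: ac_simps intro: exI[of _ "- _"])
    show "monoid (qp_model q)"
      by (rule monoidI) (auto simp: pmul_assoc)
  qed (auto simp: pmul_linear_left pmul_linear_right)
qed (auto simp: pmul_linear_left pmul_linear_right cscale_add cscale_add_left)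

lemma calgebra_qplane: "calgebra (qplane q)"
  unfolding qplane_def by (rule calgebra_presented)

definition coords :: "complex \<Rightarrow> (qp_gen list \<Rightarrow>\<^sub>0 complex) set \<Rightarrow> qp_poly" where
  "coords q = presented_hom (qp_rels q) (qp_model q) (case_qp_gen (mon 1 0) (mon 0 1))"

definition normal_word :: "nat \<times> nat \<Rightarrow> qp_gen list" where
  "normal_word = (\<lambda>(m, n). replicate m Gx @ replicate n Gy)"

definition of_coords :: "complex \<Rightarrow> qp_poly \<Rightarrow> (qp_gen list \<Rightarrow>\<^sub>0 complex) set" where
  "of_coords q p = pcls (qp_rels q) (lext (\<lambda>u. single (normal_word u) 1) p)"

lemma coords_hom: "coords q \<in> alg_hom (qplane q) (qp_model q)"
  and coords_gen: "coords q (qx q) = mon 1 0" "coords q (qy q) = mon 0 1"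
proof -
  interpret calgebra "qp_model q" by (rule calgebra_qp_model)
  have v: "case_qp_gen (mon 1 0) (mon 0 1) g \<in> carrier (qp_model q)" for g
    by simp
  have minus: "p \<ominus>\<^bsub>qp_model q\<^esub> r = p - r" for p r
    using smult_uminus[of r] by (simp add: a_minus_def cscale_minus_one)
  have "free_lift (qp_model q) (case_qp_gen (mon 1 0) (mon 0 1)) r = \<zero>\<^bsub>qp_model q\<^esub>" if "r \<in> qp_rels q" for r
    using that unfolding qp_rels_def
    by (elim insertE emptyE; hypsubst; simp only: free_lift_diff[OF v] free_lift_single[OF v] word_value_simps[OF v])
      (simp add: minus)
  note * = presented_hom[of "case_qp_gen (mon 1 0) (mon 0 1)", OF v this]
  show "coords q \<in> alg_hom (qplane q) (qp_model q)"
    unfolding coords_def qplane_def by (rule *(1))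
  show "coords q (qx q) = mon 1 0" "coords q (qy q) = mon 0 1"
    unfolding coords_def qx_def qy_def by (subst *(3); simp)+
qed

lemmas coords_simps = alg_homD(2-5)[OF coords_hom, simplified]

lemma of_coords_closed [simp]: "of_coords q p \<in> carrier (qplane q)"
  by (simp add: of_coords_def qplane_def)

lemma of_coords_add: "of_coords q (p + r) = of_coords q p \<oplus>\<^bsub>qplane q\<^esub> of_coords q r"
  by (simp add: of_coords_def qplane_def lext_add pcls_simps)

lemma of_coords_cscale: "of_coords q (cscale c p) = c \<odot>\<^bsub>qplane q\<^esub> of_coords q p"
  by (simp add: of_coords_def qplane_def lext_cscale pcls_simps)

lemma of_coords_one: "of_coords q (mon 0 0) = \<one>\<^bsub>qplane q\<^esub>"
  by (simp add: of_coords_def qplane_def normal_word_def pcls_simps)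

lemma qx_qy_closed [simp]: "qx q \<in> carrier (qplane q)" "qy q \<in> carrier (qplane q)"
  by (simp_all add: qx_def qy_def qplane_def)

lemma qy_qx: "qy q \<otimes>\<^bsub>qplane q\<^esub> qx q = q \<odot>\<^bsub>qplane q\<^esub> (qx q \<otimes>\<^bsub>qplane q\<^esub> qy q)"
proof -
  have "pcls (qp_rels q) (single [Gy, Gx] 1) = pcls (qp_rels q) (cscale q (single [Gx, Gy] 1))"
    by (rule pcls_rel) (simp add: qp_rels_def)
  then show ?thesis
    by (simp add: qplane_def qx_def qy_def presented_gen_eq flip: pcls_simps)
qed

lemma word_in_qplane:
  "pcls (qp_rels q) (single (g # w) 1)
    = presented_gen (qp_rels q) g \<otimes>\<^bsub>qplane q\<^esub> pcls (qp_rels q) (single w 1)"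
  by (simp add: qplane_def presented_gen_eq flip: pcls_simps)

lemma qx_of_coords_mon: "qx q \<otimes>\<^bsub>qplane q\<^esub> of_coords q (mon m n) = of_coords q (mon (Suc m) n)"
  by (simp add: of_coords_def normal_word_def qx_def word_in_qplane)

lemma qy_of_coords_mon:
  "qy q \<otimes>\<^bsub>qplane q\<^esub> of_coords q (mon m n) = q ^ m \<odot>\<^bsub>qplane q\<^esub> of_coords q (mon m (Suc n))"
proof -
  interpret calgebra "qplane q" by (rule calgebra_qplane)
  show ?thesis
  proof (induct m)
    case 0
    show ?case
      using of_coords_closed[of q "mon 0 (Suc n)"]
      by simp (simp add: of_coords_def normal_word_def qy_def word_in_qplane)
  next
    case (Suc m)
    have "qy q \<otimes>\<^bsub>qplane q\<^esub> of_coords q (mon (Suc m) n)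
        = (qy q \<otimes>\<^bsub>qplane q\<^esub> qx q) \<otimes>\<^bsub>qplane q\<^esub> of_coords q (mon m n)"
      by (simp add: m_assoc flip: qx_of_coords_mon)
    also have "\<dots> = q \<odot>\<^bsub>qplane q\<^esub> (qx q \<otimes>\<^bsub>qplane q\<^esub> (qy q \<otimes>\<^bsub>qplane q\<^esub> of_coords q (mon m n)))"
      by (simp add: qy_qx smult_mult_left m_assoc)
    also have "\<dots> = q ^ Suc m \<odot>\<^bsub>qplane q\<^esub> of_coords q (mon (Suc m) (Suc n))"
      by (simp add: Suc smult_mult_right smult_smult qx_of_coords_mon)
    finally show ?case .
  qed
qed

lemma gen_of_coords:
  "qx q \<otimes>\<^bsub>qplane q\<^esub> of_coords q r = of_coords q (pmul q (mon 1 0) r)"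
  "qy q \<otimes>\<^bsub>qplane q\<^esub> of_coords q r = of_coords q (pmul q (mon 0 1) r)"
proof -
  interpret calgebra "qplane q" by (rule calgebra_qplane)
  show "qx q \<otimes>\<^bsub>qplane q\<^esub> of_coords q r = of_coords q (pmul q (mon 1 0) r)"
  proof (induct r rule: poly_mapping_single_add_induct)
    case (single u c)
    obtain m n where u: "u = (m, n)" by fastforce
    have "qx q \<otimes>\<^bsub>qplane q\<^esub> of_coords q (cscale c (mon m n)) = of_coords q (pmul q (mon 1 0) (cscale c (mon m n)))"
      by (simp only: of_coords_cscale pmul_linear_right smult_mult_right qx_qy_closed of_coords_closed qx_of_coords_mon)
        simp
    then show ?case
      by (simp add: u)
  next
    case (add p r)
    then show ?case
      by (simp add: of_coords_add pmul_linear_right r_distr)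
  qed
  show "qy q \<otimes>\<^bsub>qplane q\<^esub> of_coords q r = of_coords q (pmul q (mon 0 1) r)"
  proof (induct r rule: poly_mapping_single_add_induct)
    case (single u c)
    obtain m n where u: "u = (m, n)" by fastforce
    have "qy q \<otimes>\<^bsub>qplane q\<^esub> of_coords q (cscale c (mon m n)) = of_coords q (cscale c (cscale (q ^ m) (mon m (Suc n))))"
      by (simp only: of_coords_cscale smult_mult_right qx_qy_closed of_coords_closed qy_of_coords_mon)
    then show ?case
      by (simp add: u)
  next
    case (add p r)
    then show ?case
      by (simp add: of_coords_add pmul_linear_right r_distr)
  qed
qed

lemma qplane_induct [consumes 1, case_names one x y mult add smult]:
  assumes "X \<in> carrier (qplane q)" and "P \<one>\<^bsub>qplane q\<^esub>" and "P (qx q)" "P (qy q)"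
    and "\<And>X Y. X \<in> carrier (qplane q) \<Longrightarrow> Y \<in> carrier (qplane q) \<Longrightarrow> P X \<Longrightarrow> P Y \<Longrightarrow> P (X \<otimes>\<^bsub>qplane q\<^esub> Y)"
    and "\<And>X Y. X \<in> carrier (qplane q) \<Longrightarrow> Y \<in> carrier (qplane q) \<Longrightarrow> P X \<Longrightarrow> P Y \<Longrightarrow> P (X \<oplus>\<^bsub>qplane q\<^esub> Y)"
    and "\<And>c X. X \<in> carrier (qplane q) \<Longrightarrow> P X \<Longrightarrow> P (c \<odot>\<^bsub>qplane q\<^esub> X)"
  shows "P X"
proof -
  have "P (presented_gen (qp_rels q) g)" for g
    using assms(3,4) by (cases g) (simp_all add: qx_def qy_def)
  with assms show ?thesis
    unfolding qplane_def by (rule_tac presented_induct[of X "qp_rels q" P]) auto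
qed

text \<open>
  Left multiplication by the generators preserves the normal form with the expected coefficients, and
  the property passes to products. For \<open>r = 1\<close> it says that \<open>of_coords\<close> is a left inverse of
  \<open>coords\<close>, that is, the monomials \<open>x^m y^n\<close> span.
\<close>

lemma mult_of_coords:
  assumes "X \<in> carrier (qplane q)"
  shows "X \<otimes>\<^bsub>qplane q\<^esub> of_coords q r = of_coords q (pmul q (coords q X) r)"
proof -
  interpret calgebra "qplane q" by (rule calgebra_qplane)
  note closed = of_coords_closed[of q]
  have "\<forall>r. X \<otimes>\<^bsub>qplane q\<^esub> of_coords q r = of_coords q (pmul q (coords q X) r)"
    using assms
  proof (induct rule: qplane_induct)
    case one
    show ?case by (simp add: coords_simps)
  next
    case x
    show ?case by (simp add: gen_of_coords coords_gen)
  next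
    case y
    show ?case by (simp add: gen_of_coords coords_gen)
  next
    case (mult X Y)
    then show ?case by (simp add: coords_simps m_assoc pmul_assoc)
  next
    case (add X Y)
    then show ?case by (simp add: coords_simps l_distr pmul_linear_left of_coords_add)
  next
    case (smult c X)
    then show ?case by (simp add: coords_simps smult_mult_left pmul_linear_left of_coords_cscale)
  qed
  then show ?thesis by blast
qed

lemma of_coords_coords [simp]: "X \<in> carrier (qplane q) \<Longrightarrow> of_coords q (coords q X) = X"
proof -
  interpret calgebra "qplane q" by (rule calgebra_qplane)
  assume "X \<in> carrier (qplane q)"
  then show ?thesis
    using mult_of_coords[of X q "mon 0 0"] by (simp add: of_coords_one)
qed

text \<open>
  This is the linear independence of the monomials \<open>x^m y^n\<close>: their images in the model are the
  basis elements.
\<close>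

lemma coords_of_coords [simp]: "coords q (of_coords q p) = p"
proof -
  have mon: "coords q (of_coords q (mon m n)) = mon m n" for m n
  proof (induct m)
    case 0
    show ?case
    proof (induct n)
      case 0
      show ?case by (simp add: of_coords_one coords_simps)
    next
      case (Suc n)
      have "of_coords q (mon 0 (Suc n)) = qy q \<otimes>\<^bsub>qplane q\<^esub> of_coords q (mon 0 n)"
        by (simp add: of_coords_def normal_word_def qy_def word_in_qplane)
      then show ?case
        by (simp add: coords_simps coords_gen Suc)
    qed
  next
    case (Suc m)
    then show ?case
      by (simp add: coords_simps coords_gen flip: qx_of_coords_mon)
  qed
  show ?thesis
    by (rule clin_eq_on_keys[of "\<lambda>p. coords q (of_coords q p)" "\<lambda>p. p"])
      (auto simp: clin_id mon of_coords_add of_coords_cscale coords_simps intro!: clinI)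
qed

lemma of_coords_pmul: "of_coords q (pmul q p r) = of_coords q p \<otimes>\<^bsub>qplane q\<^esub> of_coords q r"
  by (simp add: mult_of_coords)

lemma of_coords_zero: "of_coords q 0 = \<zero>\<^bsub>qplane q\<^esub>"
proof -
  have "coords q \<zero>\<^bsub>qplane q\<^esub> = 0"
    using alg_hom_zero[OF coords_hom calgebra_qplane calgebra_qp_model] by simp
  then show ?thesis
    using calgebra_qplane[of q] by (metis of_coords_coords calgebra.axioms(1) ring.ring_simprules(2))
qed

lemma of_coords_gen: "of_coords q (mon 1 0) = qx q" "of_coords q (mon 0 1) = qy q"
  using of_coords_coords[of "qx q" q] of_coords_coords[of "qy q" q] by (simp_all add: coords_gen)

lemma of_coords_inject [simp]: "of_coords q p = of_coords q r \<longleftrightarrow> p = r"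
  by (metis coords_of_coords)

lemma coords_inject: "X \<in> carrier (qplane q) \<Longrightarrow> Y \<in> carrier (qplane q) \<Longrightarrow> coords q X = coords q Y \<longleftrightarrow> X = Y"
  by (metis of_coords_coords)

lemma coords_finsum:
  assumes "finite S" "\<And>i. i \<in> S \<Longrightarrow> f i \<in> carrier (qplane q)"
  shows "coords q (\<Oplus>\<^bsub>qplane q\<^esub>i\<in>S. f i) = (\<Sum>i\<in>S. coords q (f i))"
proof -
  interpret calgebra "qplane q" by (rule calgebra_qplane)
  have zero: "coords q \<zero>\<^bsub>qplane q\<^esub> = 0"
    using alg_hom_zero[OF coords_hom calgebra_qplane calgebra_qp_model] by simp
  show ?thesis
    using assms by (induct S) (auto simp: zero finsum_insert Pi_def coords_simps finsum_closed)
qed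

lemma of_coords_sum:
  assumes "finite S"
  shows "of_coords q (\<Sum>i\<in>S. f i) = (\<Oplus>\<^bsub>qplane q\<^esub>i\<in>S. of_coords q (f i))"
proof -
  interpret calgebra "qplane q" by (rule calgebra_qplane)
  have "coords q (of_coords q (\<Sum>i\<in>S. f i)) = coords q (\<Oplus>\<^bsub>qplane q\<^esub>i\<in>S. of_coords q (f i))"
    using assms by (simp add: coords_finsum)
  then show ?thesis
    by (subst (asm) coords_inject) (auto intro: finsum_closed)
qed

lemma qx_pow_qy_pow:
  "qx q [^]\<^bsub>qplane q\<^esub> (m::nat) \<otimes>\<^bsub>qplane q\<^esub> qy q [^]\<^bsub>qplane q\<^esub> (n::nat) = of_coords q (mon m n)"
proof -
  interpret calgebra "qplane q" by (rule calgebra_qplane)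
  have x: "qx q [^]\<^bsub>qplane q\<^esub> m = of_coords q (mon m 0)" for m :: nat
    by (induct m) (simp_all add: of_coords_one flip: of_coords_pmul of_coords_gen)
  have y: "qy q [^]\<^bsub>qplane q\<^esub> n = of_coords q (mon 0 n)" for n :: nat
    by (induct n) (simp_all add: of_coords_one flip: of_coords_pmul of_coords_gen)
  show ?thesis
    unfolding x y by (simp flip: of_coords_pmul)
qed

lemma qp_homog_iff:
  "of_coords q p \<in> qp_homog q i \<longleftrightarrow> keys p \<subseteq> {(m, n). m + n = i}"
proof -
  interpret calgebra "qplane q" by (rule calgebra_qplane)
  have sum: "(\<Oplus>\<^bsub>qplane q\<^esub>m\<in>{..i}. c m \<odot>\<^bsub>qplane q\<^esub> (qx q [^]\<^bsub>qplane q\<^esub> m \<otimes>\<^bsub>qplane q\<^esub> qy q [^]\<^bsub>qplane q\<^esub> (i - m)))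
      = of_coords q (\<Sum>m\<le>i. single (m, i - m) (c m))" for c
  proof -
    have "c m \<odot>\<^bsub>qplane q\<^esub> of_coords q (mon m (i - m)) = of_coords q (single (m, i - m) (c m))" for m
      by (simp flip: of_coords_cscale)
    then show ?thesis
      unfolding qx_pow_qy_pow by (subst of_coords_sum) auto
  qed
  have "of_coords q p \<in> qp_homog q i \<longleftrightarrow> (\<exists>c. p = (\<Sum>m\<le>i. single (m, i - m) (c m)))"
    unfolding qp_homog_def sum by auto
  also have "\<dots> \<longleftrightarrow> keys p \<subseteq> {(m, n). m + n = i}"
  proof
    assume "\<exists>c. p = (\<Sum>m\<le>i. single (m, i - m) (c m))"
    then obtain c where "p = (\<Sum>m\<le>i. single (m, i - m) (c m))" by blast
    then show "keys p \<subseteq> {(m, n). m + n = i}"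
      by (auto dest!: subsetD[OF keys_sum] split: if_splits)
  next
    assume p: "keys p \<subseteq> {(m, n). m + n = i}"
    have "p = (\<Sum>m\<le>i. single (m, i - m) (lookup p (m, i - m)))"
    proof (rule poly_mapping_eqI)
      fix u :: "nat \<times> nat"
      obtain a b where u: "u = (a, b)" by fastforce
      show "lookup p u
          = lookup (\<Sum>m\<le>i. single (m, i - m) (lookup p (m, i - m))) u"
      proof (cases "a + b = i")
        case True
        then have "b = i - a" "a \<le> i" by auto
        then show ?thesis
          by (simp add: u lookup_sum lookup_single when_def if_distrib cong: if_cong conj_cong)
      next
        case False
        then have "lookup p u = 0"
          using p u by (auto simp: in_keys_iff)
        moreover have "(m, i - m) \<noteq> u" if "m \<le> i" for m
          using False that u by auto
        ultimately show ?thesis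
          by (simp add: lookup_sum lookup_single when_def)
      qed
    qed
    then show "\<exists>c. p = (\<Sum>m\<le>i. single (m, i - m) (c m))"
      by (rule exI[of _ "\<lambda>m. lookup p (m, i - m)"])
  qed
  finally show ?thesis .
qed

definition hpart :: "nat \<Rightarrow> qp_poly \<Rightarrow> qp_poly" where
  "hpart i = lext (\<lambda>(m, n). if m + n = i then mon m n else 0)"

lemma lookup_hpart:
  "lookup (hpart i p) (m, n) = (if m + n = i then lookup p (m, n) else 0)"
  by (induct p rule: poly_mapping_single_add_induct)
    (auto simp: hpart_def lext_add lookup_add lookup_single when_def split: if_splits)

text \<open>
  The homogeneous components exist and are unique because the basis monomials are homogeneous.
\<close>

lemma qp_proj_of_coords: "qp_proj q i (of_coords q p) = of_coords q (hpart i p)"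
proof -
  interpret calgebra "qplane q" by (rule calgebra_qplane)
  show ?thesis
    unfolding qp_proj_def
  proof (rule the_equality)
    let ?u = "\<lambda>j. of_coords q (hpart j p)"
    let ?S = "{j. ?u j \<noteq> \<zero>\<^bsub>qplane q\<^esub>}"
    have nz: "?u j \<noteq> \<zero>\<^bsub>qplane q\<^esub> \<longleftrightarrow> hpart j p \<noteq> 0" for j
      by (simp flip: of_coords_zero)
    have "?S \<subseteq> (\<lambda>(m, n). m + n) ` keys p"
    proof
      fix j
      assume "j \<in> ?S"
      then have "hpart j p \<noteq> 0" using nz by simp
      then obtain u where "lookup (hpart j p) u \<noteq> 0"
        by (metis lookup_zero poly_mapping_eqI)
      then show "j \<in> (\<lambda>(m, n). m + n) ` keys p"
        by (cases u) (force simp: lookup_hpart in_keys_iff split: if_splits)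
    qed
    then have fin: "finite ?S"
      by (rule finite_subset) simp
    have "p = (\<Sum>j\<in>?S. hpart j p)"
    proof (rule poly_mapping_eqI)
      fix u :: "nat \<times> nat"
      obtain a b where u: "u = (a, b)" by fastforce
      have "lookup p (a, b) = 0" if "a + b \<notin> ?S"
      proof -
        have "hpart (a + b) p = 0" using that nz by simp
        then show ?thesis using lookup_hpart[of "a + b" p a b] by simp
      qed
      then show "lookup p u = lookup (\<Sum>j\<in>?S. hpart j p) u"
        using fin by (simp add: u lookup_sum lookup_hpart)
    qed
    then have "of_coords q p = of_coords q (\<Sum>j\<in>?S. hpart j p)"
      by (rule arg_cong)
    also have "\<dots> = (\<Oplus>\<^bsub>qplane q\<^esub>j\<in>?S. ?u j)"
      by (rule of_coords_sum[OF fin])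
    finally have "of_coords q p = (\<Oplus>\<^bsub>qplane q\<^esub>j\<in>?S. ?u j)" .
    moreover have "?u j \<in> qp_homog q j" for j
      by (auto simp: qp_homog_iff in_keys_iff lookup_hpart split: if_splits)
    ultimately show "\<exists>u. (\<forall>j. u j \<in> qp_homog q j) \<and> finite {j. u j \<noteq> \<zero>\<^bsub>qplane q\<^esub>} \<and>
        of_coords q p = (\<Oplus>\<^bsub>qplane q\<^esub>j\<in>{j. u j \<noteq> \<zero>\<^bsub>qplane q\<^esub>}. u j) \<and> of_coords q (hpart i p) = u i"
      using fin by (intro exI[of _ ?u]) simp
  next
    fix r
    assume "\<exists>u. (\<forall>j. u j \<in> qp_homog q j) \<and> finite {j. u j \<noteq> \<zero>\<^bsub>qplane q\<^esub>} \<and>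
        of_coords q p = (\<Oplus>\<^bsub>qplane q\<^esub>j\<in>{j. u j \<noteq> \<zero>\<^bsub>qplane q\<^esub>}. u j) \<and> r = u i"
    then obtain u where u: "\<And>j. u j \<in> qp_homog q j" and fin: "finite {j. u j \<noteq> \<zero>\<^bsub>qplane q\<^esub>}"
      and p: "of_coords q p = (\<Oplus>\<^bsub>qplane q\<^esub>j\<in>{j. u j \<noteq> \<zero>\<^bsub>qplane q\<^esub>}. u j)" and r: "r = u i"
      by blast
    have closed: "u j \<in> carrier (qplane q)" for j
      using u[of j] by (auto simp: qp_homog_def intro!: finsum_closed)
    define v where "v j = coords q (u j)" for j
    have uv: "u j = of_coords q (v j)" for j
      using closed by (simp add: v_def)
    have vj: "keys (v j) \<subseteq> {(m, n). m + n = j}" for j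
      using u[of j] unfolding uv qp_homog_iff .
    let ?S = "{j. u j \<noteq> \<zero>\<^bsub>qplane q\<^esub>}"
    have "p = (\<Sum>j\<in>?S. v j)"
      using arg_cong[OF p, of "coords q"] closed fin by (simp add: coords_finsum v_def)
    then have look: "lookup p w = (\<Sum>j\<in>?S. lookup (v j) w)" for w
      by (simp add: lookup_sum)
    have "v i = hpart i p"
    proof (rule poly_mapping_eqI)
      fix w :: "nat \<times> nat"
      obtain a b where w: "w = (a, b)" by fastforce
      have other: "lookup (v j) (a, b) = (if j = a + b then lookup (v (a + b)) (a, b) else 0)" for j
      proof (cases "j = a + b")
        case False
        then have "(a, b) \<notin> keys (v j)"
          using subsetD[OF vj, of "(a, b)" j] by auto
        with False show ?thesis
          by (simp add: in_keys_iff)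
      qed simp
      have zero: "v j = 0" if "j \<notin> ?S" for j
      proof -
        have "of_coords q (v j) = of_coords q 0"
          using that unfolding uv[symmetric] of_coords_zero by simp
        then show ?thesis by (rule of_coords_inject[THEN iffD1])
      qed
      have "lookup p (a, b) = lookup (v (a + b)) (a, b)"
      proof -
        have "lookup p (a, b)
            = (\<Sum>j\<in>?S. if j = a + b then lookup (v (a + b)) (a, b) else 0)"
          unfolding look by (rule sum.cong[OF refl other])
        also have "\<dots> = (if a + b \<in> ?S then lookup (v (a + b)) (a, b) else 0)"
          by (rule sum.delta[OF fin])
        also have "\<dots> = lookup (v (a + b)) (a, b)"
          using zero[of "a + b"] by (cases "a + b \<in> ?S") simp_all
        finally show ?thesis .
      qed
      then show "lookup (v i) w = lookup (hpart i p) w"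
      proof (cases "a + b = i")
        case False
        then show ?thesis
          using trans[OF other[of i] if_not_P] by (simp add: w lookup_hpart)
      qed (simp add: w lookup_hpart)
    qed
    then show "r = of_coords q (hpart i p)"
      unfolding r uv by simp
  qed
qed

lemma qp_proj_eq_zero_iff:
  assumes "X \<in> carrier (qplane q)"
  shows "qp_proj q i X = \<zero>\<^bsub>qplane q\<^esub> \<longleftrightarrow> (\<forall>m n. m + n = i \<longrightarrow> lookup (coords q X) (m, n) = 0)"
proof -
  have "qp_proj q i X = \<zero>\<^bsub>qplane q\<^esub> \<longleftrightarrow> hpart i (coords q X) = 0"
    using qp_proj_of_coords[of q i "coords q X"] assms by (simp flip: of_coords_zero)
  also have "\<dots> \<longleftrightarrow> (\<forall>m n. m + n = i \<longrightarrow> lookup (coords q X) (m, n) = 0)"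
    by (auto simp: poly_mapping_eq_iff fun_eq_iff lookup_hpart)
  finally show ?thesis .
qed

section \<open>Structures as quadruples of operators\<close>

text \<open>
  A module algebra structure in coordinates: the lemmas \<open>qp_structures_action\<close> and
  \<open>action_structure\<close> below pass from structures to such quadruples and back.
\<close>

locale quantum_plane_action =
  fixes q :: complex and k k' e f :: "qp_poly \<Rightarrow> qp_poly"
  assumes lin: "clin k" "clin k'" "clin e" "clin f"
    and k_inv: "k' (k p) = p" "k (k' p) = p"
    and ke: "k (e p) = cscale (q\<^sup>2) (e (k p))"
    and kf: "k (f p) = cscale (inverse (q\<^sup>2)) (f (k p))"
    and ef: "e (f p) + cscale (1 / (q - inverse q)) (k' p) = f (e p) + cscale (1 / (q - inverse q)) (k p)"
    and k_pmul: "k (pmul q a b) = pmul q (k a) (k b)"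
    and k'_pmul: "k' (pmul q a b) = pmul q (k' a) (k' b)"
    and e_pmul: "e (pmul q a b) = pmul q a (e b) + pmul q (e a) (k b)"
    and f_pmul: "f (pmul q a b) = pmul q (f a) b + pmul q (k' a) (f b)"
    and on_one: "k (mon 0 0) = mon 0 0" "k' (mon 0 0) = mon 0 0" "e (mon 0 0) = 0" "f (mon 0 0) = 0"

definition op_of :: "complex \<Rightarrow> qp_action \<Rightarrow> (uq_gen list \<Rightarrow>\<^sub>0 complex) set
    \<Rightarrow> qp_poly \<Rightarrow> qp_poly" where
  "op_of q \<pi> h p = coords q (\<pi> h (of_coords q p))"

locale uq_rep =
  fixes q :: complex and \<pi> :: qp_action
  assumes hom: "\<pi> \<in> alg_hom (uq q) (End_alg (qplane q))"
begin

sublocale A: calgebra "qplane q"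
  by (rule calgebra_qplane)

lemma End_closed: "h \<in> carrier (uq q) \<Longrightarrow> \<pi> h \<in> carrier (End_alg (qplane q))"
  by (rule alg_homD(1)[OF hom])

lemma rep_closed: "h \<in> carrier (uq q) \<Longrightarrow> X \<in> carrier (qplane q) \<Longrightarrow> \<pi> h X \<in> carrier (qplane q)"
  by (rule A.End_alg_closed[OF End_closed])

lemma rep_eq_op: "h \<in> carrier (uq q) \<Longrightarrow> X \<in> carrier (qplane q) \<Longrightarrow> \<pi> h X = of_coords q (op_of q \<pi> h (coords q X))"
  by (simp add: op_of_def rep_closed)

lemma clin_op: "h \<in> carrier (uq q) \<Longrightarrow> clin (op_of q \<pi> h)"
  by (rule clinI)
    (simp_all add: op_of_def of_coords_add of_coords_cscale A.End_alg_linear[OF End_closed] coords_simps rep_closed)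

lemma op_mult:
  assumes "g \<in> carrier (uq q)" "h \<in> carrier (uq q)"
  shows "op_of q \<pi> (g \<otimes>\<^bsub>uq q\<^esub> h) p = op_of q \<pi> g (op_of q \<pi> h p)"
  using assms by (simp add: op_of_def alg_homD(2)[OF hom] A.End_alg_apply rep_closed)

lemma op_add:
  assumes "g \<in> carrier (uq q)" "h \<in> carrier (uq q)"
  shows "op_of q \<pi> (g \<oplus>\<^bsub>uq q\<^esub> h) p = op_of q \<pi> g p + op_of q \<pi> h p"
  using assms by (simp add: op_of_def alg_homD(3)[OF hom] A.End_alg_apply rep_closed coords_simps)

lemma op_smult:
  assumes "h \<in> carrier (uq q)"
  shows "op_of q \<pi> (c \<odot>\<^bsub>uq q\<^esub> h) p = cscale c (op_of q \<pi> h p)"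
  using assms by (simp add: op_of_def alg_homD(5)[OF hom] A.End_alg_apply rep_closed coords_simps)

lemma op_one: "op_of q \<pi> \<one>\<^bsub>uq q\<^esub> p = p"
  by (simp add: op_of_def alg_homD(4)[OF hom] A.End_alg_apply)

end

lemma uq_rep_eqI:
  assumes "uq_rep q \<pi>" "uq_rep q \<rho>"
    and ext: "\<pi> \<in> extensional (carrier (uq q))" "\<rho> \<in> extensional (carrier (uq q))"
    and eq: "op_of q \<pi> (uk q) = op_of q \<rho> (uk q)" "op_of q \<pi> (ukinv q) = op_of q \<rho> (ukinv q)"
      "op_of q \<pi> (ue q) = op_of q \<rho> (ue q)" "op_of q \<pi> (uf q) = op_of q \<rho> (uf q)"
  shows "\<pi> = \<rho>"
proof -
  interpret \<pi>: uq_rep q \<pi> by fact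
  interpret \<rho>: uq_rep q \<rho> by fact
  have "op_of q \<pi> h = op_of q \<rho> h" if "h \<in> carrier (uq q)" for h
    using that
    by (induct rule: uq_induct)
      (auto simp: eq fun_eq_iff \<pi>.op_mult \<rho>.op_mult \<pi>.op_add \<rho>.op_add \<pi>.op_smult \<rho>.op_smult \<pi>.op_one \<rho>.op_one)
  then have "\<pi> h = \<rho> h" if "h \<in> carrier (uq q)" for h
    using that
    by (intro \<pi>.A.End_alg_eqI[OF \<pi>.End_closed \<rho>.End_closed]) (simp_all add: \<pi>.rep_eq_op \<rho>.rep_eq_op)
  then show ?thesis
    by (rule extensionalityI[OF ext])
qed

lemma qp_structures_uq_rep: "\<pi> \<in> qp_structures q \<Longrightarrow> uq_rep q \<pi>"
  by (simp add: qp_structures_def module_algebra_structures_def uq_rep_def)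

text \<open>
  The defining product rule of a module algebra, read in coordinates.
\<close>

lemma qp_structures_op_pmul:
  assumes \<pi>: "\<pi> \<in> qp_structures q" and h: "h \<in> carrier (uq q)"
    and uv: "\<And>i. i < n \<Longrightarrow> u i \<in> carrier (uq q) \<and> v i \<in> carrier (uq q)"
    and D: "uq_comult q h = (\<Oplus>\<^bsub>tensor_alg (uq q) (uq q)\<^esub> i \<in> {..<n::nat}. pure_tensor (uq q) (uq q) (u i) (v i))"
  shows "op_of q \<pi> h (pmul q a b) = (\<Sum>i<n. pmul q (op_of q \<pi> (u i) a) (op_of q \<pi> (v i) b))"
proof -
  interpret uq_rep q \<pi> using \<pi> by (rule qp_structures_uq_rep)
  have *: "\<forall>h \<in> carrier (uq q). \<forall>(n::nat) u v. (\<forall>i<n. u i \<in> carrier (uq q) \<and> v i \<in> carrier (uq q)) \<and>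
        uq_comult q h = (\<Oplus>\<^bsub>tensor_alg (uq q) (uq q)\<^esub> i \<in> {..<n}. pure_tensor (uq q) (uq q) (u i) (v i)) \<longrightarrow>
        (\<forall>a \<in> carrier (qplane q). \<forall>b \<in> carrier (qplane q).
          \<pi> h (a \<otimes>\<^bsub>qplane q\<^esub> b) = (\<Oplus>\<^bsub>qplane q\<^esub> i \<in> {..<n}. \<pi> (u i) a \<otimes>\<^bsub>qplane q\<^esub> \<pi> (v i) b))"
    using \<pi> by (simp only: qp_structures_def module_algebra_structures_def mem_Collect_eq) (elim conjE)
  have "\<pi> h (of_coords q a \<otimes>\<^bsub>qplane q\<^esub> of_coords q b)
      = (\<Oplus>\<^bsub>qplane q\<^esub> i \<in> {..<n}. \<pi> (u i) (of_coords q a) \<otimes>\<^bsub>qplane q\<^esub> \<pi> (v i) (of_coords q b))"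
    using *[THEN bspec, OF h, THEN spec[of _ n], THEN spec[of _ u], THEN spec[of _ v], THEN mp,
        THEN bspec, OF _ of_coords_closed[of q a], THEN bspec, OF _ of_coords_closed[of q b]] uv D
    by blast
  then have "op_of q \<pi> h (pmul q a b)
      = coords q (\<Oplus>\<^bsub>qplane q\<^esub> i \<in> {..<n}. \<pi> (u i) (of_coords q a) \<otimes>\<^bsub>qplane q\<^esub> \<pi> (v i) (of_coords q b))"
    by (simp add: op_of_def of_coords_pmul)
  also have "\<dots> = (\<Sum>i<n. pmul q (op_of q \<pi> (u i) a) (op_of q \<pi> (v i) b))"
    using uv by (subst coords_finsum) (auto simp: coords_simps rep_closed op_of_def)
  finally show ?thesis .
qed

lemma qp_structures_action:
  assumes \<pi>: "\<pi> \<in> qp_structures q" and q: "q \<noteq> 0"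
  shows "quantum_plane_action q (op_of q \<pi> (uk q)) (op_of q \<pi> (ukinv q)) (op_of q \<pi> (ue q)) (op_of q \<pi> (uf q))"
proof -
  interpret uq_rep q \<pi> using \<pi> by (rule qp_structures_uq_rep)
  interpret H: calgebra "uq q" by (rule calgebra_uq)
  interpret two_calgebras "uq q" "uq q" ..
  interpret T: calgebra T by (rule calgebra_tensor)
  let ?o = "op_of q \<pi>"
  note rel = uq_relationsD[OF uq_relations_uq[of q]]
  note app = op_mult op_add op_smult op_one
  have rel_op: "?o g p = ?o h p" if "g = h" for g h p
    using that by simp
  \<comment> \<open>The comultiplication is one pure tensor for \<open>k\<close> and its inverse, and two for \<open>e\<close> and \<open>f\<close>.\<close>
  have group_like: "?o h (pmul q a b) = pmul q (?o h a) (?o h b)"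
    if "h \<in> carrier (uq q)" "uq_comult q h = t h h" for h a b
    using qp_structures_op_pmul[OF \<pi> that(1), of 1 "\<lambda>_. h" "\<lambda>_. h"] that
    by (simp add: lessThan_Suc)
  have skew: "?o h (pmul q a b) = pmul q (?o u a) (?o v b) + pmul q (?o u' a) (?o v' b)"
    if h: "h \<in> carrier (uq q)" "uq_comult q h = t u v \<oplus>\<^bsub>T\<^esub> t u' v'"
      and uv: "u \<in> carrier (uq q)" "v \<in> carrier (uq q)" "u' \<in> carrier (uq q)" "v' \<in> carrier (uq q)" for h u v u' v' a b
    using qp_structures_op_pmul[OF \<pi> h(1), of 2 "\<lambda>i. if i = 0 then u else u'" "\<lambda>i. if i = 0 then v else v'"] h(2) uv
    by (simp add: lessThan_Suc numeral_2_eq_2 T.a_comm add.commute)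
  have unit: "?o h (mon 0 0) = cscale (uq_counit q h) (mon 0 0)" if "h \<in> carrier (uq q)" for h
    using \<pi> that by (simp add: qp_structures_def module_algebra_structures_def op_of_def
        of_coords_one coords_simps del: cscale_single)
  note D = uq_comult[OF q] and C = uq_counit[of q]
  show ?thesis
  proof
    show "clin (?o (uk q))" "clin (?o (ukinv q))" "clin (?o (ue q))" "clin (?o (uf q))"
      by (simp_all add: clin_op)
    fix p a b
    show "?o (ukinv q) (?o (uk q) p) = p" "?o (uk q) (?o (ukinv q) p) = p"
      using rel_op[OF rel(5)] rel_op[OF rel(6)] by (simp_all add: app)
    show "?o (uk q) (?o (ue q) p) = cscale (q\<^sup>2) (?o (ue q) (?o (uk q) p))"
      using rel_op[OF rel(7)] by (simp add: app)
    show "?o (uk q) (?o (uf q) p) = cscale (inverse (q\<^sup>2)) (?o (uf q) (?o (uk q) p))"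
      using rel_op[OF rel(8)] by (simp add: app)
    show "?o (ue q) (?o (uf q) p) + cscale (1 / (q - inverse q)) (?o (ukinv q) p)
        = ?o (uf q) (?o (ue q) p) + cscale (1 / (q - inverse q)) (?o (uk q) p)"
      using rel_op[OF rel(9)] by (simp add: app)
    show "?o (uk q) (pmul q a b) = pmul q (?o (uk q) a) (?o (uk q) b)"
      "?o (ukinv q) (pmul q a b) = pmul q (?o (ukinv q) a) (?o (ukinv q) b)"
      by (rule group_like; simp add: D)+
    show "?o (ue q) (pmul q a b) = pmul q a (?o (ue q) b) + pmul q (?o (ue q) a) (?o (uk q) b)"
      using skew[of "ue q", OF _ D(4)] by (simp add: op_one)
    show "?o (uf q) (pmul q a b) = pmul q (?o (uf q) a) b + pmul q (?o (ukinv q) a) (?o (uf q) b)"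
      using skew[of "uf q", OF _ D(5)] by (simp add: op_one)
    show "?o (uk q) (mon 0 0) = mon 0 0" "?o (ukinv q) (mon 0 0) = mon 0 0"
      "?o (ue q) (mon 0 0) = 0" "?o (uf q) (mon 0 0) = 0"
      by (simp_all add: unit C)
  qed
qed

definition End_of :: "complex \<Rightarrow> (qp_poly \<Rightarrow> qp_poly)
    \<Rightarrow> (qp_gen list \<Rightarrow>\<^sub>0 complex) set \<Rightarrow> (qp_gen list \<Rightarrow>\<^sub>0 complex) set" where
  "End_of q T = (\<lambda>X\<in>carrier (qplane q). of_coords q (T (coords q X)))"

lemma End_of_closed:
  assumes "clin T"
  shows "End_of q T \<in> carrier (End_alg (qplane q))"
proof -
  interpret calgebra "qplane q" by (rule calgebra_qplane)
  show ?thesis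
    by (rule End_algI)
      (auto simp: End_of_def coords_simps clinD[OF assms] of_coords_add of_coords_cscale)
qed

context quantum_plane_action
begin

lemma End_relations: "uq_relations (End_alg (qplane q)) q (End_of q k) (End_of q k') (End_of q e) (End_of q f)"
proof -
  interpret A: calgebra "qplane q" by (rule calgebra_qplane)
  interpret E: calgebra "End_alg (qplane q)" by (rule A.calgebra_End)
  have closed: "End_of q k \<in> carrier (End_alg (qplane q))" "End_of q k' \<in> carrier (End_alg (qplane q))"
    "End_of q e \<in> carrier (End_alg (qplane q))" "End_of q f \<in> carrier (End_alg (qplane q))"
    by (rule End_of_closed[OF lin(1)] End_of_closed[OF lin(2)] End_of_closed[OF lin(3)] End_of_closed[OF lin(4)])+
  have app: "End_of q T X = of_coords q (T (coords q X))" if "X \<in> carrier (qplane q)" for T X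
    using that by (simp add: End_of_def)
  show ?thesis
    unfolding uq_relations_def
    by (intro conjI closed A.End_alg_eqI E.m_closed E.a_closed E.smult_closed E.one_closed)
      (simp_all add: A.End_alg_apply app k_inv ke kf ef flip: of_coords_cscale of_coords_add)
qed

definition action :: qp_action where
  "action = presented_hom (uq_rels q) (End_alg (qplane q))
     (case_uq_gen (End_of q k) (End_of q k') (End_of q e) (End_of q f))"

lemma action_hom: "action \<in> alg_hom (uq q) (End_alg (qplane q))"
  and action_ext: "action \<in> extensional (carrier (uq q))"
  and action_gen: "op_of q action (uk q) = k" "op_of q action (ukinv q) = k'"
    "op_of q action (ue q) = e" "op_of q action (uf q) = f"
proof -
  interpret A: calgebra "qplane q" by (rule calgebra_qplane)
  note hom = calgebra.uq_hom[OF A.calgebra_End End_relations, folded action_def]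
  show "action \<in> alg_hom (uq q) (End_alg (qplane q))" "action \<in> extensional (carrier (uq q))"
    by (rule hom)+
  have op: "coords q (End_of q T (of_coords q p)) = T p" for T p
    by (simp add: End_of_def)
  show "op_of q action (uk q) = k" "op_of q action (ukinv q) = k'"
    "op_of q action (ue q) = e" "op_of q action (uf q) = f"
    by (simp_all add: fun_eq_iff op_of_def hom(3-6) op)
qed

sublocale rep: uq_rep q action
  by unfold_locales (rule action_hom)

lemma bilinear_op:
  "bilinear_on (uq q) (uq q) (\<lambda>u v. pmul q (op_of q action u a) (op_of q action v b))"
  by (simp add: bilinear_on_def rep.op_add rep.op_smult pmul_linear_left pmul_linear_right)

text \<open>
  For some way of writing the comultiplication of \<open>h\<close> as a combination of pairs, \<open>h\<close> satisfies the
  product rule. The set of all such \<open>h\<close> contains the generators by the product rules for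
  \<open>k, k', e, f\<close>, and it is closed under products: if \<open>X\<close> and \<open>Y\<close> obey the rule with \<open>p\<close> and \<open>r\<close>, then
  applying \<open>X\<close> to the expansion of \<open>Y(ab)\<close> yields the rule for \<open>X Y\<close> with the product of \<open>p\<close> and
  \<open>r\<close>.
\<close>

lemma action_leibniz:
  assumes q: "q \<noteq> 0" and h: "h \<in> carrier (uq q)"
  shows "\<exists>p \<in> carrier (monoid_alg (uq q \<times>\<times> uq q)). uq_comult q h = tcls (uq q) (uq q) p \<and>
    (\<forall>a b. op_of q action h (pmul q a b)
      = lext (\<lambda>(u, v). pmul q (op_of q action u a) (op_of q action v b)) p)"
  (is "?P h")
proof -
  interpret H: calgebra "uq q" by (rule calgebra_uq)
  interpret two_calgebras "uq q" "uq q" ..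
  let ?o = "op_of q action"
  let ?\<beta> = "\<lambda>a b (u, v). pmul q (?o u a) (?o v b)"
  note D = uq_comult[OF q]
  have sum2: "tcls (uq q) (uq q) p \<oplus>\<^bsub>T\<^esub> tcls (uq q) (uq q) r = tcls (uq q) (uq q) (p + r)"
    if "p \<in> carrier F" "r \<in> carrier F" for p r
    using alg_homD(3)[OF tcls_hom that] by (simp add: monoid_alg_simps)
  have Fadd: "p + r \<in> carrier F" if "p \<in> carrier F" "r \<in> carrier F" for p r
    using F.a_closed[OF that] by (simp add: monoid_alg_simps)
  note act = action_gen rep.op_one
  show ?thesis
    using h
  proof (induct rule: uq_induct)
    case one
    show ?case
      by (rule bexI[of _ "single (\<one>\<^bsub>uq q\<^esub>, \<one>\<^bsub>uq q\<^esub>) 1"])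
        (simp_all add: alg_homD(4)[OF D(1)] act flip: pure_tensor_eq pure_tensor_one)
  next
    case k
    show ?case
      by (rule bexI[of _ "single (uk q, uk q) 1"])
        (simp_all add: D act k_pmul flip: pure_tensor_eq)
  next
    case kinv
    show ?case
      by (rule bexI[of _ "single (ukinv q, ukinv q) 1"])
        (simp_all add: D act k'_pmul flip: pure_tensor_eq)
  next
    case e
    show ?case
      by (rule bexI[of _ "single (\<one>\<^bsub>uq q\<^esub>, ue q) 1 + single (ue q, uk q) 1"])
        (simp_all add: D act e_pmul lext_add Fadd pure_tensor_eq sum2)
  next
    case f
    show ?case
      by (rule bexI[of _ "single (uf q, \<one>\<^bsub>uq q\<^esub>) 1 + single (ukinv q, uf q) 1"])
        (simp_all add: D act f_pmul lext_add Fadd pure_tensor_eq sum2)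
  next
    case (mult X Y)
    obtain p where p: "p \<in> carrier F" "uq_comult q X = tcls (uq q) (uq q) p"
      and pX: "\<And>a b. ?o X (pmul q a b) = lext (?\<beta> a b) p"
      using mult(3) by blast
    obtain r where r: "r \<in> carrier F" "uq_comult q Y = tcls (uq q) (uq q) r"
      and rY: "\<And>a b. ?o Y (pmul q a b) = lext (?\<beta> a b) r"
      using mult(4) by blast
    have "?o (X \<otimes>\<^bsub>uq q\<^esub> Y) (pmul q a b) = lext (?\<beta> a b) (p \<otimes>\<^bsub>F\<^esub> r)" for a b
    proof -
      have "?o (X \<otimes>\<^bsub>uq q\<^esub> Y) (pmul q a b) = ?o X (lext (?\<beta> a b) r)"
        using mult(1,2) by (simp add: rep.op_mult rY)
      also have "\<dots> = lext (\<lambda>w. ?o X (?\<beta> a b w)) r"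
        by (rule clin_lext_swap[OF rep.clin_op[OF mult(1)]])
      also have "\<dots> = lext (\<lambda>w. lext (\<lambda>z. ?\<beta> a b (z \<otimes>\<^bsub>uq q \<times>\<times> uq q\<^esub> w)) p) r"
      proof (rule lext_cong)
        fix w
        assume "w \<in> keys r"
        then obtain u v where w: "w = (u, v)" "u \<in> carrier (uq q)" "v \<in> carrier (uq q)"
          using r(1) by (auto simp: F_carrier)
        have "?o X (?\<beta> a b w) = lext (?\<beta> (?o u a) (?o v b)) p"
          by (simp add: w pX)
        also have "\<dots> = lext (\<lambda>z. ?\<beta> a b (z \<otimes>\<^bsub>uq q \<times>\<times> uq q\<^esub> w)) p"
        proof (rule lext_cong)
          fix z
          assume "z \<in> keys p"
          then obtain u' v' where z: "z = (u', v')" "u' \<in> carrier (uq q)" "v' \<in> carrier (uq q)"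
            using p(1) by (auto simp: F_carrier)
          show "?\<beta> (?o u a) (?o v b) z = ?\<beta> a b (z \<otimes>\<^bsub>uq q \<times>\<times> uq q\<^esub> w)"
            using w z by (simp add: rep.op_mult)
        qed
        finally show "?o X (?\<beta> a b w) = lext (\<lambda>z. ?\<beta> a b (z \<otimes>\<^bsub>uq q \<times>\<times> uq q\<^esub> w)) p" .
      qed
      also have "\<dots> = lext (?\<beta> a b) (p \<otimes>\<^bsub>F\<^esub> r)"
        by (simp add: monoid_alg_simps lext_bext) (simp add: bext_def, rule lext_swap)
      finally show ?thesis .
    qed
    moreover have "uq_comult q (X \<otimes>\<^bsub>uq q\<^esub> Y) = tcls (uq q) (uq q) (p \<otimes>\<^bsub>F\<^esub> r)"
      using mult(1,2) p r by (simp add: alg_homD(2)[OF D(1)] alg_homD(2)[OF tcls_hom])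
    ultimately show ?case
      using F.m_closed[OF p(1) r(1)] by blast
  next
    case (add X Y)
    obtain p where p: "p \<in> carrier F" "uq_comult q X = tcls (uq q) (uq q) p"
      and pX: "\<And>a b. ?o X (pmul q a b) = lext (?\<beta> a b) p"
      using add(3) by blast
    obtain r where r: "r \<in> carrier F" "uq_comult q Y = tcls (uq q) (uq q) r"
      and rY: "\<And>a b. ?o Y (pmul q a b) = lext (?\<beta> a b) r"
      using add(4) by blast
    show ?case
      by (rule bexI[OF _ Fadd[OF p(1) r(1)]])
        (simp add: alg_homD(3)[OF D(1)] add(1,2) p r sum2 rep.op_add pX rY lext_add)
  next
    case (smult c X)
    obtain p where p: "p \<in> carrier F" "uq_comult q X = tcls (uq q) (uq q) p"
      and pX: "\<And>a b. ?o X (pmul q a b) = lext (?\<beta> a b) p"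
      using smult(2) by blast
    have "uq_comult q (c \<odot>\<^bsub>uq q\<^esub> X) = tcls (uq q) (uq q) (c \<odot>\<^bsub>F\<^esub> p)"
      by (simp add: alg_homD(5)[OF D(1)] alg_homD(5)[OF tcls_hom] smult(1) p)
    moreover have "?o (c \<odot>\<^bsub>uq q\<^esub> X) (pmul q a b) = lext (?\<beta> a b) (c \<odot>\<^bsub>F\<^esub> p)" for a b
      by (simp add: rep.op_smult smult(1) pX monoid_alg_simps lext_cscale)
    ultimately show ?case
      using F.smult_closed[OF p(1), of c] by blast
  qed
qed

lemma action_unit:
  assumes "h \<in> carrier (uq q)"
  shows "op_of q action h (mon 0 0) = cscale (uq_counit q h) (mon 0 0)"
  using assms
proof (induct rule: uq_induct)
  case one
  show ?case
    using alg_homD(4)[OF uq_counit(1), of q] by (simp add: rep.op_one complex_alg_def)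
next
  case (mult X Y)
  then show ?case
    using alg_homD(2)[OF uq_counit(1) mult(1,2)]
    by (simp add: rep.op_mult clinD(2)[OF rep.clin_op] complex_alg_def mult.commute del: cscale_single)
next
  case (add X Y)
  then show ?case
    using alg_homD(3)[OF uq_counit(1) add(1,2)]
    by (simp add: rep.op_add complex_alg_def cscale_add_left del: cscale_single)
next
  case (smult c X)
  then show ?case
    using alg_homD(5)[OF uq_counit(1) smult(1), of c]
    by (simp add: rep.op_smult complex_alg_def del: cscale_single)
qed (simp_all add: action_gen on_one uq_counit)

text \<open>
  By \<open>bilinear_factors\<close> the product rule, which \<open>action_leibniz\<close> provides for one expansion of the
  comultiplication, holds for every expansion.
\<close>

lemma action_structure:
  assumes q: "q \<noteq> 0"
  shows "action \<in> qp_structures q"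
proof -
  interpret H: calgebra "uq q" by (rule calgebra_uq)
  interpret two_calgebras "uq q" "uq q" ..
  let ?o = "op_of q action"
  have leibniz: "action h (X \<otimes>\<^bsub>qplane q\<^esub> Y) = (\<Oplus>\<^bsub>qplane q\<^esub> i \<in> {..<n}. action (u i) X \<otimes>\<^bsub>qplane q\<^esub> action (v i) Y)"
    if h: "h \<in> carrier (uq q)" and uv: "\<forall>i<n. u i \<in> carrier (uq q) \<and> v i \<in> carrier (uq q)"
      and D: "uq_comult q h = (\<Oplus>\<^bsub>T\<^esub> i \<in> {..<n}. t (u i) (v i))"
      and XY: "X \<in> carrier (qplane q)" "Y \<in> carrier (qplane q)" for h and n :: nat and u v X Y
  proof -
    let ?\<beta> = "\<lambda>u v. pmul q (?o u (coords q X)) (?o v (coords q Y))"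
    let ?r = "\<Sum>i<n. single (u i, v i) (1::complex)"
    obtain p where p: "p \<in> carrier F" "uq_comult q h = tcls (uq q) (uq q) p"
      and ph: "?o h (pmul q (coords q X) (coords q Y)) = lext (case_prod ?\<beta>) p"
      using action_leibniz[OF q h] by blast
    have uv': "u i \<in> carrier (uq q) \<and> v i \<in> carrier (uq q)" if "i \<in> {..<n}" for i
      using uv that by simp
    note r = finsum_pure_tensor[of "{..<n}" u v, OF _ uv']
    have "?o h (pmul q (coords q X) (coords q Y)) = lext (case_prod ?\<beta>) ?r"
      unfolding ph using p(2) D r by (intro bilinear_factors bilinear_op p(1)) auto
    also have "\<dots> = (\<Sum>i<n. ?\<beta> (u i) (v i))"
      by (simp add: lext_sum)
    finally have "?o h (pmul q (coords q X) (coords q Y)) = (\<Sum>i<n. ?\<beta> (u i) (v i))" .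
    then have "action h (X \<otimes>\<^bsub>qplane q\<^esub> Y) = of_coords q (\<Sum>i<n. ?\<beta> (u i) (v i))"
      using h XY by (simp add: rep.rep_eq_op coords_simps)
    also have "\<dots> = (\<Oplus>\<^bsub>qplane q\<^esub> i \<in> {..<n}. of_coords q (?\<beta> (u i) (v i)))"
      by (rule of_coords_sum) simp
    also have "\<dots> = (\<Oplus>\<^bsub>qplane q\<^esub> i \<in> {..<n}. action (u i) X \<otimes>\<^bsub>qplane q\<^esub> action (v i) Y)"
      by (rule rep.A.finsum_cong')
        (use uv XY in \<open>auto simp: rep.rep_closed of_coords_pmul rep.rep_eq_op[symmetric]\<close>)
    finally show ?thesis .
  qed
  have unit: "action h \<one>\<^bsub>qplane q\<^esub> = uq_counit q h \<odot>\<^bsub>qplane q\<^esub> \<one>\<^bsub>qplane q\<^esub>" if "h \<in> carrier (uq q)" for h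
    using action_unit[OF that] that
    by (simp add: rep.rep_eq_op coords_simps of_coords_cscale of_coords_one del: cscale_single)
  show ?thesis
    unfolding qp_structures_def module_algebra_structures_def
    using action_hom action_ext leibniz unit by blast
qed

end

section \<open>Leading monomials\<close>

lemma lookup_lext: "lookup (lext f p) w
    = (\<Sum>u\<in>keys p. lookup p u * lookup (f u) w)"
  by (simp add: lext_def lookup_sum)

lemma lookup_pmul:
  "lookup (pmul q p r) (m, n) = (\<Sum>u\<in>keys p. \<Sum>v\<in>keys r.
    if fst u + fst v = m \<and> snd u + snd v = n
    then lookup p u * lookup r v * q ^ (snd u * fst v) else 0)"
  unfolding pmul_def bext_def lookup_lext sum_distrib_left
  by (intro sum.cong refl) (simp add: case_prod_unfold lookup_single when_def)

lemma lookup_pmul_unique: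
  assumes "\<And>u v. u \<in> keys p \<Longrightarrow> v \<in> keys r \<Longrightarrow>
    fst u + fst v = i + i' \<Longrightarrow> snd u + snd v = j + j' \<Longrightarrow> u = (i, j) \<and> v = (i', j')"
  shows "lookup (pmul q p r) (i + i', j + j')
    = lookup p (i, j) * lookup r (i', j') * q ^ (j * i')"
proof -
  let ?t = "lookup p (i, j) * lookup r (i', j') * q ^ (j * i')"
  have "lookup (pmul q p r) (i + i', j + j')
      = (\<Sum>u\<in>keys p. \<Sum>v\<in>keys r.
          if u = (i, j) then if v = (i', j') then ?t else 0 else 0)"
    unfolding lookup_pmul
  proof (intro sum.cong refl)
    fix u v
    assume "u \<in> keys p" "v \<in> keys r"
    then show "(if fst u + fst v = i + i' \<and> snd u + snd v = j + j'
        then lookup p u * lookup r v * q ^ (snd u * fst v) else 0)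
      = (if u = (i, j) then if v = (i', j') then ?t else 0 else 0)"
      by (cases "fst u + fst v = i + i' \<and> snd u + snd v = j + j'") (use assms[of u v] in auto)
  qed
  also have "\<dots> = (\<Sum>u\<in>keys p. if u = (i, j) then
      (\<Sum>v\<in>keys r. if v = (i', j') then ?t else 0) else 0)"
    by (intro sum.cong refl) auto
  also have "\<dots> = ?t"
    by (auto simp: in_keys_iff)
  finally show ?thesis .
qed

lemma lookup_pmul_single_left:
  "lookup (pmul q (single (a, b) s) p) (m, n)
    = (if a \<le> m \<and> b \<le> n then s * q ^ (b * (m - a)) * lookup p (m - a, n - b) else 0)"
  by (induct p rule: poly_mapping_single_add_induct)
    (auto simp: pmul_linear_right lookup_add lookup_single when_def distrib_left split: if_splits)

lemma lookup_pmul_single_right: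
  "lookup (pmul q p (single (a, b) s)) (m, n)
    = (if a \<le> m \<and> b \<le> n then s * q ^ ((n - b) * a) * lookup p (m - a, n - b) else 0)"
  by (induct p rule: poly_mapping_single_add_induct)
    (auto simp: pmul_linear_left lookup_add lookup_single when_def distrib_left split: if_splits)

text \<open>
  \<open>c\<close> is the coefficient of \<open>p\<close> at \<open>t\<close>, and no monomial of \<open>p\<close> exceeds \<open>t\<close> in the lexicographic
  order. The value \<open>c = 0\<close> is admitted, so that sums in which leading terms cancel, and summands with
  smaller leading monomials, need no case distinction.
\<close>

definition lead :: "qp_poly \<Rightarrow> nat \<times> nat \<Rightarrow> complex \<Rightarrow> bool" where
  "lead p t c \<longleftrightarrow> lookup p t = c \<and> (\<forall>u\<in>keys p. u \<le> t)"

lemma lead_add: "lead p t c \<Longrightarrow> lead r t d \<Longrightarrow> lead (p + r) t (c + d)"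
  using keys_add[of p r] by (auto simp: lead_def lookup_add)

lemma lead_cscale: "lead p t c \<Longrightarrow> lead (cscale d p) t (d * c)"
  using keys_cscale[of d p] by (auto simp: lead_def)

lemma lead_diff: "lead p t c \<Longrightarrow> lead r t d \<Longrightarrow> lead (p - r) t (c - d)"
  using lead_add[of p t c "cscale (- 1) r" "- 1 * d"] lead_cscale[of r t d "- 1"]
  by (simp add: cscale_minus_one)

lemma lead_below: "(\<And>u. u \<in> keys p \<Longrightarrow> u < t) \<Longrightarrow> lead p t 0"
  by (metis in_keys_iff lead_def less_imp_le less_irrefl)

lemma lead_unique: "lead p t c \<Longrightarrow> lead p t d \<Longrightarrow> c = d"
  by (simp add: lead_def)

lemma lead_single: "lead (single t c) t c"
  by (cases "c = 0") (simp_all add: lead_def)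

lemma lead_pmul:
  assumes "lead p (i, j) c" "lead r (i', j') d"
  shows "lead (pmul q p r) (i + i', j + j') (c * d * q ^ (j * i'))"
proof -
  have le: "(a, b) \<le> (i, j)" if "(a, b) \<in> keys p" for a b
    using assms(1) that by (auto simp: lead_def)
  have le': "(a, b) \<le> (i', j')" if "(a, b) \<in> keys r" for a b
    using assms(2) that by (auto simp: lead_def)
  have "lookup (pmul q p r) (i + i', j + j') = c * d * q ^ (j * i')"
    using assms by (subst lookup_pmul_unique) (auto simp: lead_def dest!: le le' split: if_splits)
  moreover have "u \<le> (i + i', j + j')" if u: "u \<in> keys (pmul q p r)" for u
  proof -
    obtain a b c d where "(a, b) \<in> keys p" "(c, d) \<in> keys r" "u = (a + c, b + d)"
      using subsetD[OF keys_bext u[unfolded pmul_def]] by (auto split: if_splits)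
    then show ?thesis
      using le[of a b] le'[of c d] by auto
  qed
  ultimately show ?thesis
    by (auto simp: lead_def)
qed

lemma lead_pmul_eq:
  assumes "lead p (i, j) a" "lead r (i', j') d" "m = i + i'" "n = j + j'" "C = a * d * q ^ (j * i')"
  shows "lead (pmul q p r) (m, n) C"
  unfolding assms(3-5) by (rule lead_pmul[OF assms(1,2)])

lemma ex_lead:
  assumes "p \<noteq> 0"
  shows "\<exists>t \<in> keys p. lead p t (lookup p t)"
  using assms by (intro bexI[of _ "Max (keys p)"]) (auto simp: lead_def)

text \<open>
  The largest and the smallest monomials (in the lexicographic order) of a product are the products
  of the largest and of the smallest monomials of its factors. If they coincide for the product, they
  coincide for both factors.
\<close>

lemma pmul_eq_single:
  assumes q: "q \<noteq> 0" and eq: "pmul q p r = single (m, n) c" and c: "c \<noteq> 0"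
  shows "\<exists>a b c d \<alpha> \<beta>. p = single (a, b) \<alpha> \<and> r = single (c, d) \<beta>"
proof -
  have "lookup (pmul q p r) (m, n) \<noteq> 0"
    using eq c by simp
  then have nz: "p \<noteq> 0" "r \<noteq> 0"
    by (auto simp: pmul_linear_left pmul_linear_right)
  have fin: "finite (keys p)" "finite (keys r)"
    "keys p \<noteq> {}" "keys r \<noteq> {}"
    using nz by simp_all
  obtain i j where T: "Max (keys p) = (i, j)" by fastforce
  obtain i' j' where T': "Max (keys r) = (i', j')" by fastforce
  obtain k l where B: "Min (keys p) = (k, l)" by fastforce
  obtain k' l' where B': "Min (keys r) = (k', l')" by fastforce
  have max: "(a, b) \<le> (i, j)" "(k, l) \<le> (a, b)" if "(a, b) \<in> keys p" for a b
    using Max_ge[OF fin(1) that] Min_le[OF fin(1) that] T B by simp_all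
  have max': "(a, b) \<le> (i', j')" "(k', l') \<le> (a, b)" if "(a, b) \<in> keys r" for a b
    using Max_ge[OF fin(2) that] Min_le[OF fin(2) that] T' B' by simp_all
  have "lookup (pmul q p r) (i + i', j + j')
      = lookup p (i, j) * lookup r (i', j') * q ^ (j * i')"
    by (rule lookup_pmul_unique) (use max(1) max'(1) in fastforce)
  also have "\<dots> \<noteq> 0"
    using Max_in[OF fin(1,3)] Max_in[OF fin(2,4)] T T' q by (simp add: in_keys_iff)
  finally have top: "(i + i', j + j') = (m, n)"
    unfolding eq by (auto simp: lookup_single when_def split: if_splits)
  have "lookup (pmul q p r) (k + k', l + l')
      = lookup p (k, l) * lookup r (k', l') * q ^ (l * k')"
    by (rule lookup_pmul_unique) (use max(2) max'(2) in fastforce)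
  also have "\<dots> \<noteq> 0"
    using Min_in[OF fin(1,3)] Min_in[OF fin(2,4)] B B' q by (simp add: in_keys_iff)
  finally have bot: "(k + k', l + l') = (m, n)"
    unfolding eq by (auto simp: lookup_single when_def split: if_splits)
  have "(k, l) \<le> (i, j)" "(k', l') \<le> (i', j')"
    using max(2)[of i j] max'(2)[of i' j'] Max_in[OF fin(1,3)] Max_in[OF fin(2,4)] T T' by simp_all
  then have kl: "(k, l) = (i, j)" "(k', l') = (i', j')"
    using top bot by auto
  have "u = (i, j)" if "u \<in> keys p" for u
    using max[of "fst u" "snd u"] that kl by (cases u) auto
  then have p: "p = single (i, j) (lookup p (i, j))"
    by (intro poly_mapping_eqI) (auto simp: lookup_single when_def in_keys_iff)
  have "u = (i', j')" if "u \<in> keys r" for u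
    using max'[of "fst u" "snd u"] that kl by (cases u) auto
  then have r: "r = single (i', j') (lookup r (i', j'))"
    by (intro poly_mapping_eqI) (auto simp: lookup_single when_def in_keys_iff)
  show ?thesis
    using p r by blast
qed

section \<open>Automorphisms of the quantum plane\<close>

lemma lookup_pmul_commute_pure:
  "lookup (pmul q p r) (m, 0) = lookup (pmul q r p) (m, 0)"
  "lookup (pmul q p r) (0, n) = lookup (pmul q r p) (0, n)"
  unfolding lookup_pmul by (subst sum.swap, intro sum.cong refl, auto)+

lemma pmul_mon_1_1_divides:
  assumes q: "q \<noteq> 0"
    and pure: "\<And>m. lookup p (m, 0) = 0" "\<And>n. lookup p (0, n) = 0"
  shows "\<exists>r. p = pmul q (mon 1 1) r"
proof -
  define W :: "qp_poly \<Rightarrow> qp_poly"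
    where "W = lext (\<lambda>(m, n). single (m - 1, n - 1) (inverse (q ^ (m - 1))))"
  have "p = pmul q (mon 1 1) (W p)"
  proof (rule clin_eq_on_keys[OF clin_id])
    show "clin (\<lambda>p. pmul q (mon 1 1) (W p))"
      unfolding W_def by (rule clin_compose[OF clin_pmul_right clin_lext])
    fix u
    assume u: "u \<in> keys p"
    obtain m n where mn: "u = (m, n)" by fastforce
    with u pure have "m \<noteq> 0" "n \<noteq> 0"
      by (auto simp: in_keys_iff) (metis neq0_conv)+
    then show "single u 1 = pmul q (mon 1 1) (W (single u 1))"
      using q by (simp add: mn W_def)
  qed
  then show ?thesis by blast
qed

definition diag :: "complex \<Rightarrow> complex \<Rightarrow> qp_poly \<Rightarrow> qp_poly" where
  "diag \<alpha> \<beta> = lext (\<lambda>(m, n). single (m, n) (\<alpha> ^ m * \<beta> ^ n))"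

lemma clin_diag: "clin (diag \<alpha> \<beta>)"
  unfolding diag_def by (rule clin_lext)

lemma diag_single [simp]:
  "diag \<alpha> \<beta> (single (m, n) c) = single (m, n) (c * (\<alpha> ^ m * \<beta> ^ n))"
  by (simp add: diag_def)

lemma lookup_diag: "lookup (diag \<alpha> \<beta> p) (m, n) = \<alpha> ^ m * \<beta> ^ n * lookup p (m, n)"
  by (induct p rule: poly_mapping_single_add_induct)
    (auto simp: clinD[OF clin_diag] lookup_add lookup_single when_def distrib_left split: if_splits)

lemma diag_diag [simp]: "diag \<alpha> \<beta> (diag \<gamma> \<delta> p) = diag (\<alpha> * \<gamma>) (\<beta> * \<delta>) p"
  by (rule poly_mapping_eqI) (simp add: lookup_diag power_mult_distrib split_paired_all)

lemma diag_one [simp]: "diag 1 1 p = p"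
  by (rule poly_mapping_eqI) (simp add: lookup_diag split_paired_all)

lemma pmul_eqI:
  assumes F: "\<And>p r. F (p + r) = F p + F r" "\<And>c p. F (cscale c p) = cscale c (F p)"
    and G: "\<And>p r. G (p + r) = G p + G r" "\<And>c p. G (cscale c p) = cscale c (G p)"
    and eq: "\<And>m n. F (mon m n) = G (mon m n)"
  shows "F p = G (p :: qp_poly)"
  by (rule clin_eq_on_keys[OF clinI clinI]) (auto simp: F G eq)

lemma diag_pmul: "diag \<alpha> \<beta> (pmul q p r) = pmul q (diag \<alpha> \<beta> p) (diag \<alpha> \<beta> r)"
proof -
  note lin = clinD(1,2)[OF clin_diag] pmul_linear_left(1,2) pmul_linear_right(1,2)
  have "diag \<alpha> \<beta> (pmul q (mon a b) r) = pmul q (diag \<alpha> \<beta> (mon a b)) (diag \<alpha> \<beta> r)" for a b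
    by (rule pmul_eqI[of "\<lambda>r. diag \<alpha> \<beta> (pmul q (mon a b) r)"
          "\<lambda>r. pmul q (diag \<alpha> \<beta> (mon a b)) (diag \<alpha> \<beta> r)"]) (simp_all add: lin power_add algebra_simps)
  then show ?thesis
    by (rule_tac pmul_eqI[of "\<lambda>p. diag \<alpha> \<beta> (pmul q p r)" "\<lambda>p. pmul q (diag \<alpha> \<beta> p) (diag \<alpha> \<beta> r)"])
      (simp_all only: lin)
qed

lemma mon_induct [case_names one y x]:
  assumes "P (mon 0 0)" and "\<And>n. P (mon 0 n) \<Longrightarrow> P (pmul q (mon 0 1) (mon 0 n))"
    and "\<And>m n. P (mon m n) \<Longrightarrow> P (pmul q (mon 1 0) (mon m n))"
  shows "P (mon m n)"
proof (induct m)
  case 0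
  show ?case
    by (induct n) (use assms(1,2) in \<open>simp_all\<close>)
next
  case (Suc m)
  then show ?case
    using assms(3)[of m n] by simp
qed

lemma multiplicative_eq_diag:
  assumes lin: "clin g" and mult: "\<And>a b. g (pmul q a b) = pmul q (g a) (g b)"
    and gens: "g (mon 0 0) = mon 0 0" "g (mon 1 0) = single (1, 0) \<alpha>"
      "g (mon 0 1) = single (0, 1) \<beta>"
  shows "g = diag \<alpha> \<beta>"
proof
  fix p
  show "g p = diag \<alpha> \<beta> p"
  proof (rule pmul_eqI[of g "diag \<alpha> \<beta>"])
    fix m n
    show "g (mon m n) = diag \<alpha> \<beta> (mon m n)"
      by (induct m n rule: mon_induct[where q = q])
        (simp_all only: mult gens diag_pmul, simp_all)
  qed (simp_all add: clinD[OF lin] clinD[OF clin_diag])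
qed

text \<open>
  Modulo \<open>x y\<close> the quantum plane is commutative, so commutators have no pure powers of \<open>x\<close> or \<open>y\<close>
  among their monomials and are divisible by \<open>x y\<close>. The element \<open>x y\<close> is a multiple of the commutator
  of \<open>y\<close> and \<open>x\<close>, hence its image under a multiplicative linear map is a multiple of a commutator.
\<close>

lemma automorphism_mon_1_1:
  assumes q: "q \<noteq> 0" "q \<noteq> 1" and lin: "clin g" and mult: "\<And>a b. g (pmul q a b) = pmul q (g a) (g b)"
  shows "\<exists>r. g (mon 1 1) = pmul q (mon 1 1) r"
proof (rule pmul_mon_1_1_divides[OF q(1)])
  let ?X = "g (mon 1 0)" and ?Y = "g (mon 0 1)"
  have "cscale q (g (mon 1 1)) = g (pmul q (mon 0 1) (mon 1 0))"
    by (simp flip: clinD(2)[OF lin])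
  then have YX: "cscale q (g (mon 1 1)) = pmul q ?Y ?X"
    by (simp only: mult)
  have XY: "g (mon 1 1) = pmul q ?X ?Y"
    by (simp flip: mult)
  have *: "q * lookup (g (mon 1 1)) w = lookup (pmul q ?Y ?X) w"
    "lookup (g (mon 1 1)) w = lookup (pmul q ?X ?Y) w" for w
    by (simp_all only: lookup_cscale[symmetric] YX XY[symmetric])
  show "lookup (g (mon 1 1)) (m, 0) = 0" for m
    using *[of "(m, 0)"] lookup_pmul_commute_pure(1)[of q ?X ?Y m] q by simp
  show "lookup (g (mon 1 1)) (0, n) = 0" for n
    using *[of "(0, n)"] lookup_pmul_commute_pure(2)[of q ?X ?Y n] q by simp
qed

text \<open>
  Both \<open>g(x y)\<close> and \<open>g'(x y)\<close> are multiples of \<open>x y\<close>, so the cofactor \<open>r\<close> in \<open>g(x y) = x y r\<close> is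
  invertible and therefore constant. Then \<open>g(x) g(y)\<close> is a multiple of the monomial \<open>x y\<close>, so
  \<open>g(x)\<close> and \<open>g(y)\<close> are monomials whose exponents \<open>(i, j)\<close> and \<open>(i', j')\<close> add up to \<open>(1, 1)\<close>.
  The relation between them reads \<open>j' i = 1 + j i'\<close>, as \<open>q\<close> is not a root of unity; it leaves only
  \<open>g(x) \<in> \<complex> x\<close> and \<open>g(y) \<in> \<complex> y\<close>.
\<close>

lemma automorphism_diagonal:
  assumes q: "q \<noteq> 0" and root: "\<forall>n::nat. n > 0 \<longrightarrow> q ^ n \<noteq> 1"
    and lin: "clin g" "clin g'"
    and mult: "\<And>a b. g (pmul q a b) = pmul q (g a) (g b)" "\<And>a b. g' (pmul q a b) = pmul q (g' a) (g' b)"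
    and one: "g (mon 0 0) = mon 0 0"
    and inv: "\<And>p. g (g' p) = p"
  shows "\<exists>\<alpha> \<beta>. \<alpha> \<noteq> 0 \<and> \<beta> \<noteq> 0 \<and> g = diag \<alpha> \<beta>"
proof -
  have single_eqD: "u = v \<and> c = d" if "single u c = single v d" "d \<noteq> 0"
    for u v :: "nat \<times> nat" and c d :: complex
    using that by (metis lookup_single_eq lookup_single_not_eq)
  have q1: "q \<noteq> 1"
    using root[rule_format, of 1] by simp
  obtain r s where r: "g (mon 1 1) = pmul q (mon 1 1) r" and s: "g' (mon 1 1) = pmul q (mon 1 1) s"
    using automorphism_mon_1_1[OF q q1 lin(1) mult(1)] automorphism_mon_1_1[OF q q1 lin(2) mult(2)] by blast
  have "mon 1 1 = pmul q (mon 1 1) (pmul q r (g s))"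
    using inv[of "mon 1 1"] unfolding s mult r by (simp add: pmul_assoc)
  then have "lookup (mon 1 1) (Suc m, Suc n)
      = lookup (pmul q (mon 1 1) (pmul q r (g s))) (Suc m, Suc n)" for m n
    by simp
  then have "q ^ m * lookup (pmul q r (g s)) (m, n) = (if m = 0 \<and> n = 0 then 1 else 0)" for m n
    by (simp add: lookup_pmul_single_left lookup_single when_def)
  then have "lookup (pmul q r (g s)) (m, n) = (if m = 0 \<and> n = 0 then 1 else 0)" for m n
    using q by (metis mult_eq_0_iff mult_1 power_0 power_not_zero)
  then have "pmul q r (g s) = mon 0 0"
    by (intro poly_mapping_eqI) (simp add: lookup_single when_def split_paired_all)
  then obtain a b \<gamma> a' b' \<delta> where rs: "r = single (a, b) \<gamma>" "g s = single (a', b') \<delta>"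
    and rs1: "pmul q r (g s) = mon 0 0"
    using pmul_eq_single[OF q, of r "g s" 0 0 1] by auto
  then have ab: "a = 0" "b = 0" "\<gamma> \<noteq> 0"
    using single_eqD[of "(a + a', b + b')" "\<gamma> * \<delta> * q ^ (b * a')" "(0, 0)" 1] by auto
  then have g11: "g (mon 1 1) = single (1, 1) \<gamma>"
    unfolding r rs(1) by simp
  have XY: "pmul q (g (mon 1 0)) (g (mon 0 1)) = single (1, 1) \<gamma>"
    using g11 by (simp flip: mult)
  have "g (pmul q (mon 0 1) (mon 1 0)) = cscale q (g (mon 1 1))"
    by (simp flip: clinD(2)[OF lin(1)])
  then have YX: "pmul q (g (mon 0 1)) (g (mon 1 0)) = single (1, 1) (q * \<gamma>)"
    by (simp only: mult g11 cscale_single)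
  obtain i j \<alpha> i' j' \<beta> where X: "g (mon 1 0) = single (i, j) \<alpha>" and Y: "g (mon 0 1) = single (i', j') \<beta>"
    using pmul_eq_single[OF q XY ab(3)] by blast
  have ij: "i + i' = 1" "j + j' = 1" "\<alpha> * \<beta> * q ^ (j * i') = \<gamma>"
    using single_eqD[OF XY[unfolded X Y pmul_single] ab(3)] by simp_all
  have "\<beta> * \<alpha> * q ^ (j' * i) = q * \<gamma>"
    using single_eqD[OF YX[unfolded X Y pmul_single]] ab(3) q by simp
  then have "\<alpha> * \<beta> * q ^ (j' * i) = \<alpha> * \<beta> * q ^ Suc (j * i')"
    unfolding ij(3)[symmetric] by (simp add: algebra_simps)
  moreover have nz: "\<alpha> \<noteq> 0" "\<beta> \<noteq> 0"
    using ij(3) ab(3) by auto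
  ultimately have pow: "q ^ (j' * i) = q ^ Suc (j * i')"
    by simp
  have "i = 1 \<and> j' = 1"
  proof (rule ccontr)
    assume "\<not> ?thesis"
    then have "j' * i = 0"
      using ij by auto
    then have "q ^ Suc (j * i') = 1"
      using pow by (simp only: power_0)
    then show False
      using root by blast
  qed
  then have "g = diag \<alpha> \<beta>"
    using ij X Y by (intro multiplicative_eq_diag[OF lin(1) mult(1) one]) auto
  then show ?thesis
    using nz by blast
qed

section \<open>Skew derivations\<close>

lemma pmul_zero [simp]: "pmul q 0 p = 0" "pmul q p 0 = 0"
  by (rule pmul_linear_left(3) pmul_linear_right(3))+

lemma skew_derivation_eq_zero:
  assumes lin: "clin d" and leibniz: "\<And>a b. d (pmul q a b) = pmul q (g a) (d b) + pmul q (d a) (h b)"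
    and gens: "d (mon 0 0) = 0" "d (mon 1 0) = 0" "d (mon 0 1) = 0"
  shows "d p = 0"
proof (rule clin_eq_on_keys[of d "\<lambda>_. 0"])
  fix u :: "nat \<times> nat"
  obtain m n where u: "u = (m, n)" by fastforce
  have "d (mon m n) = 0"
    by (induct m n rule: mon_induct[where q = q])
      (simp_all only: leibniz gens pmul_linear_left(3) pmul_linear_right(3) add_0_left)
  then show "d (single u 1) = 0"
    by (simp add: u)
qed (use lin in \<open>simp_all add: clin_def\<close>)

lemma skew_derivation_eqI:
  assumes lin: "clin d" "clin d'"
    and leibniz: "\<And>a b. d (pmul q a b) = pmul q (g a) (d b) + pmul q (d a) (h b)"
      "\<And>a b. d' (pmul q a b) = pmul q (g a) (d' b) + pmul q (d' a) (h b)"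
    and gens: "d (mon 0 0) = d' (mon 0 0)" "d (mon 1 0) = d' (mon 1 0)" "d (mon 0 1) = d' (mon 0 1)"
  shows "d = d'"
proof
  fix p
  have "d p - d' p = 0"
    by (rule skew_derivation_eq_zero[where d = "\<lambda>p. d p - d' p" and g = g and h = h and q = q])
      (simp_all only: clin_diff lin leibniz gens pmul_linear_left pmul_linear_right, simp_all)
  then show "d p = d' p" by simp
qed

text \<open>
  The analogues of inner derivations for the two product rules: whatever \<open>w\<close> and \<open>v\<close> are,
  \<open>inner_e\<close> satisfies the product rule of \<open>e\<close> and \<open>inner_f\<close> that of \<open>f\<close>.
\<close>

definition inner_e :: "complex \<Rightarrow> (qp_poly \<Rightarrow> qp_poly)
    \<Rightarrow> qp_poly \<Rightarrow> qp_poly \<Rightarrow> qp_poly" where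
  "inner_e q k w p = pmul q w (k p) - pmul q p w"

definition inner_f :: "complex \<Rightarrow> (qp_poly \<Rightarrow> qp_poly)
    \<Rightarrow> qp_poly \<Rightarrow> qp_poly \<Rightarrow> qp_poly" where
  "inner_f q k' v p = pmul q v p - pmul q (k' p) v"

lemma clin_inner_e: "clin k \<Longrightarrow> clin (inner_e q k w)"
  unfolding inner_e_def[abs_def] by (intro clin_diff clin_compose[OF clin_pmul_right] clin_pmul_left)

lemma clin_inner_f: "clin k' \<Longrightarrow> clin (inner_f q k' v)"
  unfolding inner_f_def[abs_def] by (intro clin_diff clin_compose[OF clin_pmul_left] clin_pmul_right)

lemma inner_e_pmul:
  assumes "\<And>a b. k (pmul q a b) = pmul q (k a) (k b)"
  shows "inner_e q k w (pmul q a b) = pmul q a (inner_e q k w b) + pmul q (inner_e q k w a) (k b)"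
  by (simp add: inner_e_def assms pmul_linear_left pmul_linear_right pmul_assoc)

lemma inner_f_pmul:
  assumes "\<And>a b. k' (pmul q a b) = pmul q (k' a) (k' b)"
  shows "inner_f q k' v (pmul q a b) = pmul q (inner_f q k' v a) b + pmul q (k' a) (inner_f q k' v b)"
  by (simp add: inner_f_def assms pmul_linear_left pmul_linear_right pmul_assoc)

text \<open>
  The sum \<open>1 + q^(-2) + \<dots>\<close> with \<open>m\<close> terms. The product rule of \<open>f\<close>, with \<open>f(x) = 1\<close>, \<open>f(y) = 0\<close> and
  \<open>k'(x) = q^(-2) x\<close>, makes \<open>f(x^m y^n)\<close> this multiple of \<open>x^(m-1) y^n\<close>.
\<close>

definition qint :: "complex \<Rightarrow> nat \<Rightarrow> complex" where
  "qint q m = (1 - inverse (q\<^sup>2) ^ m) / (1 - inverse (q\<^sup>2))"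

text \<open>
  For \<open>m = 0\<close> the truncated exponent \<open>m - 1\<close> is harmless because the coefficient vanishes.
\<close>

definition fder :: "complex \<Rightarrow> complex \<Rightarrow> qp_poly \<Rightarrow> qp_poly" where
  "fder q c = lext (\<lambda>(m, n). single (m - 1, n) (c * qint q m))"

lemma clin_fder: "clin (fder q c)"
  unfolding fder_def by (rule clin_lext)

lemma fder_single [simp]:
  "fder q c (single (m, n) d) = single (m - 1, n) (d * (c * qint q m))"
  by (simp add: fder_def)

lemma qint_0 [simp]: "qint q 0 = 0"
  by (simp add: qint_def)

lemma lookup_fder:
  "lookup (fder q c p) (m, n) = c * qint q (Suc m) * lookup p (Suc m, n)"
proof (induct p rule: poly_mapping_single_add_induct)
  case (single u d)
  obtain a b where u: "u = (a, b)" by fastforce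
  show ?case
    by (cases a) (auto simp: u lookup_single when_def)
qed (simp add: clinD[OF clin_fder] lookup_add distrib_left)

locale generic_q =
  fixes q :: complex
  assumes q0: "q \<noteq> 0" and root: "\<forall>n::nat. n > 0 \<longrightarrow> q ^ n \<noteq> 1"
begin

lemma pow_eq_1_iff: "q ^ n = 1 \<longleftrightarrow> n = 0"
  using root by auto

lemma pow_inject: "q ^ m = q ^ n \<longleftrightarrow> m = n"
proof
  have *: "m = n" if "q ^ m = q ^ n" "m \<le> n" for m n
  proof -
    have "q ^ m * q ^ (n - m) = q ^ m"
      using that by (metis le_add_diff_inverse power_add)
    then show ?thesis
      using q0 that by (simp add: pow_eq_1_iff)
  qed
  show "q ^ m = q ^ n \<Longrightarrow> m = n"
    using *[of m n] *[of n m] by (cases "m \<le> n") auto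
qed simp

lemma q_sq: "q\<^sup>2 \<noteq> 1" "inverse (q\<^sup>2) \<noteq> 1"
  using pow_eq_1_iff[of 2] by (simp_all add: inverse_eq_1_iff)

lemma q_inv: "inverse q \<noteq> q" "q - inverse q \<noteq> 0" "inverse q - q \<noteq> 0"
proof -
  show *: "inverse q \<noteq> q"
    using q_sq q0 by (metis power2_eq_square right_inverse)
  show "q - inverse q \<noteq> 0" "inverse q - q \<noteq> 0"
    using * by auto
qed

lemma qint_1 [simp]: "qint q (Suc 0) = 1" "qint q 1 = 1"
  using q_sq by (simp_all add: qint_def)

lemma qint_nonzero: "qint q (Suc m) \<noteq> 0"
proof -
  have "inverse (q\<^sup>2) ^ Suc m \<noteq> 1"
    by (simp only: power_inverse inverse_eq_1_iff power_mult[symmetric] pow_eq_1_iff) simp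
  then show ?thesis
    using q_sq by (simp add: qint_def)
qed

lemma qint_add: "qint q (a + c) = qint q a + inverse (q\<^sup>2) ^ a * qint q c"
proof -
  have "1 - x ^ (a + c) = (1 - x ^ a) + x ^ a * (1 - x ^ c)" for x :: complex
    by (simp add: power_add algebra_simps)
  then show ?thesis
    by (simp only: qint_def add_divide_distrib times_divide_eq_right)
qed

lemma fder_pmul:
  "fder q c (pmul q a b) = pmul q (fder q c a) b + pmul q (diag (inverse (q\<^sup>2)) q a) (fder q c b)"
proof -
  note lin = clinD(1,2)[OF clin_fder] clinD(1,2)[OF clin_diag] pmul_linear_left(1,2) pmul_linear_right(1,2) cscale_add
  have mon: "fder q c (pmul q (mon i j) (mon m n))
      = pmul q (fder q c (mon i j)) (mon m n) + pmul q (diag (inverse (q\<^sup>2)) q (mon i j)) (fder q c (mon m n))" for i j m n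
  proof (cases i)
    case 0
    show ?thesis
    proof (cases m)
      case (Suc m')
      then show ?thesis
        using 0 by (simp add: power_add algebra_simps)
    qed (use 0 in simp)
  next
    case (Suc i')
    show ?thesis
    proof (cases m)
      case m: (Suc m')
      have "fder q c (pmul q (mon i j) (mon m n))
        = single (i' + m, j + n) (q ^ (j * m) * (c * (qint q i + inverse (q\<^sup>2) ^ i * qint q m)))"
        using Suc qint_add[of i m] by simp
      also have "\<dots> = pmul q (fder q c (mon i j)) (mon m n) + pmul q (diag (inverse (q\<^sup>2)) q (mon i j)) (fder q c (mon m n))"
        using Suc m by (simp add: power_add algebra_simps flip: single_add)
      finally show ?thesis .
    qed (use Suc in simp)
  qed
  have "fder q c (pmul q (mon i j) b)
      = pmul q (fder q c (mon i j)) b + pmul q (diag (inverse (q\<^sup>2)) q (mon i j)) (fder q c b)" for i j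
    by (rule pmul_eqI[of "\<lambda>b. fder q c (pmul q (mon i j) b)"
          "\<lambda>b. pmul q (fder q c (mon i j)) b + pmul q (diag (inverse (q\<^sup>2)) q (mon i j)) (fder q c b)"])
      (simp_all only: mon, simp_all only: lin, simp_all add: algebra_simps)
  then show ?thesis
    by (rule_tac pmul_eqI[of "\<lambda>a. fder q c (pmul q a b)"
          "\<lambda>a. pmul q (fder q c a) b + pmul q (diag (inverse (q\<^sup>2)) q a) (fder q c b)"])
      (simp_all only: lin, simp_all add: algebra_simps)
qed

section \<open>The one-parameter family\<close>

text \<open>
  The operator \<open>e\<close> of the family is inner with \<open>w\<close> a multiple of \<open>x\<close>. The multiple is chosen such
  that \<open>w k(y) - y w = (q^(-1) - q) w y\<close> equals \<open>c^(-1) x y\<close>.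
\<close>

definition fam_e :: "complex \<Rightarrow> qp_poly \<Rightarrow> qp_poly" where
  "fam_e c = inner_e q (diag (q\<^sup>2) (inverse q)) (single (1, 0) (inverse c * inverse (inverse q - q)))"

lemma fam_e_single [simp]:
  "fam_e c (single (m, n) d) = single (Suc m, n)
    (d * (inverse c * inverse (inverse q - q) * ((q\<^sup>2) ^ m * inverse q ^ n - q ^ n)))"
  by (simp add: fam_e_def inner_e_def algebra_simps flip: single_diff)

lemma clin_fam_e: "clin (fam_e c)"
  unfolding fam_e_def by (rule clin_inner_e[OF clin_diag])

lemma family_action:
  assumes c: "c \<noteq> 0"
  shows "quantum_plane_action q (diag (q\<^sup>2) (inverse q)) (diag (inverse (q\<^sup>2)) q) (fam_e c) (fder q c)"
proof
  let ?k = "diag (q\<^sup>2) (inverse q)" and ?k' = "diag (inverse (q\<^sup>2)) q"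
  note lin = clinD(1,2)[OF clin_fder] clinD(1,2)[OF clin_diag] clinD(1,2)[OF clin_fam_e] cscale_add
  show "clin ?k" "clin ?k'" "clin (fam_e c)" "clin (fder q c)"
    by (rule clin_diag clin_fam_e clin_fder)+
  fix p a b
  show "?k' (?k p) = p" "?k (?k' p) = p"
    using q0 by simp_all
  show "?k (fam_e c p) = cscale (q\<^sup>2) (fam_e c (?k p))"
    by (rule pmul_eqI[of "\<lambda>p. ?k (fam_e c p)" "\<lambda>p. cscale (q\<^sup>2) (fam_e c (?k p))"])
      (simp_all add: lin mult_ac)
  show "?k (fder q c p) = cscale (inverse (q\<^sup>2)) (fder q c (?k p))"
  proof (rule pmul_eqI[of "\<lambda>p. ?k (fder q c p)" "\<lambda>p. cscale (inverse (q\<^sup>2)) (fder q c (?k p))"])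
    fix m n
    show "?k (fder q c (mon m n)) = cscale (inverse (q\<^sup>2)) (fder q c (?k (mon m n)))"
      using q0 by (cases m) (simp_all add: clinD(3)[OF clin_diag] field_simps)
  qed (simp_all add: lin mult_ac)
  show "fam_e c (fder q c p) + cscale (1 / (q - inverse q)) (?k' p)
      = fder q c (fam_e c p) + cscale (1 / (q - inverse q)) (?k p)"
  proof (rule pmul_eqI[of "\<lambda>p. fam_e c (fder q c p) + cscale (1 / (q - inverse q)) (?k' p)"
        "\<lambda>p. fder q c (fam_e c p) + cscale (1 / (q - inverse q)) (?k p)"])
    fix m n
    let ?A = "(q\<^sup>2) ^ m" and ?N = "inverse q ^ n" and ?B = "q ^ n"
    define \<tau> where "\<tau> = inverse (inverse q - q)"
    have \<tau>: "1 / (q - inverse q) = - \<tau>"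
      unfolding \<tau>_def by (metis inverse_eq_divide inverse_minus_eq minus_diff_eq)
    have qint: "qint q m * (1 - inverse (q\<^sup>2)) = 1 - inverse ?A"
      using q_sq by (simp add: qint_def power_inverse)
    have qint_Suc: "qint q (Suc m) = qint q m + inverse ?A"
      using qint_add[of m 1] by (simp add: power_inverse)
    \<comment> \<open>Since \<open>qint q (m + 1) = qint q m + q^(-2m)\<close>, the two sides differ by a multiple of
        \<open>qint q m * (1 - q^(-2)) - (1 - q^(-2m))\<close>.\<close>
    have coeff: "qint q m * (inverse (q\<^sup>2) * ?A * ?N - ?B) - inverse ?A * ?B
        = (?A * ?N - ?B) * qint q (Suc m) - ?A * ?N"
    proof -
      have "(?A * ?N - ?B) * qint q (Suc m) - ?A * ?N
          = (?A * ?N - ?B) * qint q m + (?A * inverse ?A) * ?N - inverse ?A * ?B - ?A * ?N"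
        by (simp add: qint_Suc algebra_simps)
      also have "?A * inverse ?A = 1"
        using q0 by simp
      also have "(?A * ?N - ?B) * qint q m + 1 * ?N - inverse ?A * ?B - ?A * ?N
          = (?A * ?N - ?B) * qint q m - inverse ?A * ?B - ?A * ?N * (1 - inverse ?A)"
        using q0 by (simp add: algebra_simps)
      also have "\<dots> = qint q m * (inverse (q\<^sup>2) * ?A * ?N - ?B) - inverse ?A * ?B"
        unfolding qint[symmetric] by (simp add: algebra_simps)
      finally show ?thesis ..
    qed
    have fe: "fam_e c (single (i, j) d) = single (Suc i, j)
        (d * (inverse c * \<tau> * ((q\<^sup>2) ^ i * inverse q ^ j - q ^ j)))" for i j d
      unfolding \<tau>_def by (rule fam_e_single)
    have left: "fam_e c (fder q c (mon m n))
        = single (m, n) (\<tau> * (qint q m * (inverse (q\<^sup>2) * ?A * ?N - ?B)))"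
    proof (cases m)
      case (Suc m')
      have "1 * (c * qint q (Suc m')) * (inverse c * \<tau> * ((q\<^sup>2) ^ m' * ?N - ?B))
          = \<tau> * (qint q (Suc m') * (inverse (q\<^sup>2) * (q\<^sup>2) ^ Suc m' * ?N - ?B))"
        using c q0 by (simp add: field_simps)
      then show ?thesis
        by (simp only: Suc fder_single fe diff_Suc_1)
    qed (simp add: clinD(3)[OF clin_fam_e])
    have right: "fder q c (fam_e c (mon m n)) = single (m, n) (\<tau> * ((?A * ?N - ?B) * qint q (Suc m)))"
    proof -
      have "1 * (inverse c * \<tau> * (?A * ?N - ?B)) * (c * qint q (Suc m))
          = \<tau> * ((?A * ?N - ?B) * qint q (Suc m))"
        using c by (simp add: field_simps)
      then show ?thesis
        by (simp only: fder_single fe diff_Suc_1)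
    qed
    have "\<tau> * (qint q m * (inverse (q\<^sup>2) * ?A * ?N - ?B)) - \<tau> * (inverse ?A * ?B)
        = \<tau> * ((?A * ?N - ?B) * qint q (Suc m)) - \<tau> * (?A * ?N)"
      using coeff by (simp only: right_diff_distrib[symmetric])
    then show "fam_e c (fder q c (mon m n)) + cscale (1 / (q - inverse q)) (?k' (mon m n))
        = fder q c (fam_e c (mon m n)) + cscale (1 / (q - inverse q)) (?k (mon m n))"
      unfolding left right \<tau> by (simp add: power_inverse flip: single_add)
  qed (simp_all add: lin mult_ac)
  show "?k (pmul q a b) = pmul q (?k a) (?k b)" "?k' (pmul q a b) = pmul q (?k' a) (?k' b)"
    by (rule diag_pmul)+
  show "fam_e c (pmul q a b) = pmul q a (fam_e c b) + pmul q (fam_e c a) (?k b)"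
    unfolding fam_e_def by (rule inner_e_pmul[OF diag_pmul])
  show "fder q c (pmul q a b) = pmul q (fder q c a) b + pmul q (?k' a) (fder q c b)"
    by (rule fder_pmul)
  show "?k (mon 0 0) = mon 0 0" "?k' (mon 0 0) = mon 0 0" "fam_e c (mon 0 0) = 0" "fder q c (mon 0 0) = 0"
    by simp_all
qed

end

section \<open>Classification\<close>

text \<open>
  The constant term of \<open>f(x)\<close> turns out to be the parameter of the family.
\<close>

locale special_action = generic_q q + quantum_plane_action q k k' e f
  for q k k' e f +
  fixes c :: complex
  assumes c: "lookup (f (mon 1 0)) (0, 0) = c" "c \<noteq> 0"
begin

abbreviation "X \<equiv> mon 1 0"
abbreviation "Y \<equiv> mon 0 1"

lemma YX: "pmul q Y X = cscale q (pmul q X Y)"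
  by simp

lemma k_eq: "k = diag (q\<^sup>2) (inverse q)" and k'_eq: "k' = diag (inverse (q\<^sup>2)) q"
proof -
  obtain \<alpha> \<beta> where nz: "\<alpha> \<noteq> 0" "\<beta> \<noteq> 0" and k: "k = diag \<alpha> \<beta>"
    using automorphism_diagonal[OF q0 root lin(1,2) k_pmul k'_pmul on_one(1) k_inv(2)] by blast
  have k': "k' p = diag (inverse \<alpha>) (inverse \<beta>) p" for p
    using k_inv(1)[of "diag (inverse \<alpha>) (inverse \<beta>) p"] nz unfolding k by simp
  have "k (f X) = cscale (inverse (q\<^sup>2) * \<alpha>) (f X)"
    using kf[of X] clinD(2)[OF lin(4), of \<alpha> X] by (simp add: k)
  \<comment> \<open>The constant term of \<open>f(x)\<close> is fixed by \<open>k\<close>, so its weight \<open>q^(-2) \<alpha>\<close> is 1.\<close>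
  from arg_cong[OF this, of "\<lambda>p. lookup p (0, 0)"]
  have \<alpha>: "\<alpha> = q\<^sup>2"
    using c q0 by (simp add: k lookup_diag field_simps)
  have "pmul q (f Y) X + pmul q (k' Y) (f X) = cscale q (pmul q (f X) Y + pmul q (k' X) (f Y))"
    using arg_cong[OF YX, of f] by (simp only: f_pmul clinD(2)[OF lin(4)])
  \<comment> \<open>At the monomial \<open>y\<close> only \<open>k'(y) f(x)\<close> and \<open>q f(x) y\<close> contribute, with \<open>\<beta>^(-1) c\<close> and \<open>q c\<close>.\<close>
  from arg_cong[OF this, of "\<lambda>p. lookup p (0, 1)"]
  have "inverse \<beta> = q"
    using c by (simp add: k' lookup_add lookup_pmul_single_left lookup_pmul_single_right)
  then have \<beta>: "\<beta> = inverse q"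
    by auto
  show "k = diag (q\<^sup>2) (inverse q)"
    using k \<alpha> \<beta> by simp
  show "k' = diag (inverse (q\<^sup>2)) q"
    using k' \<alpha> \<beta> by (simp add: fun_eq_iff)
qed

text \<open>
  The monomial \<open>x^m y^n\<close> has weight \<open>q^(2m-n)\<close>, and distinct powers of \<open>q\<close> are distinct, so an
  eigenvector of \<open>k\<close> lives on a line \<open>2 m - n = const\<close>.
\<close>

lemma weight_vector:
  assumes p: "k p = cscale (q ^ i * inverse q ^ j) p" and mn: "(m, n) \<in> keys p"
  shows "2 * m + j = n + i"
proof -
  have "(q\<^sup>2) ^ m * inverse q ^ n = q ^ i * inverse q ^ j"
    using arg_cong[OF p, of "\<lambda>p. lookup p (m, n)"] mn
    by (simp add: k_eq lookup_diag in_keys_iff)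
  then have "q ^ (2 * m) * q ^ j = q ^ i * q ^ n"
    using q0 by (simp add: field_simps flip: power_mult)
  then have "q ^ (2 * m + j) = q ^ (n + i)"
    by (simp add: power_add mult.commute)
  then show ?thesis
    by (simp add: pow_inject)
qed

lemma weights:
  "(m, n) \<in> keys (e X) \<Longrightarrow> 2 * m = n + 4"
  "(m, n) \<in> keys (e Y) \<Longrightarrow> 2 * m = n + 1"
  "(m, n) \<in> keys (f X) \<Longrightarrow> 2 * m = n"
  "(m, n) \<in> keys (f Y) \<Longrightarrow> 2 * m + 3 = n"
proof -
  have kX: "k X = cscale (q\<^sup>2) X" and kY: "k Y = cscale (inverse q) Y"
    by (simp_all add: k_eq)
  have "k (e X) = cscale (q ^ 4 * inverse q ^ 0) (e X)"
    unfolding ke kX clinD(2)[OF lin(3)] by (simp add: power2_eq_square power4_eq_xxxx mult.assoc)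
  then show "(m, n) \<in> keys (e X) \<Longrightarrow> 2 * m = n + 4"
    using weight_vector[of "e X" 4 0 m n] by simp
  have "k (e Y) = cscale (q ^ 1 * inverse q ^ 0) (e Y)"
    unfolding ke kY clinD(2)[OF lin(3)] using q0 by (simp add: power2_eq_square mult.assoc)
  then show "(m, n) \<in> keys (e Y) \<Longrightarrow> 2 * m = n + 1"
    using weight_vector[of "e Y" 1 0 m n] by simp
  have "k (f X) = cscale (q ^ 0 * inverse q ^ 0) (f X)"
    unfolding kf kX clinD(2)[OF lin(4)] using q0 by simp
  then show "(m, n) \<in> keys (f X) \<Longrightarrow> 2 * m = n"
    using weight_vector[of "f X" 0 0 m n] by simp
  have "k (f Y) = cscale (q ^ 0 * inverse q ^ 3) (f Y)"
    unfolding kf kY clinD(2)[OF lin(4)]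
    by (simp add: power2_eq_square power3_eq_cube mult.assoc)
  then show "(m, n) \<in> keys (f Y) \<Longrightarrow> 2 * m + 3 = n"
    using weight_vector[of "f Y" 0 3 m n] by simp
qed

text \<open>
  The inner operators send \<open>x^m y^(n-1)\<close> to a multiple of \<open>x^m y^n\<close> when they are evaluated at \<open>y\<close>:
  \<open>x^m y^(n-1) k(y) - y x^m y^(n-1) = (q^(-1) - q^m) x^m y^n\<close> and, with \<open>k'(y) = q y\<close>,
  \<open>x^m y^(n-1) y - k'(y) x^m y^(n-1) = (1 - q^(m+1)) x^m y^n\<close>. Dividing the coefficients of \<open>e(y)\<close> and
  \<open>f(y)\<close> by these factors yields \<open>w\<close> and \<open>v\<close>, for which the inner operators have the prescribed
  values at \<open>y\<close>.
\<close>

definition w :: qp_poly where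
  "w = lext (\<lambda>(m, n). single (m, n - 1) (inverse (inverse q - q ^ m))) (e Y)"

definition v :: qp_poly where
  "v = lext (\<lambda>(m, n). single (m, n - 1) (inverse (1 - q ^ Suc m))) (f Y)"

lemma keys_w: "(m, n) \<in> keys w \<Longrightarrow> 2 * m = n + 2"
proof -
  assume "(m, n) \<in> keys w"
  then obtain i j where ij: "(i, j) \<in> keys (e Y)" and "m = i" "n = j - 1"
    unfolding w_def by (auto dest!: subsetD[OF keys_lext] split: if_splits)
  moreover have "j \<noteq> 0"
    using weights(2)[OF ij] by presburger
  ultimately show ?thesis
    using weights(2)[OF ij] by simp
qed

lemma keys_v: "(m, n) \<in> keys v \<Longrightarrow> 2 * m + 2 = n"
proof -
  assume "(m, n) \<in> keys v"
  then obtain i j where ij: "(i, j) \<in> keys (f Y)" and "m = i" "n = j - 1"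
    unfolding v_def by (auto dest!: subsetD[OF keys_lext] split: if_splits)
  then show ?thesis
    using weights(4)[OF ij] by simp
qed

lemma e_Y: "e Y = inner_e q k w Y"
proof -
  define W :: "qp_poly \<Rightarrow> qp_poly" where "W = lext (\<lambda>(m, n). single (m, n - 1) (inverse (inverse q - q ^ m)))"
  have "e Y = (\<lambda>p. pmul q (W p) (k Y) - pmul q Y (W p)) (e Y)"
  proof (rule clin_eq_on_keys[OF clin_id])
    show "clin (\<lambda>p. pmul q (W p) (k Y) - pmul q Y (W p))"
      unfolding W_def by (intro clin_diff clin_compose[OF clin_pmul_left clin_lext] clin_compose[OF clin_pmul_right clin_lext])
    fix u
    assume u: "u \<in> keys (e Y)"
    obtain m n where mn: "u = (m, n)" by fastforce
    have "2 * m = n + 1"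
      using u weights(2) mn by simp
    then obtain n' where n: "n = Suc n'"
      by (cases n) auto
    have "inverse q - q ^ m \<noteq> 0"
      using pow_eq_1_iff[of "Suc m"] q0 by (auto simp: field_simps)
    moreover have "inverse (inverse q - q ^ m) * inverse q - q ^ m * inverse (inverse q - q ^ m)
        = inverse (inverse q - q ^ m) * (inverse q - q ^ m)"
      by (simp add: algebra_simps)
    ultimately show "single u 1 = pmul q (W (single u 1)) (k Y) - pmul q Y (W (single u 1))"
      by (simp add: mn n W_def k_eq mult.commute flip: single_diff)
  qed
  then show ?thesis
    by (simp add: inner_e_def w_def W_def)
qed

lemma f_Y: "f Y = inner_f q k' v Y"
proof -
  define V :: "qp_poly \<Rightarrow> qp_poly" where "V = lext (\<lambda>(m, n). single (m, n - 1) (inverse (1 - q ^ Suc m)))"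
  have "f Y = (\<lambda>p. pmul q (V p) Y - pmul q (k' Y) (V p)) (f Y)"
  proof (rule clin_eq_on_keys[OF clin_id])
    show "clin (\<lambda>p. pmul q (V p) Y - pmul q (k' Y) (V p))"
      unfolding V_def by (intro clin_diff clin_compose[OF clin_pmul_left clin_lext] clin_compose[OF clin_pmul_right clin_lext])
    fix u
    assume u: "u \<in> keys (f Y)"
    obtain m n where mn: "u = (m, n)" by fastforce
    have "2 * m + 3 = n"
      using u weights(4) mn by simp
    then obtain n' where n: "n = Suc n'"
      by (cases n) auto
    have "1 - q ^ Suc m \<noteq> 0"
      using pow_eq_1_iff[of "Suc m"] by (simp del: power_Suc)
    moreover have "inverse (1 - q ^ Suc m) - q * q ^ m * inverse (1 - q ^ Suc m)
        = inverse (1 - q ^ Suc m) * (1 - q ^ Suc m)"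
      by (simp add: algebra_simps)
    ultimately show "single u 1 = pmul q (V (single u 1)) Y - pmul q (k' Y) (V (single u 1))"
      by (simp add: mn n V_def k'_eq mult_ac flip: single_diff)
  qed
  then show ?thesis
    by (simp add: inner_f_def v_def V_def)
qed

text \<open>
  Polynomials that commute with \<open>y\<close> do not involve \<open>x\<close>. Differences of skew derivations with the
  same value at \<open>y\<close> lead to such polynomials, see the next two lemmas.
\<close>

lemma commuting_with_y_free_of_x:
  assumes "pmul q Y p = pmul q p Y"
  shows "lookup p (Suc m, n) = 0"
proof -
  have "q ^ Suc m * lookup p (Suc m, n) = lookup p (Suc m, n)"
    using arg_cong[OF assms, of "\<lambda>p. lookup p (Suc m, Suc n)"]
    by (simp add: lookup_pmul_single_left lookup_pmul_single_right del: power_Suc)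
  then show ?thesis
    using pow_eq_1_iff[of "Suc m"] by (simp del: power_Suc)
qed

text \<open>
  The difference \<open>d\<close> of the two sides vanishes at \<open>y\<close>, so \<open>y x = q x y\<close> says that \<open>d(x)\<close> commutes with
  \<open>y\<close> and only involves \<open>y\<close>. But \<open>e(x)\<close> has no monomials free of \<open>x\<close>, by their weight, and
  \<open>w k(x) - x w\<close> has none either.
\<close>

lemma e_eq: "e = inner_e q k w"
proof (rule skew_derivation_eqI[where g = "\<lambda>a. a" and h = k and q = q])
  show "e X = inner_e q k w X"
  proof -
    define d where "d = (\<lambda>p. e p - inner_e q k w p)"
    have d_lin: "clin d"
      unfolding d_def by (intro clin_diff lin clin_inner_e)
    have d_pmul: "d (pmul q a b) = pmul q a (d b) + pmul q (d a) (k b)" for a b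
      by (simp add: d_def e_pmul inner_e_pmul k_pmul pmul_linear_left pmul_linear_right)
    have dY: "d Y = 0"
      unfolding d_def e_Y[symmetric] by simp
    have "pmul q Y (d X) = cscale q (pmul q (d X) (k Y))"
      using arg_cong[OF YX, of d] by (simp only: d_pmul clinD(2)[OF d_lin] dY pmul_zero add_0_left add_0_right)
    also have "k Y = cscale (inverse q) Y"
      by (simp add: k_eq)
    finally have "pmul q Y (d X) = pmul q (d X) Y"
      using q0 by (simp only: pmul_linear_right cscale_cscale) simp
    then have "lookup (d X) (Suc m, n) = 0" for m n
      by (rule commuting_with_y_free_of_x)
    moreover have "lookup (d X) (0, n) = 0" for n
    proof -
      have "(0, n) \<notin> keys (e X)"
        using weights(1)[of 0 n] by auto
      then show ?thesis
        by (simp add: d_def inner_e_def k_eq lookup_minus in_keys_iff lookup_pmul_single_left lookup_pmul_single_right)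
    qed
    ultimately have "d X = 0"
      by (intro poly_mapping_eqI) (metis lookup_zero not0_implies_Suc surj_pair)
    then show ?thesis
      by (simp add: d_def)
  qed
  show "e Y = inner_e q k w Y"
    by (rule e_Y)
qed (simp_all add: lin clin_inner_e e_pmul inner_e_pmul k_pmul on_one inner_e_def[of _ _ _ "mon 0 0"])

text \<open>
  As in the previous lemma, \<open>d(x)\<close> only involves \<open>y\<close>, where \<open>d\<close> is the difference of \<open>f\<close> and the
  inner operator. All monomials of \<open>v x - k'(x) v\<close> involve \<open>x\<close>, and those of \<open>f(x)\<close> have weight 1,
  which leaves the constant one.
\<close>

lemma f_eq: "f = (\<lambda>p. fder q c p + inner_f q k' v p)"
proof (rule skew_derivation_eqI[where g = k' and h = "\<lambda>b. b" and q = q])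
  show "f X = fder q c X + inner_f q k' v X"
  proof -
    define d where "d = (\<lambda>p. f p - inner_f q k' v p)"
    have d_lin: "clin d"
      unfolding d_def by (intro clin_diff lin clin_inner_f)
    have d_pmul: "d (pmul q a b) = pmul q (d a) b + pmul q (k' a) (d b)" for a b
      by (simp add: d_def f_pmul inner_f_pmul k'_pmul pmul_linear_left pmul_linear_right)
    have dY: "d Y = 0"
      unfolding d_def f_Y[symmetric] by simp
    have "pmul q (k' Y) (d X) = cscale q (pmul q (d X) Y)"
      using arg_cong[OF YX, of d] by (simp only: d_pmul clinD(2)[OF d_lin] dY pmul_zero add_0_left add_0_right)
    also have "k' Y = cscale q Y"
      by (simp add: k'_eq)
    finally have "cscale (inverse q) (cscale q (pmul q Y (d X))) = cscale (inverse q) (cscale q (pmul q (d X) Y))"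
      by (simp only: pmul_linear_left)
    then have "pmul q Y (d X) = pmul q (d X) Y"
      using q0 by simp
    then have "lookup (d X) (Suc m, n) = 0" for m n
      by (rule commuting_with_y_free_of_x)
    moreover have "lookup (d X) (0, n) = (if n = 0 then c else 0)" for n
    proof -
      have "lookup (f X) (0, n) = (if n = 0 then c else 0)"
        using weights(3)[of 0 n] c by (auto simp: in_keys_iff)
      then show ?thesis
        by (simp add: d_def inner_f_def k'_eq lookup_minus lookup_pmul_single_left lookup_pmul_single_right)
    qed
    ultimately have "lookup (d X) (m, n) = lookup (single (0, 0) c) (m, n)" for m n
      by (cases m) (simp_all add: lookup_single when_def)
    then have "d X = single (0, 0) c"
      by (intro poly_mapping_eqI) (metis surj_pair)
    then show ?thesis
      by (simp add: d_def algebra_simps)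
  qed
  show "f (pmul q a b) = pmul q (k' a) (f b) + pmul q (f a) b" for a b
    by (simp add: f_pmul add.commute)
  show "fder q c (pmul q a b) + inner_f q k' v (pmul q a b)
      = pmul q (k' a) (fder q c b + inner_f q k' v b) + pmul q (fder q c a + inner_f q k' v a) b" for a b
    by (simp add: inner_f_pmul[OF k'_pmul] fder_pmul k'_eq[symmetric] pmul_linear_left pmul_linear_right algebra_simps)
  show "f Y = fder q c Y + inner_f q k' v Y"
    unfolding f_Y[symmetric] by simp
qed (simp_all add: lin clin_add clin_fder clin_inner_f on_one inner_f_def[of _ _ _ "mon 0 0"])

lemma e_apply: "e p = pmul q w (k p) - pmul q p w"
  using fun_cong[OF e_eq, of p] unfolding inner_e_def .

lemma f_apply: "f p = fder q c p + inner_f q k' v p"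
  by (rule fun_cong[OF f_eq])

lemma ef_Y: "e (f Y) + cscale (q / (q - inverse q)) Y = f (e Y) + cscale (inverse q / (q - inverse q)) Y"
  using ef[of Y] by (simp add: k_eq k'_eq)

lemma w_nonzero: "w \<noteq> 0"
proof
  assume "w = 0"
  then have "e p = 0" for p
    by (simp add: e_apply)
  then have "cscale (q / (q - inverse q)) Y = cscale (inverse q / (q - inverse q)) Y"
    using ef_Y clinD(3)[OF lin(4)] by simp
  then have "q / (q - inverse q) = inverse q / (q - inverse q)"
    by (metis cscale_single inj_single injD mult.right_neutral)
  then show False
    using q_inv by simp
qed

text \<open>
  The identity between the leading coefficients of \<open>e(f(y))\<close> and \<open>f(e(y))\<close>, with
  \<open>p = q^J\<close>, \<open>u = q^M\<close> and \<open>z = q^(JM)\<close>. Multiplied by \<open>q^3\<close>, the difference of its two sides splits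
  into factors.
\<close>

lemma leading_coefficient_factorization:
  fixes p u z :: complex
  assumes "(1 - q * u) * (inverse q ^ 3 * z\<^sup>2 - z\<^sup>2 * u\<^sup>2 * p ^ 3 * q ^ 3)
      = (inverse q - q * p) * (z\<^sup>2 * u\<^sup>2 * p\<^sup>2 * q\<^sup>2 - inverse q * z\<^sup>2 * u)"
  shows "z\<^sup>2 * (1 - q ^ 3 * u * p) * (1 - q ^ 4 * u\<^sup>2 * p\<^sup>2) = 0"
proof -
  define i where "i = inverse q"
  have "q * i = 1"
    using q0 by (simp add: i_def)
  have "z\<^sup>2 * (1 - q ^ 3 * u * p) * (1 - q ^ 4 * u\<^sup>2 * p\<^sup>2)
      = (1 - q * u) * ((q * i) ^ 3 * z\<^sup>2 - q ^ 3 * (z\<^sup>2 * u\<^sup>2 * p ^ 3 * q ^ 3))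
        - (q * i - q * (q * p)) * (q\<^sup>2 * (z\<^sup>2 * u\<^sup>2 * p\<^sup>2 * q\<^sup>2) - q * i * (q * z\<^sup>2 * u))"
    unfolding \<open>q * i = 1\<close> by (simp add: algebra_simps eval_nat_numeral)
  also have "\<dots> = q ^ 3 * ((1 - q * u) * (i ^ 3 * z\<^sup>2 - z\<^sup>2 * u\<^sup>2 * p ^ 3 * q ^ 3)
      - (i - q * p) * (z\<^sup>2 * u\<^sup>2 * p\<^sup>2 * q\<^sup>2 - i * z\<^sup>2 * u))"
    by (simp add: algebra_simps eval_nat_numeral)
  also have "\<dots> = 0"
    using assms by (simp add: i_def)
  finally show ?thesis .
qed

text \<open>
  Let \<open>s x^(J+1) y^(2J)\<close> and \<open>r x^M y^(2M+2)\<close> be the leading terms of \<open>w\<close> and \<open>v\<close>; the weights force this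
  shape of the exponents. The leading terms of \<open>e(f(y))\<close> and \<open>f(e(y))\<close> have the same monomial, and
  this monomial is larger than \<open>y\<close>, so their coefficients agree by the commutation relation of \<open>e\<close>
  and \<open>f\<close>. The agreement makes \<open>q\<close> a root of unity.
\<close>

lemma v_zero: "v = 0"
proof (rule ccontr)
  assume "v \<noteq> 0"
  then obtain t where t: "t \<in> keys v" "lead v t (lookup v t)"
    using ex_lead by blast
  obtain M n where "t = (M, n)"
    by (cases t)
  with t keys_v[of M n] have M: "(M, 2 * M + 2) \<in> keys v"
      "lead v (M, 2 * M + 2) (lookup v (M, 2 * M + 2))"
    by simp_all
  define r where "r = lookup v (M, 2 * M + 2)"
  have v: "lead v (M, 2 * M + 2) r" and r: "r \<noteq> 0"
    using M by (simp_all add: r_def in_keys_iff)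
  obtain t' where t': "t' \<in> keys w" "lead w t' (lookup w t')"
    using ex_lead[OF w_nonzero] by blast
  obtain a b where "t' = (a, b)"
    by (cases t')
  with t' have ab: "(a, b) \<in> keys w" "lead w (a, b) (lookup w (a, b))"
    by simp_all
  define J where "J = a - 1"
  have J: "a = J + 1" "b = 2 * J"
    using keys_w[OF ab(1)] by (auto simp: J_def)
  define s where "s = lookup w (J + 1, 2 * J)"
  have w: "lead w (J + 1, 2 * J) s" and s: "s \<noteq> 0"
    using ab unfolding J by (simp_all add: s_def in_keys_iff)
  have Y: "lead Y (0, 1) 1"
    by (rule lead_single)
  have kY: "k Y = cscale (inverse q) Y" and k'Y: "k' Y = cscale q Y"
    by (simp_all add: k_eq k'_eq)
  have fY_eq: "f Y = pmul q v Y - cscale q (pmul q Y v)"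
    by (rule trans[OF f_Y]) (simp only: inner_f_def k'Y pmul_linear_left)
  have eY_eq: "e Y = cscale (inverse q) (pmul q w Y) - pmul q Y w"
    by (rule trans[OF e_Y]) (simp only: inner_e_def kY pmul_linear_right)
  define A B where "A = r - q * (r * q ^ M)" and "B = inverse q * s - s * q ^ (J + 1)"
  have fY: "lead (f Y) (M, 2 * M + 3) A"
    unfolding fY_eq A_def
    by (intro lead_diff lead_cscale lead_pmul_eq[OF v Y] lead_pmul_eq[OF Y v]) simp_all
  have eY: "lead (e Y) (J + 1, 2 * J + 1) B"
    unfolding eY_eq B_def
    by (intro lead_diff lead_cscale lead_pmul_eq[OF w Y] lead_pmul_eq[OF Y w]) simp_all
  let ?t = "(M + J + 1, 2 * M + 2 * J + 3)"
  have kfY: "k (f Y) = cscale (inverse q ^ 3) (f Y)"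
    unfolding kf kY clinD(2)[OF lin(4)] by (simp add: power2_eq_square power3_eq_cube mult.assoc)
  have keY: "k (e Y) = cscale q (e Y)"
    unfolding ke kY clinD(2)[OF lin(3)] using q0 by (simp add: power2_eq_square mult.assoc)
  have "cscale (inverse q) (e Y) = k' (cscale (inverse q) (k (e Y)))"
    by (simp add: clinD(2)[OF lin(2)] k_inv)
  also have "\<dots> = k' (e Y)"
    unfolding keY cscale_cscale using q0 by simp
  finally have k'eY: "k' (e Y) = cscale (inverse q) (e Y)" ..
  have efY_eq: "e (f Y) = cscale (inverse q ^ 3) (pmul q w (f Y)) - pmul q (f Y) w"
    by (rule trans[OF e_apply]) (simp only: kfY pmul_linear_right)
  have efY: "lead (e (f Y)) ?t (inverse q ^ 3 * (s * A * q ^ (2 * J * M)) - A * s * q ^ ((2 * M + 3) * (J + 1)))"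
    unfolding efY_eq
    by (intro lead_diff lead_cscale lead_pmul_eq[OF w fY] lead_pmul_eq[OF fY w]) simp_all
  have inner: "inner_f q k' v (e Y) = pmul q v (e Y) - cscale (inverse q) (pmul q (e Y) v)"
    by (simp only: inner_f_def k'eY pmul_linear_left)
  have "lead (inner_f q k' v (e Y)) ?t (r * B * q ^ ((2 * M + 2) * (J + 1)) - inverse q * (B * r * q ^ ((2 * J + 1) * M)))"
    unfolding inner
    by (intro lead_diff lead_cscale lead_pmul_eq[OF v eY] lead_pmul_eq[OF eY v]) simp_all
  \<comment> \<open>The operator \<open>fder\<close> lowers the exponent of \<open>x\<close>, so it does not reach the monomial \<open>?t\<close>.\<close>
  moreover have "lead (fder q c (e Y)) ?t 0"
  proof (rule lead_below)
    fix u
    assume "u \<in> keys (fder q c (e Y))"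
    moreover obtain i j where u: "u = (i, j)" by fastforce
    ultimately have "(Suc i, j) \<in> keys (e Y)"
      by (auto simp: in_keys_iff lookup_fder)
    then have "(Suc i, j) \<le> (J + 1, 2 * J + 1)"
      using eY unfolding lead_def by blast
    then show "u < ?t"
      by (auto simp: u)
  qed
  ultimately have feY: "lead (f (e Y)) ?t (0 + (r * B * q ^ ((2 * M + 2) * (J + 1)) - inverse q * (B * r * q ^ ((2 * J + 1) * M))))"
    unfolding f_apply[of "e Y"] by (intro lead_add)
  have low: "lead (cscale d Y) ?t 0" for d
    by (rule lead_below) (auto split: if_splits)
  have main: "inverse q ^ 3 * (s * A * q ^ (2 * J * M)) - A * s * q ^ ((2 * M + 3) * (J + 1))
      = r * B * q ^ ((2 * M + 2) * (J + 1)) - inverse q * (B * r * q ^ ((2 * J + 1) * M))"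
    using lead_unique[OF lead_add[OF efY low[of "q / (q - inverse q)"], unfolded ef_Y]
        lead_add[OF feY low[of "inverse q / (q - inverse q)"]]] by simp
  define p u z where "p = q ^ J" and "u = q ^ M" and "z = q ^ (J * M)"
  have pows: "q ^ (2 * J * M) = z\<^sup>2" "q ^ ((2 * M + 3) * (J + 1)) = z\<^sup>2 * u\<^sup>2 * p ^ 3 * q ^ 3"
    "q ^ ((2 * M + 2) * (J + 1)) = z\<^sup>2 * u\<^sup>2 * p\<^sup>2 * q\<^sup>2" "q ^ ((2 * J + 1) * M) = z\<^sup>2 * u"
    unfolding p_def u_def z_def power_mult[symmetric] power_add[symmetric]
    by (simp_all add: algebra_simps)
  have A: "A = r * (1 - q * u)" and B: "B = s * (inverse q - q * p)"
    by (simp_all add: A_def B_def p_def u_def algebra_simps)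
  have "s * r * ((1 - q * u) * (inverse q ^ 3 * z\<^sup>2 - z\<^sup>2 * u\<^sup>2 * p ^ 3 * q ^ 3))
      = inverse q ^ 3 * (s * A * z\<^sup>2) - A * s * (z\<^sup>2 * u\<^sup>2 * p ^ 3 * q ^ 3)"
    unfolding A by (simp add: algebra_simps)
  also have "\<dots> = r * B * (z\<^sup>2 * u\<^sup>2 * p\<^sup>2 * q\<^sup>2) - inverse q * (B * r * (z\<^sup>2 * u))"
    using main unfolding pows .
  also have "\<dots> = s * r * ((inverse q - q * p) * (z\<^sup>2 * u\<^sup>2 * p\<^sup>2 * q\<^sup>2 - inverse q * z\<^sup>2 * u))"
    unfolding B by (simp add: algebra_simps)
  finally have "s * r * ((1 - q * u) * (inverse q ^ 3 * z\<^sup>2 - z\<^sup>2 * u\<^sup>2 * p ^ 3 * q ^ 3))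
      = s * r * ((inverse q - q * p) * (z\<^sup>2 * u\<^sup>2 * p\<^sup>2 * q\<^sup>2 - inverse q * z\<^sup>2 * u))" .
  then have "z\<^sup>2 * (1 - q ^ 3 * u * p) * (1 - q ^ 4 * u\<^sup>2 * p\<^sup>2) = 0"
    using r s by (intro leading_coefficient_factorization) simp
  then have "1 - q ^ 3 * u * p = 0 \<or> 1 - q ^ 4 * u\<^sup>2 * p\<^sup>2 = 0"
    using q0 by (simp add: z_def)
  moreover have "q ^ 3 * u * p = q ^ (3 + M + J)" "q ^ 4 * u\<^sup>2 * p\<^sup>2 = q ^ (4 + M * 2 + J * 2)"
    by (simp_all only: p_def u_def power_add power_mult)
  ultimately show False
    using pow_eq_1_iff[of "3 + M + J"] pow_eq_1_iff[of "4 + M * 2 + J * 2"] by auto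
qed

lemma f_eq_fder: "f = fder q c"
  by (rule ext, subst f_apply) (simp add: v_zero inner_f_def)

text \<open>
  Now \<open>f(y) = 0\<close>, and the commutation relation at \<open>y\<close> becomes \<open>f(e(y)) = y\<close>. The operator \<open>f\<close>
  multiplies each monomial that involves \<open>x\<close> by a nonzero factor, and \<open>e(y)\<close> has no others.
\<close>

lemma e_Y_value: "e Y = single (1, 1) (inverse c)"
proof (rule poly_mapping_eqI)
  fix t :: "nat \<times> nat"
  obtain m n where t: "t = (m, n)" by fastforce
  have "f Y = 0"
    by (simp add: f_eq_fder)
  then have "fder q c (e Y) = cscale (q / (q - inverse q)) Y - cscale (inverse q / (q - inverse q)) Y"
    using ef_Y clinD(3)[OF lin(3)] by (simp add: f_eq_fder algebra_simps)
  also have "\<dots> = cscale (q / (q - inverse q) - inverse q / (q - inverse q)) Y"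
    by (simp flip: single_diff)
  also have "\<dots> = Y"
    using q_inv by (simp flip: diff_divide_distrib)
  finally have fe: "c * qint q (Suc i) * lookup (e Y) (Suc i, n) = lookup Y (i, n)" for i
    by (simp flip: lookup_fder)
  show "lookup (e Y) t = lookup (single (1, 1) (inverse c)) t"
  proof (cases m)
    case 0
    then have "t \<notin> keys (e Y)"
      using weights(2)[of 0 n] by (auto simp: t)
    then show ?thesis
      using 0 by (simp add: t in_keys_iff lookup_single when_def)
  next
    case (Suc i)
    then show ?thesis
      using fe[of i] qint_nonzero[of i] c(2)
      by (cases "i = 0") (auto simp: t lookup_single when_def field_simps)
  qed
qed

lemma e_eq_fam_e: "e = fam_e c"
proof -
  have w: "w = single (1, 0) (inverse c * inverse (inverse q - q))"
    unfolding w_def e_Y_value by simp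
  have "inner_e q k w = fam_e c"
    by (simp only: w fam_e_def k_eq)
  then show ?thesis
    by (rule trans[OF e_eq])
qed

end

section \<open>The family exhausts the special structures\<close>

context generic_q
begin

definition fam :: "complex \<Rightarrow> qp_action" where
  "fam c = quantum_plane_action.action q (diag (q\<^sup>2) (inverse q)) (diag (inverse (q\<^sup>2)) q) (fam_e c) (fder q c)"

lemma fam_structure: "c \<noteq> 0 \<Longrightarrow> fam c \<in> qp_structures q"
  unfolding fam_def by (rule quantum_plane_action.action_structure[OF family_action q0])

lemma op_of_fam:
  assumes "c \<noteq> 0"
  shows "op_of q (fam c) (uk q) = diag (q\<^sup>2) (inverse q)" "op_of q (fam c) (ukinv q) = diag (inverse (q\<^sup>2)) q"
    "op_of q (fam c) (ue q) = fam_e c" "op_of q (fam c) (uf q) = fder q c"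
  unfolding fam_def by (rule quantum_plane_action.action_gen[OF family_action[OF assms]])+

lemma structure_eq_fam:
  assumes \<pi>: "\<pi> \<in> qp_structures q"
    and c: "lookup (coords q (\<pi> (uf q) (qx q))) (0, 0) = c" "c \<noteq> 0"
  shows "\<pi> = fam c"
proof -
  have "op_of q \<pi> (uf q) (mon 1 0) = coords q (\<pi> (uf q) (qx q))"
    unfolding op_of_def of_coords_gen ..
  with c have c': "lookup (op_of q \<pi> (uf q) (mon 1 0)) (0, 0) = c"
    by (simp only:)
  interpret A: quantum_plane_action q "op_of q \<pi> (uk q)" "op_of q \<pi> (ukinv q)" "op_of q \<pi> (ue q)" "op_of q \<pi> (uf q)"
    by (rule qp_structures_action[OF \<pi> q0])
  interpret special_action q "op_of q \<pi> (uk q)" "op_of q \<pi> (ukinv q)" "op_of q \<pi> (ue q)" "op_of q \<pi> (uf q)" c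
    by unfold_locales (rule c' c(2))+
  have ext: "\<rho> \<in> extensional (carrier (uq q))" if "\<rho> \<in> qp_structures q" for \<rho>
    using that by (simp add: qp_structures_def module_algebra_structures_def)
  note fam = fam_structure[OF c(2)]
  show ?thesis
    by (rule uq_rep_eqI[OF qp_structures_uq_rep[OF \<pi>] qp_structures_uq_rep[OF fam] ext[OF \<pi>] ext[OF fam]])
      (simp_all only: op_of_fam[OF c(2)] k_eq k'_eq e_eq_fam_e f_eq_fder)
qed

lemma fam_values_coords:
  assumes c: "c \<noteq> 0"
  shows "fam c (uk q) (qx q) = of_coords q (single (1, 0) (q\<^sup>2))" (is ?kx)
    and "fam c (uk q) (qy q) = of_coords q (single (0, 1) (inverse q))" (is ?ky)
    and "fam c (ue q) (qx q) = of_coords q (single (2, 0) (- q * inverse c))" (is ?ex)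
    and "fam c (ue q) (qy q) = of_coords q (single (1, 1) (inverse c))" (is ?ey)
    and "fam c (uf q) (qx q) = of_coords q (single (0, 0) c)" (is ?fx)
    and "fam c (uf q) (qy q) = of_coords q 0" (is ?fy)
proof -
  interpret uq_rep q "fam c"
    by (rule qp_structures_uq_rep[OF fam_structure[OF c]])
  note val = rep_eq_op[OF _ qx_qy_closed(1), unfolded coords_gen] rep_eq_op[OF _ qx_qy_closed(2), unfolded coords_gen]
  have "inverse (inverse q - q) * (q\<^sup>2 - 1) = - q"
    using q_inv q0 by (simp add: field_simps power2_eq_square)
  then have eX: "fam_e c (mon 1 0) = single (2, 0) (- q * inverse c)"
    by (simp add: numeral_2_eq_2 mult.assoc mult.commute[of _ "inverse c"])
  have eY: "fam_e c (mon 0 1) = single (1, 1) (inverse c)"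
    using q_inv by (simp add: mult.assoc)
  show ?kx ?ky ?ex ?ey ?fx ?fy
    unfolding val[OF uq_gen_closed(1)] val[OF uq_gen_closed(3)] val[OF uq_gen_closed(4)] op_of_fam[OF c] eX eY
    by simp_all
qed

lemma family_values_fam:
  assumes c: "c \<noteq> 0"
  shows "family_values q c (fam c)"
proof -
  interpret A: calgebra "qplane q" by (rule calgebra_qplane)
  have x2: "qx q [^]\<^bsub>qplane q\<^esub> (2::nat) = of_coords q (mon 2 0)"
    using qx_pow_qy_pow[of q 2 0] by simp
  have xy: "qx q \<otimes>\<^bsub>qplane q\<^esub> qy q = of_coords q (mon 1 1)"
    using of_coords_pmul[of q "mon 1 0" "mon 0 1"] unfolding of_coords_gen by simp
  have sm: "d \<odot>\<^bsub>qplane q\<^esub> of_coords q (mon m n) = of_coords q (single (m, n) d)" for d m n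
    by (simp flip: of_coords_cscale)
  show ?thesis
    unfolding family_values_def Let_def fam_values_coords[OF c] x2 xy
    unfolding of_coords_gen[symmetric] of_coords_one[symmetric] of_coords_zero[symmetric] sm
    by (intro conjI refl)
qed

lemma family_values_unique:
  assumes "\<pi> \<in> qp_structures q" "family_values q c \<pi>" "c \<noteq> 0"
  shows "\<pi> = fam c"
proof (rule structure_eq_fam[OF assms(1) _ assms(3)])
  have "\<pi> (uf q) (qx q) = c \<odot>\<^bsub>qplane q\<^esub> \<one>\<^bsub>qplane q\<^esub>"
    using assms(2) by (simp add: family_values_def Let_def)
  also have "\<dots> = of_coords q (single (0, 0) c)"
    by (simp flip: of_coords_one of_coords_cscale)
  finally show "lookup (coords q (\<pi> (uf q) (qx q))) (0, 0) = c"
    by simp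
qed

lemma family_structure_eq: "c \<noteq> 0 \<Longrightarrow> family_structure q c = fam c"
  unfolding family_structure_def
  by (rule the_equality) (auto simp: fam_structure family_values_fam family_values_unique)

lemma special_structures_eq: "special_structures q = fam ` (UNIV - {0})"
proof (intro equalityI subsetI)
  fix \<pi>
  assume \<pi>: "\<pi> \<in> special_structures q"
  then have str: "\<pi> \<in> qp_structures q" and nz: "qp_proj q 0 (\<pi> (uf q) (qx q)) \<noteq> \<zero>\<^bsub>qplane q\<^esub>"
    by (simp_all add: special_structures_def)
  interpret uq_rep q \<pi>
    by (rule qp_structures_uq_rep[OF str])
  have "lookup (coords q (\<pi> (uf q) (qx q))) (0, 0) \<noteq> 0"
    using nz by (simp add: qp_proj_eq_zero_iff rep_closed)
  then show "\<pi> \<in> fam ` (UNIV - {0})"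
    using structure_eq_fam[OF str refl] by blast
next
  fix \<pi>
  assume "\<pi> \<in> fam ` (UNIV - {0})"
  then obtain c where c: "c \<noteq> 0" and \<pi>: "\<pi> = fam c" by blast
  have sum_1: "m + n = 1 \<longleftrightarrow> (m, n) = (0, 1) \<or> (m, n) = (1, 0)" for m n :: nat
    by auto
  show "\<pi> \<in> special_structures q"
    unfolding special_structures_def \<pi> mem_Collect_eq fam_values_coords[OF c]
      qp_proj_eq_zero_iff[OF of_coords_closed] coords_of_coords sum_1
    using c fam_structure[OF c] by (auto simp: lookup_single when_def)
qed

lemma inj_fam: "inj_on fam (UNIV - {0})"
proof (rule inj_onI)
  fix c d :: complex
  assume cd: "c \<in> UNIV - {0}" "d \<in> UNIV - {0}" "fam c = fam d"
  then have "of_coords q (single (0, 0) c) = of_coords q (single (0, 0) d)"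
    using fam_values_coords(5)[of c] fam_values_coords(5)[of d] by simp
  then show "c = d"
    by (simp add: inj_eq)
qed

text \<open>
  The automorphism rescales \<open>x\<close> by \<open>c / d\<close> and fixes \<open>y\<close>; conjugation with it turns \<open>f(x) = c\<close> into
  \<open>f(x) = d\<close>. That it intertwines the two actions is checked for the generators.
\<close>

lemma isomorphic_fam:
  assumes c: "c \<noteq> 0" and d: "d \<noteq> 0"
  shows "isomorphic_structures (uq q) (qplane q) (fam c) (fam d)"
proof -
  interpret C: uq_rep q "fam c" by (rule qp_structures_uq_rep[OF fam_structure[OF c]])
  interpret D: uq_rep q "fam d" by (rule qp_structures_uq_rep[OF fam_structure[OF d]])
  define \<Psi> where "\<Psi> X = of_coords q (diag (c / d) 1 (coords q X))" for X
  note lin = clinD(1,2)[OF clin_diag]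
  have coords_\<Psi>: "coords q (\<Psi> X) = diag (c / d) 1 (coords q X)" for X
    by (simp add: \<Psi>_def)
  have \<Psi>_hom: "\<Psi> \<in> alg_hom (qplane q) (qplane q)"
    by (rule alg_homI)
      (simp_all add: \<Psi>_def coords_simps diag_pmul lin of_coords_pmul of_coords_add of_coords_cscale of_coords_one)
  have bij: "bij_betw \<Psi> (carrier (qplane q)) (carrier (qplane q))"
    by (rule bij_betwI[of _ _ _ "\<lambda>X. of_coords q (diag (d / c) 1 (coords q X))"])
      (use c d in \<open>auto simp: \<Psi>_def\<close>)
  have "\<forall>p. diag (c / d) 1 (op_of q (fam c) h p) = op_of q (fam d) h (diag (c / d) 1 p)"
    if "h \<in> carrier (uq q)" for h
    using that
  proof (induct rule: uq_induct)
    case e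
    have "diag (c / d) 1 (fam_e c p) = fam_e d (diag (c / d) 1 p)" for p
    proof (rule pmul_eqI[of "\<lambda>p. diag (c / d) 1 (fam_e c p)" "\<lambda>p. fam_e d (diag (c / d) 1 p)"])
      fix m n
      have "1 * (inverse c * x * y) * ((c / d) ^ Suc m * 1 ^ n)
          = 1 * ((c / d) ^ m * 1 ^ n) * (inverse d * x * y)" for x y :: complex
        using c d by (simp add: field_simps)
      then show "diag (c / d) 1 (fam_e c (mon m n)) = fam_e d (diag (c / d) 1 (mon m n))"
        by (simp only: fam_e_single diag_single)
    qed (simp_all add: lin clinD(1,2)[OF clin_fam_e])
    then show ?case
      by (simp add: op_of_fam c d)
  next
    case f
    have "diag (c / d) 1 (fder q c p) = fder q d (diag (c / d) 1 p)" for p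
    proof (rule pmul_eqI[of "\<lambda>p. diag (c / d) 1 (fder q c p)" "\<lambda>p. fder q d (diag (c / d) 1 p)"])
      fix m n
      show "diag (c / d) 1 (fder q c (mon m n)) = fder q d (diag (c / d) 1 (mon m n))"
        using c d by (cases m) (simp_all add: clinD(3)[OF clin_diag] mult_ac)
    qed (simp_all add: lin clinD(1,2)[OF clin_fder])
    then show ?case
      by (simp add: op_of_fam c d)
  qed (simp_all add: op_of_fam c d mult.commute C.op_one D.op_one C.op_mult D.op_mult C.op_add D.op_add
      C.op_smult D.op_smult lin)
  then have intertwine: "\<Psi> (fam c h X) = fam d h (\<Psi> X)" if "h \<in> carrier (uq q)" "X \<in> carrier (qplane q)" for h X
    using that by (simp add: \<Psi>_def C.rep_eq_op D.rep_eq_op)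
  have "\<Psi> (fam c h (inv_into (carrier (qplane q)) \<Psi> a)) = fam d h a"
    if "h \<in> carrier (uq q)" "a \<in> carrier (qplane q)" for h a
  proof -
    have a: "a \<in> \<Psi> ` carrier (qplane q)"
      using bij that(2) by (simp add: bij_betw_def)
    then show ?thesis
      using intertwine[OF that(1) inv_into_into[OF a]] by (simp only: f_inv_into_f[OF a])
  qed
  then show ?thesis
    unfolding isomorphic_structures_def using \<Psi>_hom bij by blast
qed

end

theorem theorem11:
  fixes q :: complex
  assumes "q \<noteq> 0"
    and "\<forall>n::nat. n > 0 \<longrightarrow> q ^ n \<noteq> 1"
  shows "(\<forall>c. c \<noteq> 0 \<longrightarrow> (\<exists>!\<pi>. \<pi> \<in> qp_structures q \<and> family_values q c \<pi>)) \<and>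
    bij_betw (family_structure q) (UNIV - {0}) (special_structures q) \<and>
    (\<forall>\<pi> \<in> special_structures q. \<forall>\<rho> \<in> special_structures q.
      isomorphic_structures (uq q) (qplane q) \<pi> \<rho>) \<and>
    (\<forall>\<pi> \<in> special_structures q.
      isomorphic_structures (uq q) (qplane q) \<pi> (family_structure q 1))"
proof -
  interpret generic_q q
    using assms by unfold_locales
  show ?thesis
  proof (intro conjI allI impI ballI)
    fix c :: complex
    assume "c \<noteq> 0"
    then show "\<exists>!\<pi>. \<pi> \<in> qp_structures q \<and> family_values q c \<pi>"
      using fam_structure family_values_fam family_values_unique by blast
  next
    have "bij_betw fam (UNIV - {0}) (special_structures q)"
      unfolding special_structures_eq using inj_fam by (rule inj_on_imp_bij_betw)
    then show "bij_betw (family_structure q) (UNIV - {0}) (special_structures q)"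
      by (rule bij_betw_cong[THEN iffD1, rotated]) (simp add: family_structure_eq)
  qed (auto simp: special_structures_eq family_structure_eq intro!: isomorphic_fam)
qed

end
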